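(* Let $\mathbb{K}$ be a field, let $n\ge 2$, and let $G=([n],E)$ be the $(n-1)$-star graph. For $d=n$, the divisor class group of the Lovász-Saks-Schrijver ring $R_G(n)$ is $$\operatorname{Cl}(R_G(n))\cong\mathbb{Z}.$$
   Context: Let $[n]=\{1,\dots,n\}$ and let $G=([n],E)$ be a finite simple graph. For a field $\mathbb{K}$ and a positive integer $d$, put $S=\mathbb{K}[y_{ij} \mid i\in[n],\ j\in[d]]$ and, for each edge $e=\{i,j\}\in E$, $f_e=\sum_{k=1}^{d} y_{ik}y_{jk}$. The Lovász-Saks-Schrijver ideal is $L_G(d)=(f_e\mid e\in E)\subseteq S$ and the Lovász-Saks-Schrijver (LSS) ring is $R_G(d)=S/L_G(d)$. The $(n-1)$-star graph is the graph with $n$ vertices and $n-1$ edges, all of them adjacent to the same vertex (the central vertex, say vertex $n$); i.e. $E=\{\{i,n\}\mid 1\le i\le n-1\}$. $\operatorname{Cl}(R)$ denotes the divisor class group of a normal Noetherian domain $R$. *)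

theory Defs
  imports "HOL-Algebra.Algebra" "HOL-Library.Poly_Mapping"
begin

section \<open>Polynomial rings in a set of variables\<close>

text \<open>
  A monomial is a finitely supported exponent vector \<open>'v \<Rightarrow>\<^sub>0 nat\<close>, and a polynomial over \<open>'k\<close> is a
  finitely supported family of coefficients indexed by monomials; multiplication on
  \<open>\<Rightarrow>\<^sub>0\<close> is convolution.  The polynomial ring in the variables \<open>V\<close> consists of the polynomials
  all of whose monomials only involve variables from \<open>V\<close>.
\<close>

type_synonym ('v, 'k) mpoly = "('v \<Rightarrow>\<^sub>0 nat) \<Rightarrow>\<^sub>0 'k"

definition mpoly_ring :: "'k::comm_ring_1 itself \<Rightarrow> 'v set \<Rightarrow> ('v, 'k) mpoly ring" where
  "mpoly_ring K V =
     \<lparr>carrier = {p. \<forall>m\<in>Poly_Mapping.keys p. Poly_Mapping.keys m \<subseteq> V},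
      monoid.mult = (*), one = 1, ring.zero = 0, ring.add = (+)\<rparr>"

definition mvar :: "'v \<Rightarrow> ('v, 'k::comm_ring_1) mpoly" where
  "mvar v = Poly_Mapping.single (Poly_Mapping.single v 1) 1"

section \<open>Lovasz-Saks-Schrijver rings\<close>

text \<open>A graph on the vertex set \<open>{1..n}\<close> is given by its set of edges, each edge being a two-element
  set of vertices.  The variable \<open>y_ij\<close> is \<open>mvar (i, j)\<close>.\<close>

definition LSS_poly :: "nat \<Rightarrow> nat \<Rightarrow> nat \<Rightarrow> (nat \<times> nat, 'k::comm_ring_1) mpoly" where
  "LSS_poly d i j = (\<Sum>k=1..d. mvar (i, k) * mvar (j, k))"

definition LSS_base :: "'k::comm_ring_1 itself \<Rightarrow> nat \<Rightarrow> nat \<Rightarrow> (nat \<times> nat, 'k) mpoly ring" where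
  "LSS_base K n d = mpoly_ring K ({1..n} \<times> {1..d})"

definition LSS_ideal ::
    "'k::comm_ring_1 itself \<Rightarrow> nat \<Rightarrow> nat set set \<Rightarrow> nat \<Rightarrow> (nat \<times> nat, 'k) mpoly set" where
  "LSS_ideal K n E d = Idl\<^bsub>LSS_base K n d\<^esub> {LSS_poly d i j | i j. {i, j} \<in> E}"

definition LSS_ring ::
    "'k::comm_ring_1 itself \<Rightarrow> nat \<Rightarrow> nat set set \<Rightarrow> nat \<Rightarrow> (nat \<times> nat, 'k) mpoly set ring" where
  "LSS_ring K n E d = LSS_base K n d Quot LSS_ideal K n E d"

definition star_edges :: "nat \<Rightarrow> nat set set" where
  "star_edges n = {{i, n} | i. 1 \<le> i \<and> i \<le> n - 1}"

section \<open>Normal domains and divisor class groups\<close>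

text \<open>
  Elements of the fraction field of a domain are written as \<open>a / b\<close> with \<open>b \<noteq> \<zero>\<close>.  The equation
  below is the equation of integral dependence \<open>x^m + \<Sum>i<m. c i * x^i = \<zero>\<close> of \<open>x = a / b\<close>,
  multiplied by \<open>b^m\<close>; the conclusion says that \<open>a / b\<close> lies in \<open>R\<close>.
\<close>

definition normal_domain :: "('a, 'b) ring_scheme \<Rightarrow> bool" where
  "normal_domain R \<longleftrightarrow> domain R \<and>
     (\<forall>a\<in>carrier R. \<forall>b\<in>carrier R - {\<zero>\<^bsub>R\<^esub>}. \<forall>m::nat. \<forall>c\<in>{..<m} \<rightarrow> carrier R.
        a [^]\<^bsub>R\<^esub> m \<oplus>\<^bsub>R\<^esub> (\<Oplus>\<^bsub>R\<^esub>i\<in>{..<m}. c i \<otimes>\<^bsub>R\<^esub> a [^]\<^bsub>R\<^esub> i \<otimes>\<^bsub>R\<^esub> b [^]\<^bsub>R\<^esub> (m - i)) = \<zero>\<^bsub>R\<^esub>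
        \<longrightarrow> (\<exists>r\<in>carrier R. a = r \<otimes>\<^bsub>R\<^esub> b))"

text \<open>In a domain \<open>{\<zero>}\<close> is the least prime ideal, so a prime has height one iff it is
  nonzero and no prime lies strictly between \<open>{\<zero>}\<close> and it.\<close>

definition height_one_primes :: "('a, 'b) ring_scheme \<Rightarrow> 'a set set" where
  "height_one_primes R =
     {P. primeideal P R \<and> P \<noteq> {\<zero>\<^bsub>R\<^esub>} \<and>
         (\<forall>Q. primeideal Q R \<and> Q \<subset> P \<longrightarrow> Q = {\<zero>\<^bsub>R\<^esub>})}"

text \<open>
  For a height one prime \<open>P\<close> of a normal Noetherian domain the localization \<open>R_P\<close> is a discrete
  valuation ring with maximal ideal \<open>P R_P\<close>.  Its valuation at a nonzero \<open>a \<in> R\<close> is the largest \<open>k\<close>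
  with \<open>a \<in> (P R_P)^k = P^k R_P\<close>, that is, with \<open>s a \<in> P^k\<close> for some \<open>s \<in> R - P\<close>.
  The monoid structure on ideals has neutral element \<open>carrier R\<close>, so \<open>P^0 = R\<close>.
\<close>

definition prime_val :: "('a, 'b) ring_scheme \<Rightarrow> 'a set \<Rightarrow> 'a \<Rightarrow> nat" where
  "prime_val R P a =
     (GREATEST k::nat. \<exists>s\<in>carrier R - P. s \<otimes>\<^bsub>R\<^esub> a \<in> P [^]\<^bsub>ideals_set R\<^esub> k)"

definition divisor_group :: "('a, 'b) ring_scheme \<Rightarrow> ('a set \<Rightarrow>\<^sub>0 int) monoid" where
  "divisor_group R = free_Abelian_group (height_one_primes R)"

text \<open>The divisors \<open>div (a / b) = \<Sum>P. (v_P a - v_P b) P\<close> of the nonzero elements \<open>a / b\<close> of the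
  fraction field.\<close>

definition principal_divisors :: "('a, 'b) ring_scheme \<Rightarrow> ('a set \<Rightarrow>\<^sub>0 int) set" where
  "principal_divisors R =
     {D \<in> carrier (divisor_group R). \<exists>a\<in>carrier R - {\<zero>\<^bsub>R\<^esub>}. \<exists>b\<in>carrier R - {\<zero>\<^bsub>R\<^esub>}.
        \<forall>P\<in>height_one_primes R.
          Poly_Mapping.lookup D P = int (prime_val R P a) - int (prime_val R P b)}"

definition class_group :: "('a, 'b) ring_scheme \<Rightarrow> ('a set \<Rightarrow>\<^sub>0 int) set monoid" where
  "class_group R = divisor_group R Mod principal_divisors R"

end

theory Submission
  imports Defs "HOL-Library.Product_Lexorder" "HOL-Computational_Algebra.Polynomial"
    "HOL-Computational_Algebra.Fraction_Field" "Jordan_Normal_Form.Determinant"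
begin

text \<open>
  Write \<open>x\<^sub>k\<close> for the variable \<open>y\<^sub>n\<^sub>k\<close> of the central vertex.  The star ring \<open>R\<close> is the polynomial ring
  in all \<open>y\<^sub>i\<^sub>k\<close> modulo the relations \<open>f\<^sub>i = \<Sum>k. y\<^sub>i\<^sub>k x\<^sub>k\<close> for \<open>i < n\<close>; it says that the generic
  \<open>(n - 1) \<times> n\<close> matrix with rows \<open>1, \<dots>, n - 1\<close> kills the vector \<open>x\<close>.  Once \<open>x\<^sub>j\<close> is inverted, the
  relation \<open>f\<^sub>i\<close> can be solved for \<open>y\<^sub>i\<^sub>j\<close>, so \<open>R[1/x\<^sub>j]\<close> is a localized polynomial ring and hence
  factorial.  The divisor of \<open>x\<^sub>n\<close> has two components, both of multiplicity one: the prime generated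
  by \<open>x\<^sub>1, \<dots>, x\<^sub>n\<close> (the vector vanishes), and the prime on which \<open>x\<^sub>n\<close> and the minor
  \<open>det (y\<^sub>i\<^sub>k)\<close>, \<open>i, k < n\<close>, vanish.  By Nagata's argument the class group is generated by these two
  primes, and the only relation is that their sum is the divisor of \<open>x\<^sub>n\<close>; so it is \<open>\<int>\<close>.

  The proof replaces localizations by valuations.  A domain with a family of discrete valuations
  that decides divisibility, has finite support, and separates its members is treated in the locale
  \<open>krull_family\<close>: its height one primes are the centers of the valuations, \<open>prime_val\<close> is the
  given valuation, the domain is normal, and \<open>class_group_integers\<close> is Nagata's argument.  For the
  star ring the valuations are orders of vanishing in polynomial rings.  The substitution
  \<open>chart n j\<close> is the solution of the relations for \<open>y\<^sub>i\<^sub>j\<close> with denominators cleared.  The orders of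
  \<open>chart n n a\<close> at prime polynomials other than \<open>x\<^sub>n\<close> give all valuations except two.  The order of
  \<open>chart n (n - 1) a\<close> at \<open>x\<^sub>n\<close> belongs to the minor, and the least degree in \<open>x\<^sub>1, \<dots>, x\<^sub>n\<close>, read off
  from \<open>graded_chart\<close>, to the vanishing of the vector.

  All facts about the relations come from \<open>star_ideal_saturated\<close>.  Truncate the forms to their
  first \<open>q\<close> columns.  If there are fewer than \<open>q\<close> of them, \<open>x\<^sub>q\<close> is not a zero divisor modulo the
  forms; this makes the charts injective on \<open>R\<close> and \<open>R\<close> a domain.  For exactly \<open>q\<close> of them the same
  holds on elements that vanish for \<open>x\<^sub>1 = \<dots> = x\<^sub>q = 0\<close>; this gives \<open>divisible_by_center_var\<close>, which
  says that the ideal of \<open>x\<^sub>n\<close> is the intersection of the two special primes.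

  Two classical theorems about polynomial rings over a field are needed as well: they are factorial
  (\<open>gauss\<close>, \<open>mpoly_prime_factorization\<close>) and Noetherian (\<open>hilbert_basis\<close>,
  \<open>mpolys_noetherian\<close>).  Both are proved by adjoining one variable at a time.  All these rings are
  subsets of one type, so the statements are about subsets closed under the ring operations.
\<close>

section \<open>Evaluation of polynomials\<close>

abbreviation (input) "pm_lookup \<equiv> Poly_Mapping.lookup"
abbreviation (input) "pm_keys \<equiv> Poly_Mapping.keys"
abbreviation (input) "pm_single \<equiv> Poly_Mapping.single"

definition mconst :: "'k::comm_ring_1 \<Rightarrow> ('v, 'k) mpoly" where
  "mconst c = pm_single 0 c"

definition eval_mon :: "('v \<Rightarrow> 'a::comm_ring_1) \<Rightarrow> ('v \<Rightarrow>\<^sub>0 nat) \<Rightarrow> 'a" where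
  "eval_mon \<sigma> m = (\<Prod>v\<in>pm_keys m. \<sigma> v ^ pm_lookup m v)"

text \<open>
  The coefficients are mapped by an arbitrary \<open>h\<close>, so that the values may lie in another ring, such as
  univariate polynomials or fractions.
\<close>

definition meval :: "('k::comm_ring_1 \<Rightarrow> 'a::comm_ring_1) \<Rightarrow> ('v \<Rightarrow> 'a) \<Rightarrow> ('v, 'k) mpoly \<Rightarrow> 'a" where
  "meval h \<sigma> p = (\<Sum>m\<in>pm_keys p. h (pm_lookup p m) * eval_mon \<sigma> m)"

definition mpolys :: "'v set \<Rightarrow> ('v, 'k::comm_ring_1) mpoly set" where
  "mpolys V = {p. \<forall>m\<in>pm_keys p. pm_keys m \<subseteq> V}"

lemma sum_of_monomials: "p = (\<Sum>m\<in>pm_keys p. pm_single m (pm_lookup p m))"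
  by (rule poly_mapping_eqI)
     (simp add: lookup_sum lookup_single when_def in_keys_iff sum.delta' cong: if_cong)

lemma eval_mon_superset:
  assumes "finite F" "pm_keys m \<subseteq> F"
  shows "eval_mon \<sigma> m = (\<Prod>v\<in>F. \<sigma> v ^ pm_lookup m v)"
  unfolding eval_mon_def using assms
  by (intro prod.mono_neutral_left) (auto simp: in_keys_iff)

lemma eval_mon_0 [simp]: "eval_mon \<sigma> 0 = 1"
  by (simp add: eval_mon_def)

lemma eval_mon_add: "eval_mon \<sigma> (m + m') = eval_mon \<sigma> m * eval_mon \<sigma> m'"
proof -
  let ?F = "pm_keys m \<union> pm_keys m'"
  have "eval_mon \<sigma> (m + m') = (\<Prod>v\<in>?F. \<sigma> v ^ pm_lookup (m + m') v)"
    by (rule eval_mon_superset) (use keys_add[of m m'] in auto)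
  also have "\<dots> = (\<Prod>v\<in>?F. \<sigma> v ^ pm_lookup m v) * (\<Prod>v\<in>?F. \<sigma> v ^ pm_lookup m' v)"
    by (simp add: lookup_add power_add prod.distrib)
  also have "\<dots> = eval_mon \<sigma> m * eval_mon \<sigma> m'"
    by (subst (1 2) eval_mon_superset[symmetric]) auto
  finally show ?thesis .
qed

lemma eval_mon_single [simp]: "eval_mon \<sigma> (pm_single v k) = \<sigma> v ^ k"
  by (cases "k = 0") (auto simp: eval_mon_def)

lemma meval_superset:
  assumes "finite F" "pm_keys p \<subseteq> F" "h 0 = 0"
  shows "meval h \<sigma> p = (\<Sum>m\<in>F. h (pm_lookup p m) * eval_mon \<sigma> m)"
  unfolding meval_def using assms
  by (intro sum.mono_neutral_left) (auto simp: in_keys_iff)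

context
  fixes h :: "'k::comm_ring_1 \<Rightarrow> 'a::comm_ring_1"
  assumes h: "comm_ring_hom h"
begin

interpretation h: comm_ring_hom h by (rule h)

lemma meval_single [simp]: "meval h \<sigma> (pm_single m c) = h c * eval_mon \<sigma> m"
  by (cases "c = 0") (auto simp: meval_def)

lemma meval_0 [simp]: "meval h \<sigma> 0 = 0"
  by (simp add: meval_def)

lemma meval_add: "meval h \<sigma> (p + q) = meval h \<sigma> p + meval h \<sigma> q"
proof -
  let ?F = "pm_keys p \<union> pm_keys q"
  have "meval h \<sigma> (p + q) = (\<Sum>m\<in>?F. h (pm_lookup (p + q) m) * eval_mon \<sigma> m)"
    by (rule meval_superset) (use keys_add[of p q] in auto)
  also have "\<dots> = (\<Sum>m\<in>?F. h (pm_lookup p m) * eval_mon \<sigma> m) + (\<Sum>m\<in>?F. h (pm_lookup q m) * eval_mon \<sigma> m)"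
    by (simp add: lookup_add h.hom_add ring_distribs sum.distrib)
  also have "\<dots> = meval h \<sigma> p + meval h \<sigma> q"
    by (subst (1 2) meval_superset[symmetric]) auto
  finally show ?thesis .
qed

lemma meval_sum: "meval h \<sigma> (\<Sum>i\<in>A. f i) = (\<Sum>i\<in>A. meval h \<sigma> (f i))"
  by (induction A rule: infinite_finite_induct) (auto simp: meval_add)

lemma meval_mult: "meval h \<sigma> (p * q) = meval h \<sigma> p * meval h \<sigma> q"
proof -
  have "meval h \<sigma> (p * q) = meval h \<sigma>
      (\<Sum>m\<in>pm_keys p. \<Sum>m'\<in>pm_keys q. pm_single (m + m') (pm_lookup p m * pm_lookup q m'))"
    by (subst (1) sum_of_monomials[of p], subst (1) sum_of_monomials[of q])
       (simp add: sum_product mult_single)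
  also have "\<dots> = (\<Sum>m\<in>pm_keys p. \<Sum>m'\<in>pm_keys q.
      (h (pm_lookup p m) * eval_mon \<sigma> m) * (h (pm_lookup q m') * eval_mon \<sigma> m'))"
    by (simp add: meval_sum eval_mon_add h.hom_mult mult_ac)
  also have "\<dots> = meval h \<sigma> p * meval h \<sigma> q"
    by (simp add: meval_def sum_product)
  finally show ?thesis .
qed

lemma meval_hom: "comm_ring_hom (meval h \<sigma>)"
  by unfold_locales (simp_all add: meval_add meval_mult flip: single_one)

lemma meval_mvar [simp]: "meval h \<sigma> (mvar v) = \<sigma> v"
  by (simp add: mvar_def)

lemma meval_mconst [simp]: "meval h \<sigma> (mconst c) = h c"
  by (simp add: mconst_def)

end

lemma mconst_hom: "comm_ring_hom mconst"
  by unfold_locales (auto simp: mconst_def single_add mult_single)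

text \<open>
  Polynomials are generated as a ring by constants and variables.  With \<open>V = UNIV\<close> this is an
  induction over all polynomials.
\<close>

lemma mpolys_induct [consumes 1, case_names const var add mult]:
  fixes p :: "('v, 'k::comm_ring_1) mpoly"
  assumes p: "p \<in> mpolys V"
    and c: "\<And>c. P (mconst c)" and v: "\<And>v. v \<in> V \<Longrightarrow> P (mvar v)"
    and a: "\<And>p q. P p \<Longrightarrow> P q \<Longrightarrow> P (p + q)" and m: "\<And>p q. P p \<Longrightarrow> P q \<Longrightarrow> P (p * q)"
  shows "P p"
proof -
  interpret mconst: comm_ring_hom mconst by (rule mconst_hom)
  have pow: "P (q ^ k)" if "P q" for q k
    using c[of 1] by (induction k) (auto intro: m that)
  have var_power: "pm_single (pm_single v k) 1 = (mvar v ^ k :: ('v, 'k) mpoly)" for v :: 'v and k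
  proof (induction k)
    case (Suc k)
    have "pm_single (pm_single v (Suc k)) 1 = pm_single (pm_single v 1 + pm_single v k) (1::'k)"
      by (simp flip: single_add)
    also have "\<dots> = mvar v * pm_single (pm_single v k) 1"
      by (simp add: mvar_def mult_single)
    finally show ?case by (simp add: Suc)
  qed simp
  have mono: "P (pm_single m c)" if "pm_keys m \<subseteq> V" for m c
  proof -
    have "P (pm_single (\<Sum>v\<in>F. pm_single v (pm_lookup m v)) 1)" if "finite F" "F \<subseteq> V" for F
      using that
    proof (induction F)
      case empty
      then show ?case using c[of 1] by (simp add: mconst_def)
    next
      case (insert v F)
      have "pm_single (\<Sum>w\<in>insert v F. pm_single w (pm_lookup m w)) 1 =
            mvar v ^ pm_lookup m v * (pm_single (\<Sum>w\<in>F. pm_single w (pm_lookup m w)) 1 :: ('v, 'k) mpoly)"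
        using insert.hyps by (simp add: mult_single del: single_one flip: var_power)
      moreover have "P (mvar v ^ pm_lookup m v)" using insert.prems by (intro pow v) auto
      ultimately show ?case using insert.IH insert.prems by (simp add: m)
    qed
    from this[of "pm_keys m"] that have "P (pm_single m 1)"
      using sum_of_monomials[of m] by simp
    then have "P (mconst c * pm_single m 1)" by (intro m c)
    then show ?thesis by (simp add: mconst_def mult_single)
  qed
  have "P (\<Sum>m\<in>M. pm_single m (pm_lookup p m))" if "finite M" "M \<subseteq> pm_keys p" for M
    using that
  proof (induction M)
    case empty
    then show ?case using c[of 0] by simp
  next
    case (insert k M)
    then show ?case using p by (auto simp: mpolys_def intro!: a mono)
  qed
  from this[of "pm_keys p"] show ?thesis
    using sum_of_monomials[of p] by simp
qed

lemma in_mpolys_keys: "p \<in> mpolys (\<Union>m\<in>pm_keys p. pm_keys m)"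
  by (auto simp: mpolys_def)

lemma mpolys_UNIV [simp]: "mpolys UNIV = UNIV"
  by (auto simp: mpolys_def)

lemma mpolys_mono: "V \<subseteq> W \<Longrightarrow> mpolys V \<subseteq> mpolys W"
  by (auto simp: mpolys_def)

lemma mpolys_0 [simp]: "0 \<in> mpolys V"
  and mpolys_1 [simp]: "1 \<in> mpolys V"
  and mpolys_mconst [simp]: "mconst c \<in> mpolys V"
  and mpolys_mvar [simp]: "v \<in> V \<Longrightarrow> mvar v \<in> mpolys V"
  by (auto simp: mpolys_def mconst_def mvar_def split: if_splits)

lemma mpolys_add [simp]: "p \<in> mpolys V \<Longrightarrow> q \<in> mpolys V \<Longrightarrow> p + q \<in> mpolys V"
  using keys_add[of p q] by (auto simp: mpolys_def)

lemma mpolys_uminus [simp]: "p \<in> mpolys V \<Longrightarrow> - p \<in> mpolys V"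
  by (auto simp: mpolys_def in_keys_iff)

lemma mpolys_diff [simp]: "p \<in> mpolys V \<Longrightarrow> q \<in> mpolys V \<Longrightarrow> p - q \<in> mpolys V"
  using mpolys_add[of p V "- q"] by simp

lemma mpolys_mult [simp]:
  assumes "p \<in> mpolys V" "q \<in> mpolys V"
  shows "p * q \<in> mpolys V"
  unfolding mpolys_def
proof (safe)
  fix m x assume m: "m \<in> pm_keys (p * q)" and x: "x \<in> pm_keys m"
  obtain a b where "a \<in> pm_keys p" "b \<in> pm_keys q" "m = a + b"
    using m keys_mult[of p q] by blast
  then show "x \<in> V" using x assms keys_add[of a b] by (fastforce simp: mpolys_def)
qed

lemma mpolys_sum [simp]: "(\<And>i. i \<in> A \<Longrightarrow> f i \<in> mpolys V) \<Longrightarrow> (\<Sum>i\<in>A. f i) \<in> mpolys V"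
  by (induction A rule: infinite_finite_induct) auto

lemma mpolys_power [simp]: "p \<in> mpolys V \<Longrightarrow> p ^ k \<in> mpolys V"
  by (induction k) auto

lemma finite_variables: obtains V where "finite V" "p \<in> mpolys V"
  by (rule that[OF _ in_mpolys_keys]) simp

text \<open>
  Identities between substitutions are always verified through this lemma, on the variables only.
\<close>

lemma hom_eqI:
  assumes f: "comm_ring_hom f" and g: "comm_ring_hom g" and p: "p \<in> mpolys V"
    and "\<And>c. f (mconst c) = g (mconst c)" "\<And>v. v \<in> V \<Longrightarrow> f (mvar v) = g (mvar v)"
  shows "f p = g p"
proof -
  interpret f: comm_ring_hom f by (rule f)
  interpret g: comm_ring_hom g by (rule g)
  show ?thesis using p
    by (induction rule: mpolys_induct) (use assms in \<open>auto simp: f.hom_add g.hom_add f.hom_mult g.hom_mult\<close>)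
qed

section \<open>Gauss's lemma\<close>

text \<open>
  The rings of interest are polynomial rings in varying sets of variables, all inside one type.
  Divisibility, primes and factorizations are therefore taken relative to a subset \<open>A\<close>.
\<close>

locale subdomain =
  fixes A :: "'a::idom set"
  assumes zero [simp]: "0 \<in> A" and one [simp]: "1 \<in> A"
    and add [simp]: "a \<in> A \<Longrightarrow> b \<in> A \<Longrightarrow> a + b \<in> A"
    and uminus [simp]: "a \<in> A \<Longrightarrow> - a \<in> A"
    and mult [simp]: "a \<in> A \<Longrightarrow> b \<in> A \<Longrightarrow> a * b \<in> A"
begin

lemma diff [simp]: "a \<in> A \<Longrightarrow> b \<in> A \<Longrightarrow> a - b \<in> A"
  using add[of a "- b"] by simp

lemma sum [simp]: "(\<And>i. i \<in> I \<Longrightarrow> f i \<in> A) \<Longrightarrow> sum f I \<in> A"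
  by (induction I rule: infinite_finite_induct) auto

definition dvd_in :: "'a \<Rightarrow> 'a \<Rightarrow> bool" where
  "dvd_in a b \<longleftrightarrow> (\<exists>c\<in>A. b = a * c)"

definition prime_in :: "'a \<Rightarrow> bool" where
  "prime_in p \<longleftrightarrow> p \<in> A \<and> p \<noteq> 0 \<and> \<not> dvd_in p 1 \<and>
     (\<forall>a\<in>A. \<forall>b\<in>A. dvd_in p (a * b) \<longrightarrow> dvd_in p a \<or> dvd_in p b)"

definition factors :: "'a list \<Rightarrow> 'a \<Rightarrow> bool" where
  "factors ps a \<longleftrightarrow> (\<forall>p\<in>set ps. prime_in p) \<and> (\<exists>u\<in>A. dvd_in u 1 \<and> a = u * prod_list ps)"

text \<open>
  A factorization into primes is automatically unique up to units, so the existence of one for every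
  nonzero element is the property of being a unique factorization domain.
\<close>

definition factorial :: bool where
  "factorial \<longleftrightarrow> (\<forall>a\<in>A. a \<noteq> 0 \<longrightarrow> (\<exists>ps. factors ps a))"

lemma dvd_inI: "c \<in> A \<Longrightarrow> b = a * c \<Longrightarrow> dvd_in a b"
  by (auto simp: dvd_in_def)

lemma dvd_in_0 [simp]: "dvd_in a 0"
  by (rule dvd_inI[of 0]) auto

lemma dvd_in_add: "dvd_in a b \<Longrightarrow> dvd_in a c \<Longrightarrow> dvd_in a (b + c)"
  unfolding dvd_in_def by (metis add distrib_left)

lemma dvd_in_diff: "dvd_in a b \<Longrightarrow> dvd_in a c \<Longrightarrow> dvd_in a (b - c)"
  unfolding dvd_in_def by (metis diff right_diff_distrib)

lemma dvd_in_mult: "dvd_in a b \<Longrightarrow> c \<in> A \<Longrightarrow> dvd_in a (b * c)"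
  unfolding dvd_in_def by (metis mult mult.assoc)

lemma dvd_in_mult2: "dvd_in a b \<Longrightarrow> c \<in> A \<Longrightarrow> dvd_in a (c * b)"
  using dvd_in_mult[of a b c] by (simp add: mult.commute)

lemma dvd_in_sum: "(\<And>i. i \<in> I \<Longrightarrow> dvd_in a (f i)) \<Longrightarrow> dvd_in a (sum f I)"
  by (induction I rule: infinite_finite_induct) (auto intro: dvd_in_add)

lemma dvd_in_trans: "dvd_in a b \<Longrightarrow> dvd_in b c \<Longrightarrow> dvd_in a c"
  unfolding dvd_in_def by (metis mult mult.assoc)

lemma prime_in_dvd_prod:
  assumes "prime_in p" "set ps \<subseteq> A" "dvd_in p (prod_list ps)"
  shows "\<exists>q\<in>set ps. dvd_in p q"
  using assms(2,3)
proof (induction ps)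
  case Nil
  then show ?case using assms(1) by (auto simp: prime_in_def)
next
  case (Cons a ps)
  have "prod_list ps \<in> A" using Cons.prems(1) by (induction ps) auto
  then show ?case using Cons assms(1) by (auto simp: prime_in_def)
qed

lemma unit_mult:
  assumes "u \<in> A" "v \<in> A" "dvd_in u 1" "dvd_in v 1"
  shows "dvd_in (u * v) 1"
proof -
  from assms obtain u' v' where *: "u' \<in> A" "v' \<in> A" and "1 = u * u'" "1 = v * v'"
    by (auto simp: dvd_in_def)
  then have "1 = (u * u') * (v * v')" by simp
  then show ?thesis using * by (intro dvd_inI[of "u' * v'"]) (auto simp: mult_ac)
qed

text \<open>
  From \<open>q = p w\<close> and \<open>q\<close> prime, \<open>q\<close> divides \<open>p\<close> or \<open>w\<close>; the second would make \<open>p\<close> a unit.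
\<close>

lemma prime_in_assoc:
  assumes p: "prime_in p" and q: "prime_in q" and "dvd_in p q"
  obtains w where "w \<in> A" "dvd_in w 1" "q = p * w"
proof -
  obtain w where w: "w \<in> A" "q = p * w" using assms(3) by (auto simp: dvd_in_def)
  have "dvd_in q (p * w)" using w by (intro dvd_inI[of 1]) auto
  then consider "dvd_in q p" | "dvd_in q w"
    using q w(1) p unfolding prime_in_def by blast
  then have "dvd_in w 1"
  proof cases
    case 1
    then obtain y where y: "y \<in> A" "p = q * y" by (auto simp: dvd_in_def)
    have "q * 1 = q * (w * y)" using w y by (metis mult.assoc mult.commute mult_1_right)
    then have "1 = w * y" using q unfolding prime_in_def by (metis mult_left_cancel)
    then show ?thesis using y by (intro dvd_inI[of y]) auto
  next
    case 2
    then obtain z where z: "z \<in> A" "w = q * z" by (auto simp: dvd_in_def)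
    have "q * 1 = q * (p * z)" using w(2) z(2) by (metis mult.left_commute mult_1_right)
    then have "1 = p * z" using q unfolding prime_in_def by (metis mult_left_cancel)
    then have "dvd_in p 1" using z by (intro dvd_inI[of z]) auto
    then show ?thesis using p by (simp add: prime_in_def)
  qed
  then show ?thesis using that w by blast
qed

lemma factors_mult:
  assumes "factors ps a" "factors qs b"
  shows "factors (ps @ qs) (a * b)"
proof -
  obtain u v where "u \<in> A" "v \<in> A" "dvd_in u 1" "dvd_in v 1" "a = u * prod_list ps" "b = v * prod_list qs"
    using assms by (auto simp: factors_def)
  then show ?thesis using assms unfolding factors_def
    by (auto intro!: bexI[of _ "u * v"] unit_mult simp: mult_ac)
qed

definition polys :: "'a poly set" where
  "polys = {F. \<forall>i. poly.coeff F i \<in> A}"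

lemma polys_subdomain: "subdomain polys"
proof
  fix F G :: "'a poly"
  assume "F \<in> polys" "G \<in> polys"
  then show "F * G \<in> polys" by (auto simp: polys_def coeff_mult)
qed (auto simp: polys_def coeff_1 split: if_splits)

interpretation P: subdomain polys
  by (rule polys_subdomain)

lemma const_in_polys [simp]: "[:c:] \<in> polys \<longleftrightarrow> c \<in> A"
  by (auto simp: polys_def coeff_pCons split: nat.splits)

lemma monom_in_polys [simp]: "c \<in> A \<Longrightarrow> monom c k \<in> polys"
  by (auto simp: polys_def)

lemma smult_in_polys [simp]: "c \<in> A \<Longrightarrow> F \<in> polys \<Longrightarrow> Polynomial.smult c F \<in> polys"
  by (auto simp: polys_def)

lemma coeff_in [simp]: "F \<in> polys \<Longrightarrow> poly.coeff F i \<in> A"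
  by (auto simp: polys_def)

lemma const_dvd_in_iff:
  assumes "F \<in> polys" "c \<in> A" "c \<noteq> 0"
  shows "P.dvd_in [:c:] F \<longleftrightarrow> (\<forall>i. dvd_in c (poly.coeff F i))"
proof
  assume "P.dvd_in [:c:] F"
  then show "\<forall>i. dvd_in c (poly.coeff F i)"
    by (auto simp: P.dvd_in_def dvd_in_def)
next
  assume *: "\<forall>i. dvd_in c (poly.coeff F i)"
  define g where "g a = (if a = 0 then 0 else SOME d. d \<in> A \<and> a = c * d)" for a
  have g: "g (poly.coeff F i) \<in> A \<and> poly.coeff F i = c * g (poly.coeff F i)" for i
  proof (cases "poly.coeff F i = 0")
    case False
    have "\<exists>d. d \<in> A \<and> poly.coeff F i = c * d" using * by (auto simp: dvd_in_def)
    from someI_ex[OF this] show ?thesis using False by (simp add: g_def)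
  qed (auto simp: g_def)
  have g0: "g 0 = 0" unfolding g_def by (rule if_P) (rule refl)
  have cf: "poly.coeff (map_poly g F) i = g (poly.coeff F i)" for i
    by (rule coeff_map_poly[where f = g, OF g0])
  have "map_poly g F \<in> polys"
    unfolding polys_def mem_Collect_eq cf by (intro allI g[THEN conjunct1])
  moreover have "F = [:c:] * map_poly g F"
  proof (rule poly_eqI)
    fix i
    have "poly.coeff ([:c:] * map_poly g F) i = c * poly.coeff (map_poly g F) i" by simp
    then show "poly.coeff F i = poly.coeff ([:c:] * map_poly g F) i"
      unfolding cf by (rule trans[OF g[THEN conjunct2] sym])
  qed
  ultimately show "P.dvd_in [:c:] F" by (rule P.dvd_inI)
qed

text \<open>
  If \<open>p\<close> divides neither \<open>F\<close> nor \<open>G\<close>, take the lowest coefficients \<open>F\<^sub>i\<close> and \<open>G\<^sub>j\<close> that it does not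
  divide.  In the coefficient of \<open>F G\<close> of index \<open>i + j\<close> every other product is divisible by \<open>p\<close>.
\<close>

lemma const_prime:
  assumes p: "prime_in p"
  shows "P.prime_in [:p:]"
  unfolding P.prime_in_def
proof (intro conjI ballI impI)
  have pA: "p \<in> A" "p \<noteq> 0" using p by (auto simp: prime_in_def)
  show "[:p:] \<in> polys" "[:p:] \<noteq> 0" using pA by auto
  show "\<not> P.dvd_in [:p:] 1"
  proof
    assume "P.dvd_in [:p:] 1"
    then have "dvd_in p (poly.coeff 1 0)" using const_dvd_in_iff[of 1 p] pA P.one by blast
    then show False using p by (simp add: prime_in_def)
  qed
  fix F G assume F: "F \<in> polys" and G: "G \<in> polys" and FG: "P.dvd_in [:p:] (F * G)"
  show "P.dvd_in [:p:] F \<or> P.dvd_in [:p:] G"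
  proof (rule ccontr)
    assume "\<not> ?thesis"
    then have "\<exists>i. \<not> dvd_in p (poly.coeff F i)" "\<exists>j. \<not> dvd_in p (poly.coeff G j)"
      using const_dvd_in_iff F G pA by auto
    define i where "i = (LEAST i. \<not> dvd_in p (poly.coeff F i))"
    define j where "j = (LEAST j. \<not> dvd_in p (poly.coeff G j))"
    have i: "\<not> dvd_in p (poly.coeff F i)" "\<And>k. k < i \<Longrightarrow> dvd_in p (poly.coeff F k)"
      unfolding i_def using LeastI_ex[OF \<open>\<exists>i. \<not> dvd_in p (poly.coeff F i)\<close>] not_less_Least by blast+
    have j: "\<not> dvd_in p (poly.coeff G j)" "\<And>k. k < j \<Longrightarrow> dvd_in p (poly.coeff G k)"
      unfolding j_def using LeastI_ex[OF \<open>\<exists>j. \<not> dvd_in p (poly.coeff G j)\<close>] not_less_Least by blast+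
    have "poly.coeff (F * G) (i + j) =
        (\<Sum>k\<le>i + j. poly.coeff F k * poly.coeff G (i + j - k))"
      by (simp add: coeff_mult)
    also have "\<dots> = poly.coeff F i * poly.coeff G j +
        (\<Sum>k\<in>{..i + j} - {i}. poly.coeff F k * poly.coeff G (i + j - k))"
      by (subst sum.remove[of _ i]) auto
    finally have eq: "poly.coeff F i * poly.coeff G j = poly.coeff (F * G) (i + j) -
        (\<Sum>k\<in>{..i + j} - {i}. poly.coeff F k * poly.coeff G (i + j - k))" by simp
    have "dvd_in p (poly.coeff F i * poly.coeff G j)"
      unfolding eq
    proof (intro dvd_in_diff dvd_in_sum)
      show "dvd_in p (poly.coeff (F * G) (i + j))"
        using FG const_dvd_in_iff[of "F * G" p] F G pA by simp
      fix k assume k: "k \<in> {..i + j} - {i}"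
      then consider "k < i" | "i + j - k < j" by force
      then show "dvd_in p (poly.coeff F k * poly.coeff G (i + j - k))"
        using i(2) j(2) F G by cases (auto intro: dvd_in_mult dvd_in_mult2)
    qed
    then show False using i(1) j(1) p coeff_in[OF F] coeff_in[OF G] unfolding prime_in_def by blast
  qed
qed

definition primitive :: "'a poly \<Rightarrow> bool" where
  "primitive F \<longleftrightarrow> F \<in> polys \<and> (\<forall>p. prime_in p \<longrightarrow> \<not> P.dvd_in [:p:] F)"

text \<open>
  Prime constants stay prime in \<open>A[t]\<close> and do not divide the primitive \<open>F\<close>, so in
  \<open>c H = F Q\<close> all prime factors of \<open>c\<close> divide \<open>Q\<close> and can be cancelled one after the other.
\<close>

lemma primitive_cancel:
  assumes fac: factorial and F: "primitive F" and c: "c \<in> A" "c \<noteq> 0"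
    and H: "H \<in> polys" and dvd: "P.dvd_in F ([:c:] * H)"
  shows "P.dvd_in F H"
proof -
  have FA: "F \<in> polys" using F by (simp add: primitive_def)
  have *: "P.dvd_in F H" if "\<forall>p\<in>set ps. prime_in p" "P.dvd_in F ([:prod_list ps:] * H)" for ps
    using that
  proof (induction ps)
    case Nil
    then show ?case by (simp add: one_pCons[symmetric])
  next
    case (Cons p ps)
    have p: "prime_in p" "p \<in> A" "p \<noteq> 0" using Cons.prems by (auto simp: prime_in_def)
    have psA: "prod_list ps \<in> A"
      using Cons.prems(1) by (induction ps) (auto simp: prime_in_def)
    obtain Q where Q: "Q \<in> polys" "[:prod_list (p # ps):] * H = F * Q"
      using Cons.prems(2) by (auto simp: P.dvd_in_def)
    have "P.dvd_in [:p:] (F * Q)"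
      unfolding Q(2)[symmetric]
      by (rule P.dvd_inI[of "[:prod_list ps:] * H"]) (use psA H in \<open>auto simp: mult.commute\<close>)
    then have "P.dvd_in [:p:] Q"
      using const_prime[OF p(1)] F FA Q(1) p(1) unfolding P.prime_in_def primitive_def by blast
    then obtain Q' where Q': "Q' \<in> polys" "Q = [:p:] * Q'" by (auto simp: P.dvd_in_def)
    have "[:p:] * ([:prod_list ps:] * H) = [:p:] * (F * Q')"
      using Q(2) Q'(2) by (simp add: mult_ac)
    then have "[:prod_list ps:] * H = F * Q'" using p(3)
      by (metis mult_left_cancel pCons_eq_0_iff)
    then show ?case using Cons Q'(1) by (auto intro: P.dvd_inI)
  qed
  obtain ps u where ps: "\<forall>p\<in>set ps. prime_in p" "u \<in> A" "dvd_in u 1" "c = u * prod_list ps"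
    using fac c unfolding factorial_def factors_def by blast
  obtain w where w: "w \<in> A" "1 = u * w" using ps(3) by (auto simp: dvd_in_def)
  have "[:prod_list ps:] * H = [:c:] * H * [:w:]"
    using ps(4) w(2) by (simp add: mult_ac) (metis mult.left_commute mult_1_right smult_smult)
  then have "P.dvd_in F ([:prod_list ps:] * H)"
    using dvd w by (metis P.dvd_in_mult const_in_polys)
  then show ?thesis using * ps(1) by blast
qed

text \<open>
  Dividing by primes that divide all coefficients must end, since each step removes a prime factor
  from the leading coefficient.
\<close>

lemma content_exists:
  assumes fac: factorial and F: "F \<in> polys" "F \<noteq> 0"
  shows "\<exists>c F0. c \<in> A \<and> c \<noteq> 0 \<and> primitive F0 \<and> F = [:c:] * F0"
proof -
  have *: "\<exists>c F0. c \<in> A \<and> c \<noteq> 0 \<and> primitive F0 \<and> F = [:c:] * F0"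
    if "factors ps (lead_coeff F)" "F \<in> polys" "F \<noteq> 0" for ps F
    using that
  proof (induction "length ps" arbitrary: ps F rule: less_induct)
    case less
    show ?case
    proof (cases "primitive F")
      case True
      then show ?thesis by (intro exI[of _ 1] exI[of _ F]) (auto simp: one_pCons[symmetric])
    next
      case False
      then obtain p where p: "prime_in p" "P.dvd_in [:p:] F"
        using less.prems by (auto simp: primitive_def)
      then have pA: "p \<in> A" "p \<noteq> 0" by (auto simp: prime_in_def)
      obtain F1 where F1: "F1 \<in> polys" "F = [:p:] * F1" using p(2) by (auto simp: P.dvd_in_def)
      have "F1 \<noteq> 0" using less.prems F1 by auto
      have lc: "lead_coeff F = p * lead_coeff F1" using F1(2) pA by simp
      obtain u where u: "u \<in> A" "dvd_in u 1" "lead_coeff F = u * prod_list ps"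
        and ps: "\<forall>p\<in>set ps. prime_in p"
        using less.prems(1) by (auto simp: factors_def)
      have psA: "set ps \<subseteq> A" using ps by (auto simp: prime_in_def)
      have "prod_list ps \<in> A" using psA by (induction ps) auto
      have "dvd_in p (u * prod_list ps)"
        using u(3) lc F1(1) by (intro dvd_inI[of "lead_coeff F1"]) auto
      moreover have "\<not> dvd_in p u" using p(1) u(2) dvd_in_trans prime_in_def by blast
      ultimately have "dvd_in p (prod_list ps)"
        using p(1) u(1) \<open>prod_list ps \<in> A\<close> unfolding prime_in_def by blast
      then obtain q where q: "q \<in> set ps" "dvd_in p q"
        using prime_in_dvd_prod[OF p(1) psA] by blast
      obtain w where w: "w \<in> A" "dvd_in w 1" "q = p * w"
        using prime_in_assoc[OF p(1)] ps q by metis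
      obtain xs ys where xys: "ps = xs @ q # ys" using split_list[OF q(1)] by blast
      then have prod: "prod_list ps = q * prod_list (xs @ ys)" by (simp add: mult_ac)
      have "p * lead_coeff F1 = p * (u * w * prod_list (xs @ ys))"
        unfolding lc[symmetric] u(3) prod w(3) by (simp only: mult_ac)
      then have "lead_coeff F1 = u * w * prod_list (xs @ ys)" using pA by simp
      then have "factors (xs @ ys) (lead_coeff F1)"
        unfolding factors_def using ps u w unit_mult[of u w] xys
        by (auto intro!: bexI[of _ "u * w"])
      moreover have "length (xs @ ys) < length ps"
        using xys by simp
      ultimately obtain c F0 where "c \<in> A" "c \<noteq> 0" "primitive F0" "F1 = [:c:] * F0"
        using less.hyps[of "xs @ ys" F1] F1(1) \<open>F1 \<noteq> 0\<close> by blast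
      then show ?thesis using F1(2) pA
        by (intro exI[of _ "p * c"] exI[of _ F0]) (auto simp: mult.commute)
    qed
  qed
  obtain ps where "factors ps (lead_coeff F)"
    using fac F unfolding factorial_def by (meson coeff_in leading_coeff_0_iff)
  then show ?thesis using * F by blast
qed

lemma pseudo_division:
  assumes r: "r \<in> polys" "r \<noteq> 0" and E: "E \<in> polys"
  shows "\<exists>d Q R. d \<in> A \<and> d \<noteq> 0 \<and> Q \<in> polys \<and> R \<in> polys \<and> [:d:] * E = r * Q + R \<and>
           (R = 0 \<or> degree R < degree r)"
  using E
proof (induction "degree E" arbitrary: E rule: less_induct)
  case less
  show ?case
  proof (cases "E = 0 \<or> degree E < degree r")
    case True
    then show ?thesis
      by (intro exI[of _ 1] exI[of _ 0] exI[of _ E]) (use less.prems in \<open>auto simp: one_pCons[symmetric]\<close>)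
  next
    case False
    define M where "M = monom (lead_coeff E) (degree E - degree r)"
    define Y where "Y = [:lead_coeff r:] * E - r * M"
    have M: "M \<in> polys" using less.prems by (simp add: M_def)
    have Y: "Y \<in> polys" using less.prems r M by (auto simp: Y_def)
    have nz: "lead_coeff E \<noteq> 0" "lead_coeff r \<noteq> 0" using False r by auto
    have le: "degree Y \<le> degree E"
      unfolding Y_def M_def using False nz
      by (intro degree_diff_le) (auto simp: degree_mult_eq degree_monom_eq monom_eq_0_iff r(2))
    have "poly.coeff (r * M) (degree E) = lead_coeff r * lead_coeff E"
      using False nz coeff_degree_mult[of r M] r(2)
      by (simp add: M_def degree_mult_eq degree_monom_eq monom_eq_0_iff)
    then have c0: "poly.coeff Y (degree E) = 0" by (simp add: Y_def)
    consider "Y = 0" | "degree Y < degree E"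
      using le c0 by (metis leading_coeff_0_iff le_neq_implies_less)
    then show ?thesis
    proof cases
      case 1
      then show ?thesis
        by (intro exI[of _ "lead_coeff r"] exI[of _ M] exI[of _ 0]) (use M r nz in \<open>auto simp: Y_def\<close>)
    next
      case 2
      from less.hyps[OF this Y] obtain d Q R where *: "d \<in> A" "d \<noteq> 0" "Q \<in> polys" "R \<in> polys"
        "[:d:] * Y = r * Q + R" "R = 0 \<or> degree R < degree r" by blast
      have "[:d * lead_coeff r:] * E = [:d:] * ([:lead_coeff r:] * E)" by (simp add: mult.commute)
      also have "\<dots> = [:d:] * (Y + r * M)" by (simp add: Y_def)
      also have "\<dots> = r * (Q + [:d:] * M) + R"
        unfolding distrib_left *(5) by (simp add: algebra_simps)
      finally show ?thesis using * M r nz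
        by (intro exI[of _ "d * lead_coeff r"] exI[of _ "Q + [:d:] * M"] exI[of _ R])
           (auto simp del: mult_pCons_left intro!: P.add P.mult)
    qed
  qed
qed

text \<open>
  Let \<open>F\<close> divide \<open>G H\<close>.  An element \<open>r\<close> of least degree in the ideal of \<open>F\<close> and \<open>G\<close> divides
  constant multiples of both by pseudo-division, so its primitive part \<open>r\<^sub>0\<close> divides \<open>F\<close> and \<open>G\<close>.  As
  \<open>F\<close> is irreducible, either \<open>r\<^sub>0\<close> is \<open>F\<close> up to a unit, and \<open>F\<close> divides \<open>G\<close>, or \<open>r\<close> is a constant \<open>k\<close>.
  In that case \<open>F\<close> divides \<open>k H\<close>, hence \<open>H\<close>.
\<close>

lemma primitive_irreducible_prime:
  assumes fac: factorial and F: "primitive F" "degree F > 0"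
    and irred: "\<And>G H. G \<in> polys \<Longrightarrow> H \<in> polys \<Longrightarrow> F = G * H \<Longrightarrow> degree G = 0 \<or> degree H = 0"
  shows "P.prime_in F"
  unfolding P.prime_in_def
proof (intro conjI ballI impI)
  show FA: "F \<in> polys" using F by (simp add: primitive_def)
  show F0: "F \<noteq> 0" using F by auto
  show "\<not> P.dvd_in F 1"
  proof
    assume "P.dvd_in F 1"
    then obtain Q where "1 = F * Q" by (auto simp: P.dvd_in_def)
    then have "degree (F * Q) = 0" "Q \<noteq> 0" using degree_1 by force+
    then show False using F F0 by (simp add: degree_mult_eq)
  qed
  fix G H assume G: "G \<in> polys" and H: "H \<in> polys" and GH: "P.dvd_in F (G * H)"
  define J where "J = {U * F + W * G | U W. U \<in> polys \<and> W \<in> polys}"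
  have "F = 1 * F + 0 * G" "G = 0 * F + 1 * G" by simp_all
  then have FJ: "F \<in> J" and GJ: "G \<in> J" unfolding J_def using P.one P.zero by blast+
  have JA: "E \<in> polys" if "E \<in> J" for E using that FA G by (auto simp: J_def)
  have J_comb: "[:d:] * E - r * Q \<in> J" if "E \<in> J" "r \<in> J" "d \<in> A" "Q \<in> polys" for E r d Q
  proof -
    obtain U W U' W' where *: "E = U * F + W * G" "r = U' * F + W' * G"
      "U \<in> polys" "W \<in> polys" "U' \<in> polys" "W' \<in> polys"
      using \<open>E \<in> J\<close> \<open>r \<in> J\<close> by (auto simp: J_def)
    have "[:d:] * E - r * Q = ([:d:] * U - U' * Q) * F + ([:d:] * W - W' * Q) * G"
      unfolding * by (simp add: algebra_simps)
    moreover have "[:d:] * U - U' * Q \<in> polys" "[:d:] * W - W' * Q \<in> polys"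
      using * that by (auto simp del: mult_pCons_left intro!: P.diff P.mult)
    ultimately show ?thesis unfolding J_def by blast
  qed
  obtain r where r: "r \<in> J" "r \<noteq> 0" and min: "\<And>E. E \<in> J \<Longrightarrow> E \<noteq> 0 \<Longrightarrow> degree r \<le> degree E"
    using exists_least_lemma[of "\<lambda>n. \<exists>E\<in>J. E \<noteq> 0 \<and> degree E = n"]
      ex_has_least_nat[of "\<lambda>E. E \<in> J \<and> E \<noteq> 0" F degree] FJ F0 by blast
  have r_dvd: "\<exists>d. d \<in> A \<and> d \<noteq> 0 \<and> P.dvd_in r ([:d:] * E)" if E: "E \<in> J" for E
  proof -
    obtain d Q R where *: "d \<in> A" "d \<noteq> 0" "Q \<in> polys" "R \<in> polys" "[:d:] * E = r * Q + R"
      "R = 0 \<or> degree R < degree r" using pseudo_division[OF JA[OF r(1)] r(2) JA[OF E]] by blast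
    have "R = [:d:] * E - r * Q" using *(5) by simp
    then have "R \<in> J" using J_comb[OF E r(1) *(1,3)] by simp
    then have "R = 0" using min *(6) by fastforce
    then show ?thesis using * by (auto intro!: exI[of _ d] P.dvd_inI[of Q])
  qed
  obtain c r0 where c: "c \<in> A" "c \<noteq> 0" and r0: "primitive r0" "r = [:c:] * r0"
    using content_exists[OF fac JA[OF r(1)] r(2)] by blast
  have r0A: "r0 \<in> polys" using r0 by (simp add: primitive_def)
  have r0_r: "P.dvd_in r0 r" by (rule P.dvd_inI[of "[:c:]"]) (use c r0 in \<open>auto simp: mult.commute\<close>)
  have r0_dvd: "P.dvd_in r0 E" if E: "E \<in> J" for E
    using r_dvd[OF E] primitive_cancel[OF fac r0(1)] JA[OF E] P.dvd_in_trans[OF r0_r] by blast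
  obtain Y where Y: "Y \<in> polys" "F = r0 * Y" using r0_dvd[OF FJ] by (auto simp: P.dvd_in_def)
  consider "degree Y = 0" | "degree r0 = 0" using irred[OF r0A Y] by (elim disjE) simp_all
  then show "P.dvd_in F G \<or> P.dvd_in F H"
  proof cases
    case 1
    then obtain y where y: "Y = [:y:]" by (metis degree_eq_zeroE)
    then have yA: "y \<in> A" "y \<noteq> 0" using Y F0 by auto
    then obtain ps u where ps: "\<forall>p\<in>set ps. prime_in p" "u \<in> A" "dvd_in u 1" "y = u * prod_list ps"
      using fac unfolding factorial_def factors_def by blast
    have "ps = []"
    proof (cases ps)
      case (Cons p qs)
      have "prod_list qs \<in> A" using ps(1) unfolding Cons by (induction qs) (auto simp: prime_in_def)
      then have "P.dvd_in [:p:] F" unfolding Y(2) y ps(4) Cons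
        by (intro P.dvd_inI[of "[:u * prod_list qs:] * r0"])
           (use ps(2) r0A in \<open>auto simp: mult_ac simp del: mult_pCons_left intro!: P.mult\<close>)
      then show ?thesis using F(1) ps(1) Cons by (auto simp: primitive_def)
    qed simp
    then obtain w where w: "w \<in> A" "1 = y * w" using ps by (auto simp: dvd_in_def)
    obtain Z where Z: "Z \<in> polys" "G = r0 * Z" using r0_dvd[OF GJ] by (auto simp: P.dvd_in_def)
    have "G = F * ([:w:] * Z)" unfolding Y(2) y Z(2) using w(2) by (simp add: mult_ac)
    then have "P.dvd_in F G" using w Z by (intro P.dvd_inI[of "[:w:] * Z"]) (auto simp del: mult_pCons_left intro!: P.mult)
    then show ?thesis ..
  next
    case 2
    then obtain e where e: "r0 = [:e:]" by (metis degree_eq_zeroE)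
    then have eA: "e \<in> A" "e \<noteq> 0" using r0A r r0 by auto
    obtain U W where UW: "U \<in> polys" "W \<in> polys" "r = U * F + W * G" using r(1) by (auto simp: J_def)
    obtain V where V: "V \<in> polys" "G * H = F * V" using GH by (auto simp: P.dvd_in_def)
    have "[:c * e:] * H = r * H" using r0(2) e by (simp add: mult.commute)
    also have "\<dots> = F * (U * H + W * V)" unfolding UW(3) using V(2) by (simp add: algebra_simps)
    finally have "P.dvd_in F ([:c * e:] * H)"
      using UW V H by (intro P.dvd_inI[of "U * H + W * V"]) auto
    then have "P.dvd_in F H" using primitive_cancel[OF fac F(1), of "c * e" H] c eA H by simp
    then show ?thesis ..
  qed
qed

text \<open>
  Split off the content, which factors in \<open>A\<close>.  A primitive polynomial of positive degree is prime or a
  product of two polynomials of smaller positive degree.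
\<close>

theorem gauss:
  assumes fac: factorial
  shows "P.factorial"
proof -
  have const: "\<exists>ps. P.factors ps [:c:]" if c: "c \<in> A" "c \<noteq> 0" for c
  proof -
    obtain ps u where ps: "\<forall>p\<in>set ps. prime_in p" "u \<in> A" "dvd_in u 1" "c = u * prod_list ps"
      using fac c unfolding factorial_def factors_def by blast
    have "P.dvd_in [:u:] 1"
    proof -
      obtain w where "w \<in> A" "1 = u * w" using ps(3) by (auto simp: dvd_in_def)
      then show ?thesis by (intro P.dvd_inI[of "[:w:]"]) (auto simp: one_pCons mult.commute)
    qed
    moreover have "prod_list (map (\<lambda>p. [:p:]) qs) = [:prod_list qs:]" for qs :: "'a list"
      by (induction qs) (simp_all add: one_pCons)
    then have "[:c:] = [:u:] * prod_list (map (\<lambda>p. [:p:]) ps)"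
      using ps(4) by (simp add: mult.commute)
    ultimately have "P.factors (map (\<lambda>p. [:p:]) ps) [:c:]"
      unfolding P.factors_def using ps(1,2) by (auto intro!: const_prime)
    then show ?thesis by blast
  qed
  have "\<exists>ps. P.factors ps F" if "F \<in> polys" "F \<noteq> 0" for F
    using that
  proof (induction "degree F" arbitrary: F rule: less_induct)
    case less
    obtain c F0 where c: "c \<in> A" "c \<noteq> 0" and F0: "primitive F0" "F = [:c:] * F0"
      using content_exists[OF fac less.prems] by blast
    have F0A: "F0 \<in> polys" "F0 \<noteq> 0" using F0 less.prems by (auto simp: primitive_def)
    have deg: "degree F0 = degree F" using F0 c by simp
    have "\<exists>ps. P.factors ps F0"
    proof (cases "degree F0 = 0")
      case True
      then obtain e where e: "F0 = [:e:]" by (metis degree_eq_zeroE)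
      then show ?thesis using const F0A by auto
    next
      case False
      show ?thesis
      proof (cases "\<forall>G\<in>polys. \<forall>H\<in>polys. F0 = G * H \<longrightarrow> degree G = 0 \<or> degree H = 0")
        case True
        then have "P.prime_in F0"
          using False by (intro primitive_irreducible_prime[OF fac F0(1)]) auto
        then have "P.factors [F0] F0"
          unfolding P.factors_def by (auto intro!: bexI[of _ 1] P.dvd_inI[of 1])
        then show ?thesis by blast
      next
        case f: False
        then obtain G H where GH: "G \<in> polys" "H \<in> polys" "F0 = G * H" "degree G \<noteq> 0" "degree H \<noteq> 0"
          by blast
        then have nz: "G \<noteq> 0" "H \<noteq> 0" by auto
        then have "degree F0 = degree G + degree H" using GH by (simp add: degree_mult_eq)
        then have "degree G < degree F" "degree H < degree F" using GH deg by auto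
        then show ?thesis using less.hyps GH nz P.factors_mult by metis
      qed
    qed
    then show ?case using const[OF c] P.factors_mult unfolding F0(2) by blast
  qed
  then show ?thesis by (auto simp: P.factorial_def)
qed

end

section \<open>Hilbert's basis theorem\<close>

context subdomain
begin

definition ideal_in :: "'a set \<Rightarrow> bool" where
  "ideal_in J \<longleftrightarrow> 0 \<in> J \<and> (\<forall>a\<in>J. \<forall>b\<in>J. a + b \<in> J) \<and> (\<forall>a\<in>A. \<forall>b\<in>J. a * b \<in> J)"

text \<open>
  \<open>ideal_in hull G\<close> is the ideal generated by \<open>G\<close>.
\<close>

definition noetherian :: bool where
  "noetherian \<longleftrightarrow> (\<forall>J. ideal_in J \<and> J \<subseteq> A \<longrightarrow> (\<exists>G. finite G \<and> G \<subseteq> J \<and> J = ideal_in hull G))"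

lemma ideal_in_Inter: "\<forall>J\<in>\<J>. ideal_in J \<Longrightarrow> ideal_in (\<Inter>\<J>)"
  by (auto simp: ideal_in_def)

lemma ideal_in_hull: "ideal_in (ideal_in hull G)"
  by (rule hull_in) (auto intro: ideal_in_Inter)

lemma ideal_in_add: "ideal_in J \<Longrightarrow> a \<in> J \<Longrightarrow> b \<in> J \<Longrightarrow> a + b \<in> J"
  and ideal_in_mult: "ideal_in J \<Longrightarrow> c \<in> A \<Longrightarrow> a \<in> J \<Longrightarrow> c * a \<in> J"
  and ideal_in_0: "ideal_in J \<Longrightarrow> 0 \<in> J"
  by (auto simp: ideal_in_def)

lemma ideal_in_diff: "ideal_in J \<Longrightarrow> a \<in> J \<Longrightarrow> b \<in> J \<Longrightarrow> a - b \<in> J"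
  using ideal_in_add[of J a "-1 * b"] ideal_in_mult[of J "-1" b] by simp

lemma ideal_in_UN_chain:
  fixes J :: "nat \<Rightarrow> 'a set"
  assumes J: "\<And>n. ideal_in (J n)" and mono: "\<And>m n. m \<le> n \<Longrightarrow> J m \<subseteq> J n"
  shows "ideal_in (\<Union>n. J n)"
  unfolding ideal_in_def
proof (intro conjI ballI)
  show "0 \<in> (\<Union>n. J n)" using J by (auto simp: ideal_in_def)
  show "a * b \<in> (\<Union>n. J n)" if "a \<in> A" "b \<in> (\<Union>n. J n)" for a b
    using that ideal_in_mult[OF J] by blast
  fix a b assume "a \<in> (\<Union>n. J n)" "b \<in> (\<Union>n. J n)"
  then obtain m n where "a \<in> J m" "b \<in> J n" by auto
  then have "a \<in> J (max m n)" "b \<in> J (max m n)"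
    using mono[of m "max m n"] mono[of n "max m n"] by auto
  then show "a + b \<in> (\<Union>n. J n)" using J ideal_in_add by blast
qed

interpretation P: subdomain polys
  by (rule polys_subdomain)

text \<open>
  The coefficients of index \<open>d\<close> of the elements of degree at most \<open>d\<close> in an ideal of \<open>A[t]\<close> form an
  ideal of \<open>A\<close>.  It contains each given leading coefficient, by a shift with a power of \<open>t\<close>.
\<close>

lemma lead_coeff_attained:
  assumes F: "\<And>i. i < N \<Longrightarrow> F i \<in> polys" "\<And>i. i < N \<Longrightarrow> degree (F i) \<le> d"
    and c: "c \<in> ideal_in hull ((\<lambda>i. lead_coeff (F i)) ` {..<N})"
  shows "\<exists>G \<in> P.ideal_in hull (F ` {..<N}). degree G \<le> d \<and> poly.coeff G d = c"
proof -
  let ?H = "P.ideal_in hull (F ` {..<N})"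
  define C where "C = {c. \<exists>G \<in> ?H. degree G \<le> d \<and> poly.coeff G d = c}"
  have H: "P.ideal_in ?H" by (rule P.ideal_in_hull)
  have "ideal_in C"
    unfolding ideal_in_def
  proof (intro conjI ballI)
    show "0 \<in> C" unfolding C_def using P.ideal_in_0[OF H] by (auto intro!: bexI[of _ 0])
  next
    fix a b assume "a \<in> C" "b \<in> C"
    then obtain G G' where "G \<in> ?H" "degree G \<le> d" "poly.coeff G d = a"
      "G' \<in> ?H" "degree G' \<le> d" "poly.coeff G' d = b" by (auto simp: C_def)
    then show "a + b \<in> C" unfolding C_def
      by (intro CollectI bexI[of _ "G + G'"]) (auto intro: degree_add_le P.ideal_in_add[OF H])
  next
    fix a b assume a: "a \<in> A" and "b \<in> C"
    then obtain G where G: "G \<in> ?H" "degree G \<le> d" "poly.coeff G d = b" by (auto simp: C_def)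
    have "[:a:] * G \<in> ?H" using P.ideal_in_mult[OF H, of "[:a:]" G] a G by simp
    then show "a * b \<in> C" unfolding C_def using G
      by (intro CollectI bexI[of _ "[:a:] * G"]) (auto intro: order.trans[OF degree_smult_le])
  qed
  moreover have "lead_coeff (F i) \<in> C" if i: "i < N" for i
  proof -
    let ?M = "monom 1 (d - degree (F i))"
    have "F i \<in> ?H" using i by (intro hull_inc) auto
    then have "?M * F i \<in> ?H" by (intro P.ideal_in_mult[OF H]) auto
    moreover have "degree (?M * F i) \<le> d"
      using F(2)[OF i] degree_mult_le[of ?M "F i"] by (simp add: degree_monom_eq)
    moreover have "poly.coeff (?M * F i) d = lead_coeff (F i)"
      using F(2)[OF i] by (simp add: coeff_monom_mult)
    ultimately show ?thesis unfolding C_def by blast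
  qed
  then have "(\<lambda>i. lead_coeff (F i)) ` {..<N} \<subseteq> C" by auto
  ultimately have "c \<in> C" using c hull_minimal by blast
  then show ?thesis by (simp add: C_def)
qed

text \<open>
  Suppose \<open>J\<close> is not finitely generated and choose \<open>F\<^sub>0, F\<^sub>1, \<dots>\<close> in \<open>J\<close>, each of least degree outside
  the ideal of its predecessors.  The ideals of their leading coefficients become stationary, so the
  leading coefficient of some \<open>F\<^sub>N\<close> is attained by an element of degree at most \<open>degree F\<^sub>N\<close> in the ideal
  of the predecessors.  Subtracting it contradicts the minimal choice of \<open>F\<^sub>N\<close>.
\<close>

theorem hilbert_basis:
  assumes noeth: noetherian
  shows "P.noetherian"
  unfolding P.noetherian_def
proof (intro allI impI; elim conjE)
  fix J assume J: "P.ideal_in J" and JA: "J \<subseteq> polys"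
  show "\<exists>G. finite G \<and> G \<subseteq> J \<and> J = P.ideal_in hull G"
  proof (rule ccontr)
    assume nfg: "\<not> ?thesis"
    have ex: "\<exists>F. F \<in> J - P.ideal_in hull G \<and> (\<forall>F'\<in>J - P.ideal_in hull G. degree F \<le> degree F')"
      if G: "finite G" "G \<subseteq> J" for G
    proof -
      have "P.ideal_in hull G \<subseteq> J" using G J by (intro hull_minimal)
      moreover have "J \<noteq> P.ideal_in hull G" using nfg G by blast
      ultimately obtain F where "F \<in> J - P.ideal_in hull G" by blast
      from ex_has_least_nat[of "\<lambda>F. F \<in> J - P.ideal_in hull G" F degree, OF this]
      show ?thesis by blast
    qed
    \<comment> \<open>\<open>S n\<close> is the set of the first \<open>n\<close> chosen elements and \<open>F n\<close> the next one.\<close>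
    define pick where "pick G = (SOME F. F \<in> J - P.ideal_in hull G \<and>
        (\<forall>F'\<in>J - P.ideal_in hull G. degree F \<le> degree F'))" for G
    define S where "S = rec_nat {} (\<lambda>_ G. insert (pick G) G)"
    define F where "F n = pick (S n)" for n
    have S_Suc: "S (Suc n) = insert (F n) (S n)" for n by (simp add: S_def F_def)
    have S_image: "S n = F ` {..<n}" for n
      by (induction n) (auto simp: S_Suc lessThan_Suc, simp add: S_def)
    have pick: "pick G \<in> J - P.ideal_in hull G \<and> (\<forall>F'\<in>J - P.ideal_in hull G. degree (pick G) \<le> degree F')"
      if "finite G" "G \<subseteq> J" for G
      unfolding pick_def by (rule someI_ex[OF ex[OF that]])
    have SJ: "finite (S n) \<and> S n \<subseteq> J" for n
    proof (induction n)
      case (Suc n)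
      then show ?case using pick[of "S n"] by (auto simp: S_Suc F_def)
    qed (auto simp: S_def)
    have F_pick: "F n \<in> J - P.ideal_in hull (S n) \<and>
        (\<forall>F'\<in>J - P.ideal_in hull (S n). degree (F n) \<le> degree F')" for n
      unfolding F_def by (rule pick) (use SJ in auto)
    have F: "F n \<in> J" "F n \<notin> P.ideal_in hull (F ` {..<n})"
      and min: "\<And>F'. F' \<in> J \<Longrightarrow> F' \<notin> P.ideal_in hull (F ` {..<n}) \<Longrightarrow> degree (F n) \<le> degree F'" for n
      using F_pick[of n] unfolding S_image by auto
    have FA: "F n \<in> polys" for n using F(1) JA by blast
    have deg_mono: "degree (F m) \<le> degree (F n)" if "m \<le> n" for m n
    proof (rule min[OF F(1)])
      have "P.ideal_in hull (F ` {..<m}) \<subseteq> P.ideal_in hull (F ` {..<n})"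
        using that by (intro hull_mono) auto
      then show "F n \<notin> P.ideal_in hull (F ` {..<m})" using F(2)[of n] by blast
    qed
    define L where "L n = ideal_in hull ((\<lambda>i. lead_coeff (F i)) ` {..<n})" for n
    have L_mono: "L m \<subseteq> L n" if "m \<le> n" for m n
      unfolding L_def using that by (intro hull_mono) auto
    have L: "ideal_in (L n)" for n unfolding L_def by (rule ideal_in_hull)
    have "ideal_in A" by (auto simp: ideal_in_def)
    then have LA: "L n \<subseteq> A" for n unfolding L_def
      by (intro hull_minimal) (auto simp: FA)
    have "ideal_in (\<Union>n. L n)" by (intro ideal_in_UN_chain L L_mono)
    moreover have "(\<Union>n. L n) \<subseteq> A" using LA by auto
    ultimately have "\<exists>G. finite G \<and> G \<subseteq> (\<Union>n. L n) \<and> (\<Union>n. L n) = ideal_in hull G"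
      by (intro noeth[unfolded noetherian_def, rule_format] conjI)
    then obtain G where G: "finite G" "G \<subseteq> (\<Union>n. L n)" "(\<Union>n. L n) = ideal_in hull G"
      by (elim exE conjE)
    have "\<exists>N. G \<subseteq> L N" using G(1,2)
    proof (induction G)
      case (insert g G)
      then obtain N M where "G \<subseteq> L N" "g \<in> L M" by auto
      then have "insert g G \<subseteq> L (max N M)"
        using L_mono[of N "max N M"] L_mono[of M "max N M"] by auto
      then show ?case ..
    qed auto
    then obtain N where "G \<subseteq> L N" ..
    then have "ideal_in hull G \<subseteq> L N" using L by (intro hull_minimal)
    then have "(\<Union>n. L n) \<subseteq> L N" using G(3) by simp
    moreover have "lead_coeff (F N) \<in> L (Suc N)" unfolding L_def by (intro hull_inc) auto
    then have "lead_coeff (F N) \<in> (\<Union>n. L n)" by (rule UN_I[OF UNIV_I])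
    ultimately have "lead_coeff (F N) \<in> L N" by (rule subsetD)
    then have "\<exists>H \<in> P.ideal_in hull (F ` {..<N}). degree H \<le> degree (F N) \<and>
        poly.coeff H (degree (F N)) = lead_coeff (F N)"
      unfolding L_def by (intro lead_coeff_attained) (simp_all add: FA deg_mono)
    then obtain H where H: "H \<in> P.ideal_in hull (F ` {..<N})" "degree H \<le> degree (F N)"
        "poly.coeff H (degree (F N)) = lead_coeff (F N)"
      by (elim bexE conjE)
    have "P.ideal_in hull (F ` {..<N}) \<subseteq> J" by (rule hull_minimal) (use F(1) J in auto)
    then have HJ: "H \<in> J" using H(1) by (rule subsetD)
    have "F N - H \<notin> P.ideal_in hull (F ` {..<N})"
    proof
      assume "F N - H \<in> P.ideal_in hull (F ` {..<N})"
      from P.ideal_in_add[OF P.ideal_in_hull this H(1)] F(2)[of N] show False by simp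
    qed
    moreover have "F N - H \<in> J" using P.ideal_in_diff[OF J F(1) HJ] .
    ultimately have le: "degree (F N) \<le> degree (F N - H)" by (intro min)
    have "F N - H \<noteq> 0" using H(1) F(2)[of N] by auto
    moreover have "degree (F N - H) \<le> degree (F N)" using H(2) by (intro degree_diff_le) auto
    then have "degree (F N - H) = degree (F N)" using le by simp
    moreover have "poly.coeff (F N - H) (degree (F N)) = 0" using H(3) by simp
    ultimately show False by (metis leading_coeff_0_iff)
  qed
qed

end

section \<open>Factoriality and finiteness of polynomial rings over a field\<close>

lemma mpolys_subdomain: "subdomain (mpolys V :: ('v::linorder, 'k::idom) mpoly set)"
  by unfold_locales auto

locale subdomain_iso = A: subdomain A + B: subdomain B + comm_ring_hom \<phi>
  for A :: "'a::idom set" and B :: "'b::idom set" and \<phi> :: "'a \<Rightarrow> 'b" +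
  assumes inj: "inj_on \<phi> A" and surj: "\<phi> ` A = B"
begin

lemma image_in [simp]: "a \<in> A \<Longrightarrow> \<phi> a \<in> B"
  using surj by blast

lemma dvd_in_iff:
  assumes "a \<in> A" "b \<in> A"
  shows "B.dvd_in (\<phi> a) (\<phi> b) \<longleftrightarrow> A.dvd_in a b"
proof -
  have "B.dvd_in (\<phi> a) (\<phi> b) \<longleftrightarrow> (\<exists>c\<in>A. \<phi> b = \<phi> (a * c))"
  proof -
    have "B.dvd_in (\<phi> a) (\<phi> b) \<longleftrightarrow> (\<exists>c\<in>\<phi> ` A. \<phi> b = \<phi> a * c)"
      by (simp add: B.dvd_in_def surj)
    then show ?thesis by (simp add: hom_mult)
  qed
  also have "\<dots> \<longleftrightarrow> (\<exists>c\<in>A. b = a * c)"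
    using assms by (intro bex_cong refl inj_on_eq_iff[OF inj]) auto
  finally show ?thesis by (simp add: A.dvd_in_def)
qed

lemma prime_in_image:
  assumes "A.prime_in p"
  shows "B.prime_in (\<phi> p)"
proof -
  have p: "p \<in> A" "p \<noteq> 0" using assms by (auto simp: A.prime_in_def)
  have "\<phi> p \<noteq> 0" using inj p by (metis A.zero hom_zero inj_onD)
  moreover have "\<not> B.dvd_in (\<phi> p) 1"
    using dvd_in_iff[of p 1] p assms by (simp add: A.prime_in_def)
  moreover have "B.dvd_in (\<phi> p) (\<phi> a * \<phi> b) \<Longrightarrow> B.dvd_in (\<phi> p) (\<phi> a) \<or> B.dvd_in (\<phi> p) (\<phi> b)"
    if "a \<in> A" "b \<in> A" for a b
    using that p assms dvd_in_iff[of p] by (simp add: A.prime_in_def flip: hom_mult)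
  ultimately show ?thesis using p surj unfolding B.prime_in_def by blast
qed

lemma factorial_image:
  assumes "A.factorial"
  shows "B.factorial"
  unfolding B.factorial_def
proof (intro ballI impI)
  fix b assume b: "b \<in> B" "b \<noteq> 0"
  then have "b \<in> \<phi> ` A" using surj by simp
  then obtain a where a: "a \<in> A" "b = \<phi> a" by (elim imageE)
  then have "a \<noteq> 0" using b by auto
  then have "\<exists>ps. A.factors ps a"
    by (intro assms[unfolded A.factorial_def, rule_format] a)
  then obtain ps u where ps: "\<forall>p\<in>set ps. A.prime_in p" "u \<in> A" "A.dvd_in u 1" "a = u * prod_list ps"
    unfolding A.factors_def by (elim exE conjE bexE)
  have "B.dvd_in (\<phi> u) 1" using dvd_in_iff[of u 1] ps by simp
  moreover have "b = \<phi> u * prod_list (map \<phi> ps)" using a ps by (simp add: hom_mult)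
  ultimately have "B.factors (map \<phi> ps) b"
    unfolding B.factors_def using ps by (auto intro: prime_in_image)
  then show "\<exists>ps. B.factors ps b" ..
qed

lemma noetherian_image:
  assumes "A.noetherian"
  shows "B.noetherian"
  unfolding B.noetherian_def
proof (intro allI impI; elim conjE)
  fix J assume J: "B.ideal_in J" "J \<subseteq> B"
  have pull: "A.ideal_in {a \<in> A. \<phi> a \<in> I}" if "B.ideal_in I" for I
    unfolding A.ideal_in_def
    using that by (auto simp: hom_add hom_mult B.ideal_in_def)
  have "\<exists>G. finite G \<and> G \<subseteq> {a \<in> A. \<phi> a \<in> J} \<and> {a \<in> A. \<phi> a \<in> J} = A.ideal_in hull G"
    by (intro assms[unfolded A.noetherian_def, rule_format] conjI pull[OF J(1)]) auto
  then obtain G where G: "finite G" "G \<subseteq> {a \<in> A. \<phi> a \<in> J}" "{a \<in> A. \<phi> a \<in> J} = A.ideal_in hull G"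
    by (elim exE conjE)
  have "A.ideal_in hull G \<subseteq> {a \<in> A. \<phi> a \<in> B.ideal_in hull (\<phi> ` G)}"
    by (intro hull_minimal pull B.ideal_in_hull) (use G(2) in \<open>auto intro!: hull_inc\<close>)
  then have *: "\<phi> a \<in> B.ideal_in hull (\<phi> ` G)" if "a \<in> A" "\<phi> a \<in> J" for a
    using that unfolding G(3)[symmetric] by auto
  have "J \<subseteq> B.ideal_in hull (\<phi> ` G)"
  proof
    fix b assume b: "b \<in> J"
    then have "b \<in> \<phi> ` A" using J(2) surj by auto
    then show "b \<in> B.ideal_in hull (\<phi> ` G)" using * b by auto
  qed
  moreover have "B.ideal_in hull (\<phi> ` G) \<subseteq> J" using G(2) J(1) by (intro hull_minimal) auto
  ultimately show "\<exists>G. finite G \<and> G \<subseteq> J \<and> J = B.ideal_in hull G"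
    using G(1,2) by (intro exI[of _ "\<phi> ` G"]) auto
qed

end

text \<open>
  A polynomial regarded as a univariate polynomial in \<open>v\<close> over the polynomials in the other variables.
\<close>

definition split_var :: "'v \<Rightarrow> ('v, 'k::comm_ring_1) mpoly \<Rightarrow> ('v, 'k) mpoly poly" where
  "split_var v = meval (\<lambda>c. [:mconst c:]) (\<lambda>w. if w = v then [:0, 1:] else [:mvar w:])"

lemma const_poly_hom: "comm_ring_hom h \<Longrightarrow> comm_ring_hom (\<lambda>c. [:h c:])"
proof -
  assume "comm_ring_hom h"
  then interpret comm_ring_hom h .
  show ?thesis by unfold_locales (auto simp: hom_add hom_mult one_pCons)
qed

lemma poly_eval_hom: "comm_ring_hom (\<lambda>F. poly F x)"
  by unfold_locales auto

lemma comp_hom: "comm_ring_hom f \<Longrightarrow> comm_ring_hom g \<Longrightarrow> comm_ring_hom (\<lambda>p. f (g p))"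
proof -
  assume f: "comm_ring_hom f" and g: "comm_ring_hom g"
  interpret f: comm_ring_hom f by (rule f)
  interpret g: comm_ring_hom g by (rule g)
  show ?thesis by unfold_locales (auto simp: f.hom_add g.hom_add f.hom_mult g.hom_mult)
qed

lemma id_hom: "comm_ring_hom (\<lambda>x. x)"
  by unfold_locales auto

lemma split_var_hom: "comm_ring_hom (split_var v)"
  unfolding split_var_def by (intro meval_hom const_poly_hom mconst_hom)

lemma split_var_mconst [simp]: "split_var v (mconst c) = [:mconst c:]"
  unfolding split_var_def by (subst meval_mconst) (auto intro: const_poly_hom mconst_hom)

lemma split_var_mvar [simp]: "split_var v (mvar w) = (if w = v then [:0, 1:] else [:mvar w:])"
  unfolding split_var_def by (subst meval_mvar) (auto intro: const_poly_hom mconst_hom)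

lemma poly_split_var [simp]: "poly (split_var v p) (mvar v) = p"
  by (rule hom_eqI[where V = UNIV and f = "\<lambda>p. poly (split_var v p) (mvar v)"])
     (auto intro: comp_hom[OF poly_eval_hom split_var_hom] id_hom)

lemma split_var_free:
  assumes "p \<in> mpolys V" "v \<notin> V"
  shows "split_var v p = [:p:]"
  by (rule hom_eqI[OF split_var_hom const_poly_hom[OF id_hom] assms(1)]) (use assms(2) in auto)

lemma coeff_split_var:
  fixes p :: "('v::linorder, 'k::idom) mpoly"
  assumes "p \<in> mpolys V"
  shows "poly.coeff (split_var v p) i \<in> mpolys (V - {v})"
proof -
  interpret comm_ring_hom "split_var v :: ('v, 'k) mpoly \<Rightarrow> _" by (rule split_var_hom)
  interpret V: subdomain "mpolys (V - {v}) :: ('v, 'k) mpoly set" by (rule mpolys_subdomain)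
  interpret P: subdomain V.polys by (rule V.polys_subdomain)
  have var: "[:0, 1:] \<in> V.polys"
    using V.monom_in_polys[of 1 1] by (simp add: monom_altdef)
  from assms have "split_var v p \<in> V.polys"
  proof (induction rule: mpolys_induct)
    case (const c)
    show ?case unfolding split_var_mconst V.const_in_polys by simp
  next
    case (var w)
    then show ?case using \<open>[:0, 1:] \<in> V.polys\<close> by (cases "w = v") (simp_all add: V.const_in_polys)
  next
    case (add p q)
    then show ?case unfolding hom_add by (rule P.add)
  next
    case (mult p q)
    then show ?case unfolding hom_mult by (rule P.mult)
  qed
  then show ?thesis by (rule V.coeff_in)
qed

text \<open>
  Together with \<open>poly_split_var\<close>, this identifies \<open>K[V][t]\<close> with \<open>K[V \<union> {v}]\<close>.
\<close>

lemma split_var_poly: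
  fixes F :: "('v::linorder, 'k::idom) mpoly poly"
  assumes "v \<notin> V" "\<And>i. poly.coeff F i \<in> mpolys V"
  shows "split_var v (poly F (mvar v)) = F"
  using assms(2)
proof (induction F)
  case 0
  interpret comm_ring_hom "split_var v :: ('v, 'k) mpoly \<Rightarrow> _" by (rule split_var_hom)
  show ?case by simp
next
  case (pCons a F)
  interpret comm_ring_hom "split_var v :: ('v, 'k) mpoly \<Rightarrow> _" by (rule split_var_hom)
  have "a \<in> mpolys V" "\<And>i. poly.coeff F i \<in> mpolys V"
    using pCons.prems[of 0] pCons.prems[of "Suc i" for i] by simp_all
  then show ?case using pCons.IH
    by (simp add: hom_add hom_mult split_var_free[OF \<open>a \<in> mpolys V\<close> assms(1)])
qed

lemma mpolys_insert_iso:
  assumes "v \<notin> V"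
  shows "subdomain_iso (subdomain.polys (mpolys V)) (mpolys (insert v V))
           (\<lambda>F. poly F (mvar v :: ('v::linorder, 'k::idom) mpoly))"
proof -
  interpret V: subdomain "mpolys V :: ('v, 'k) mpoly set" by (rule mpolys_subdomain)
  have 1: "poly F (mvar v) \<in> mpolys (insert v V)" if F: "F \<in> V.polys" for F
    unfolding poly_altdef
  proof (intro mpolys_sum mpolys_mult mpolys_power mpolys_mvar insertI1)
    fix i show "poly.coeff F i \<in> mpolys (insert v V)"
      using V.coeff_in[OF F, of i] by (rule subsetD[OF mpolys_mono[OF subset_insertI]])
  qed
  have 2: "split_var v p \<in> V.polys" if "p \<in> mpolys (insert v V)" for p
    unfolding V.polys_def mem_Collect_eq
    using coeff_split_var[OF that, of v] assms by simp
  have 3: "split_var v (poly F (mvar v)) = F" if F: "F \<in> V.polys" for F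
    by (rule split_var_poly[OF assms V.coeff_in[OF F]])
  show ?thesis
    unfolding subdomain_iso_def subdomain_iso_axioms_def
  proof (intro conjI V.polys_subdomain mpolys_subdomain poly_eval_hom)
    show "inj_on (\<lambda>F. poly F (mvar v)) V.polys"
      by (rule inj_on_inverseI[of _ "split_var v"]) (rule 3)
    show "(\<lambda>F. poly F (mvar v)) ` V.polys = mpolys (insert v V)"
    proof (intro equalityI subsetI)
      fix p :: "('v, 'k) mpoly" assume "p \<in> mpolys (insert v V)"
      then show "p \<in> (\<lambda>F. poly F (mvar v)) ` V.polys"
        by (intro image_eqI[of _ _ "split_var v p"] 2 poly_split_var[symmetric])
    qed (use 1 in blast)
  qed
qed

lemma mpolys_empty: "mpolys {} = range (mconst :: 'k::comm_ring_1 \<Rightarrow> ('v, 'k) mpoly)"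
proof (intro equalityI subsetI)
  interpret comm_ring_hom "mconst :: 'k \<Rightarrow> ('v, 'k) mpoly" by (rule mconst_hom)
  fix p :: "('v, 'k) mpoly" assume "p \<in> mpolys {}"
  then show "p \<in> range mconst"
    by (induction rule: mpolys_induct) (auto simp flip: hom_add hom_mult)
qed auto

lemma mconst_unit:
  assumes "c \<noteq> (0::'k::field)"
  shows "mconst c * mconst (inverse c) = (1 :: ('v, 'k) mpoly)"
proof -
  interpret comm_ring_hom "mconst :: 'k \<Rightarrow> ('v, 'k) mpoly" by (rule mconst_hom)
  show ?thesis using assms by (simp flip: hom_mult)
qed

theorem mpolys_factorial:
  assumes "finite V"
  shows "subdomain.factorial (mpolys V :: ('v::linorder, 'k::field) mpoly set)"
  using assms
proof (induction V)
  case empty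
  interpret V: subdomain "mpolys {} :: ('v, 'k) mpoly set" by (rule mpolys_subdomain)
  have "V.factors [] p" if p: "p \<in> mpolys {}" "p \<noteq> 0" for p
  proof -
    interpret comm_ring_hom "mconst :: 'k \<Rightarrow> ('v, 'k) mpoly" by (rule mconst_hom)
    have "p \<in> range mconst" using p(1) unfolding mpolys_empty .
    then obtain c where "p = mconst c" by (elim rangeE)
    with p have c: "p = mconst c" "c \<noteq> 0" by auto
    then have "V.dvd_in p 1"
      using mconst_unit[of c, where 'v = 'v] by (intro V.dvd_inI[of "mconst (inverse c)"]) auto
    then show ?thesis using that by (auto simp: V.factors_def)
  qed
  then show ?case unfolding V.factorial_def by blast
next
  case (insert v V)
  interpret V: subdomain "mpolys V :: ('v, 'k) mpoly set" by (rule mpolys_subdomain)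
  interpret subdomain_iso V.polys "mpolys (insert v V) :: ('v, 'k) mpoly set" "\<lambda>F. poly F (mvar v)"
    by (rule mpolys_insert_iso) (use insert in auto)
  show ?case using V.gauss[OF insert.IH] by (rule factorial_image)
qed

theorem mpolys_noetherian:
  assumes "finite V"
  shows "subdomain.noetherian (mpolys V :: ('v::linorder, 'k::field) mpoly set)"
  using assms
proof (induction V)
  case empty
  interpret V: subdomain "mpolys {} :: ('v, 'k) mpoly set" by (rule mpolys_subdomain)
  have "\<exists>G. finite G \<and> G \<subseteq> J \<and> J = V.ideal_in hull G" if J: "V.ideal_in J" "J \<subseteq> mpolys {}" for J
  proof (cases "J = {0}")
    case True
    then show ?thesis using J by (intro exI[of _ J]) (auto simp: hull_same)
  next
    case False
    interpret comm_ring_hom "mconst :: 'k \<Rightarrow> ('v, 'k) mpoly" by (rule mconst_hom)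
    obtain p where p: "p \<in> J" "p \<noteq> 0" using False V.ideal_in_0[OF J(1)] by blast
    then have "p \<in> range mconst" using J(2) unfolding mpolys_empty by blast
    then obtain c where "p = mconst c" by (elim rangeE)
    with p have c: "p = mconst c" "c \<noteq> 0" by auto
    have "mpolys {} \<subseteq> V.ideal_in hull {p}"
    proof
      fix q :: "('v, 'k) mpoly" assume q: "q \<in> mpolys {}"
      have "p \<in> V.ideal_in hull {p}" by (simp add: hull_inc)
      then have "q * mconst (inverse c) * p \<in> V.ideal_in hull {p}"
        using q by (intro V.ideal_in_mult[OF V.ideal_in_hull]) auto
      then show "q \<in> V.ideal_in hull {p}"
        using mconst_unit[of c, where 'v = 'v] c by (simp add: mult_ac)
    qed
    moreover have "V.ideal_in hull {p} \<subseteq> J" using p J by (intro hull_minimal) auto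
    ultimately show ?thesis using p J(2) by (intro exI[of _ "{p}"]) auto
  qed
  then show ?case unfolding V.noetherian_def by blast
next
  case (insert v V)
  interpret V: subdomain "mpolys V :: ('v, 'k) mpoly set" by (rule mpolys_subdomain)
  interpret subdomain_iso V.polys "mpolys (insert v V) :: ('v, 'k) mpoly set" "\<lambda>F. poly F (mvar v)"
    by (rule mpolys_insert_iso) (use insert in auto)
  show ?case using V.hilbert_basis[OF insert.IH] by (rule noetherian_image)
qed

lemma prime_in_mpolys_extend:
  fixes p :: "('v::linorder, 'k::idom) mpoly"
  assumes "subdomain.prime_in (mpolys V) p" "finite W"
  shows "subdomain.prime_in (mpolys (W \<union> V)) p"
  using assms(2)
proof (induction W)
  case (insert v W)
  show ?case
  proof (cases "v \<in> W \<union> V")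
    case True
    then show ?thesis using insert by (simp add: insert_absorb)
  next
    case False
    interpret V: subdomain "mpolys (W \<union> V) :: ('v, 'k) mpoly set" by (rule mpolys_subdomain)
    interpret subdomain_iso V.polys "mpolys (insert v (W \<union> V)) :: ('v, 'k) mpoly set" "\<lambda>F. poly F (mvar v)"
      by (rule mpolys_insert_iso[OF False])
    show ?thesis using prime_in_image[OF V.const_prime[OF insert.IH]] by simp
  qed
qed (use assms in simp)

lemma mpolys_iff_free: "p \<in> mpolys V \<longleftrightarrow> (\<forall>v. v \<notin> V \<longrightarrow> p \<in> mpolys (- {v}))"
  by (fastforce simp: mpolys_def)

text \<open>
  The degree in a variable \<open>w\<close> is additive, so a variable that does not occur in \<open>p q\<close> occurs in
  neither factor.
\<close>

lemma mpolys_mult_left: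
  fixes p q :: "('v::linorder, 'k::idom) mpoly"
  assumes "p * q \<in> mpolys V" "p * q \<noteq> 0"
  shows "p \<in> mpolys V"
proof (rule mpolys_iff_free[THEN iffD2], intro allI impI)
  fix w assume w: "w \<notin> V"
  interpret comm_ring_hom "split_var w :: ('v, 'k) mpoly \<Rightarrow> _" by (rule split_var_hom)
  have eq: "split_var w p * split_var w q = [:p * q:]"
    unfolding hom_mult[symmetric] by (rule split_var_free[OF assms(1) w])
  then have "split_var w p * split_var w q \<noteq> 0" using assms(2) by (simp del: mult_eq_0_iff)
  then have "split_var w p \<noteq> 0" "split_var w q \<noteq> 0" by (simp_all only: mult_eq_0_iff not_False_eq_True de_Morgan_disj)
  from degree_mult_eq[OF this] have "degree (split_var w p) + degree (split_var w q) = 0"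
    unfolding eq by (simp only: degree_pCons_0)
  then have "degree (split_var w p) = 0" by (rule add_is_0[THEN iffD1, THEN conjunct1])
  then obtain c where c: "split_var w p = [:c:]" by (rule degree_eq_zeroE)
  then have "p = c" using poly_split_var[of w p] by simp
  then show "p \<in> mpolys (- {w})"
    using coeff_split_var[of p UNIV w 0] c by (simp add: Compl_eq_Diff_UNIV)
qed

lemma mpolys_dvd:
  fixes p q :: "('v::linorder, 'k::idom) mpoly"
  assumes "p dvd q" "q \<in> mpolys V" "q \<noteq> 0"
  shows "p \<in> mpolys V"
  using assms mpolys_mult_left by (metis dvdE)

lemma dvd_in_mpolys_iff:
  fixes p q :: "('v::linorder, 'k::idom) mpoly"
  assumes "q \<in> mpolys V"
  shows "subdomain.dvd_in (mpolys V) p q \<longleftrightarrow> p dvd q"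
proof -
  interpret V: subdomain "mpolys V :: ('v, 'k) mpoly set" by (rule mpolys_subdomain)
  show ?thesis
  proof
    assume "p dvd q"
    then obtain c where c: "q = p * c" by (rule dvdE)
    show "V.dvd_in p q"
    proof (cases "q = 0")
      case False
      then have "c \<in> mpolys V"
        by (intro mpolys_mult_left[of c p V]) (simp_all only: mult.commute[of c p] c[symmetric] assms not_False_eq_True)
      then show ?thesis using c by (rule V.dvd_inI)
    qed simp
  qed (auto simp: V.dvd_in_def)
qed

text \<open>
  Primes of a polynomial ring stay prime when variables are adjoined, and a product in the full ring
  involves only finitely many more.
\<close>

lemma prime_in_imp_prime_elem:
  fixes p :: "('v::linorder, 'k::idom) mpoly"
  assumes "subdomain.prime_in (mpolys V) p"
  shows "prime_elem p"
proof (rule prime_elemI)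
  interpret V: subdomain "mpolys V :: ('v, 'k) mpoly set" by (rule mpolys_subdomain)
  show "p \<noteq> 0" "\<not> p dvd 1"
    using assms dvd_in_mpolys_iff[of 1 V p] by (auto simp: V.prime_in_def)
  fix a b assume ab: "p dvd a * b"
  obtain W W' where W: "finite W" "a \<in> mpolys W" "finite W'" "b \<in> mpolys W'"
    by (metis finite_variables)
  interpret U: subdomain "mpolys ((W \<union> W') \<union> V) :: ('v, 'k) mpoly set" by (rule mpolys_subdomain)
  have "a \<in> mpolys ((W \<union> W') \<union> V)" "b \<in> mpolys ((W \<union> W') \<union> V)"
    using W mpolys_mono[of W "(W \<union> W') \<union> V"] mpolys_mono[of W' "(W \<union> W') \<union> V"] by auto
  moreover have "U.prime_in p" using prime_in_mpolys_extend[OF assms, of "W \<union> W'"] W by simp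
  ultimately show "p dvd a \<or> p dvd b"
    using ab unfolding U.prime_in_def by (simp add: dvd_in_mpolys_iff)
qed

theorem mpoly_prime_factorization:
  fixes p :: "('v::linorder, 'k::field) mpoly"
  assumes "p \<noteq> 0"
  obtains u ps where "u dvd 1" "\<And>q. q \<in> set ps \<Longrightarrow> prime_elem q" "p = u * prod_list ps"
proof -
  obtain V where V: "finite V" "p \<in> mpolys V" by (rule finite_variables)
  interpret V: subdomain "mpolys V :: ('v, 'k) mpoly set" by (rule mpolys_subdomain)
  have "V.factorial" by (rule mpolys_factorial[OF V(1)])
  then obtain ps where ps: "V.factors ps p"
    using V(2) assms unfolding V.factorial_def by blast
  then obtain u where "u \<in> mpolys V" "V.dvd_in u 1" "p = u * prod_list ps"
    by (auto simp: V.factors_def)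
  moreover have "prime_elem q" if "q \<in> set ps" for q
    using that ps prime_in_imp_prime_elem unfolding V.factors_def by blast
  ultimately show ?thesis using that dvd_in_mpolys_iff[of 1 V u] by auto
qed

section \<open>The ideal generated by the forms of a star\<close>

type_synonym 'k ypoly = "(nat \<times> nat, 'k) mpoly"

text \<open>
  Setting the variables in \<open>W\<close> to zero.
\<close>

definition kill :: "'v set \<Rightarrow> ('v, 'k::comm_ring_1) mpoly \<Rightarrow> ('v, 'k) mpoly" where
  "kill W = meval mconst (\<lambda>v. if v \<in> W then 0 else mvar v)"

lemma kill_hom: "comm_ring_hom (kill W)"
  unfolding kill_def by (intro meval_hom mconst_hom)

lemma kill_mconst [simp]: "kill W (mconst c) = mconst c"
  by (simp add: kill_def meval_mconst[OF mconst_hom])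

lemma kill_mvar [simp]: "kill W (mvar v) = (if v \<in> W then 0 else mvar v)"
  by (simp add: kill_def meval_mvar[OF mconst_hom])

lemma kill_kill:
  fixes p :: "('v, 'k::comm_ring_1) mpoly"
  shows "kill W (kill W' p) = kill (W \<union> W') p"
proof -
  interpret comm_ring_hom "kill W :: ('v, 'k) mpoly \<Rightarrow> _" by (rule kill_hom)
  have var: "kill W (kill W' (mvar v)) = (kill (W \<union> W') (mvar v) :: ('v, 'k) mpoly)" for v
    by (cases "v \<in> W'") simp_all
  show ?thesis
    by (rule hom_eqI[OF comp_hom[OF kill_hom kill_hom] kill_hom, of p UNIV])
       (simp_all only: var kill_mconst mpolys_UNIV UNIV_I)
qed

lemma kill_free: "p \<in> mpolys V \<Longrightarrow> V \<inter> W = {} \<Longrightarrow> kill W p = p"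
  by (rule hom_eqI[OF kill_hom id_hom, of p V]) auto

lemma mvar_dvd_diff_kill: "mvar v dvd p - kill {v} p"
proof -
  interpret comm_ring_hom "kill {v}" by (rule kill_hom)
  have "p \<in> mpolys UNIV" by simp
  then show ?thesis
  proof (induction rule: mpolys_induct)
    case (add p q)
    have "p + q - kill {v} (p + q) = (p - kill {v} p) + (q - kill {v} q)"
      unfolding hom_add by (simp add: algebra_simps)
    then show ?case using add by (simp only: dvd_add)
  next
    case (mult p q)
    have "p * q - kill {v} (p * q) = (p - kill {v} p) * q + kill {v} p * (q - kill {v} q)"
      unfolding hom_mult by (simp add: algebra_simps)
    then show ?case using mult by (simp only: dvd_add dvd_mult2 dvd_mult)
  qed auto
qed

lemma mvar_dvd_iff_kill: "mvar v dvd p \<longleftrightarrow> kill {v} p = 0"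
proof
  interpret comm_ring_hom "kill {v}" by (rule kill_hom)
  assume "mvar v dvd p"
  then obtain q where "p = mvar v * q" by (rule dvdE)
  then show "kill {v} p = 0" by (simp add: hom_mult)
next
  assume "kill {v} p = 0"
  then show "mvar v dvd p" using mvar_dvd_diff_kill[of v p] by simp
qed

lemma mvar_nonzero [simp]: "mvar v \<noteq> (0 :: ('v, 'k::comm_ring_1) mpoly)"
proof
  assume "mvar v = (0 :: ('v, 'k) mpoly)"
  then have "pm_lookup (mvar v :: ('v, 'k) mpoly) (pm_single v 1) = 0" by simp
  then show False by (simp add: mvar_def)
qed

lemma mvar_prime:
  fixes v :: "'v::linorder"
  shows "prime_elem (mvar v :: ('v, 'k::idom) mpoly)"
proof (rule prime_elemI)
  interpret comm_ring_hom "kill {v} :: ('v, 'k) mpoly \<Rightarrow> _" by (rule kill_hom)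
  show "\<not> mvar v dvd (1 :: ('v, 'k) mpoly)" by (simp add: mvar_dvd_iff_kill)
  show "mvar v dvd a \<or> mvar v dvd b" if "mvar v dvd a * b" for a b :: "('v, 'k) mpoly"
    using that unfolding mvar_dvd_iff_kill hom_mult by simp
qed simp

text \<open>
  Multiplication of the variables in \<open>W\<close> by a new variable \<open>t\<close>; the powers of \<open>t\<close> record the degree in
  these variables.
\<close>

definition scale_vars :: "'v set \<Rightarrow> ('v, 'k::comm_ring_1) mpoly \<Rightarrow> ('v, 'k) mpoly poly" where
  "scale_vars W = meval (\<lambda>c. [:mconst c:]) (\<lambda>v. if v \<in> W then [:0, mvar v:] else [:mvar v:])"

lemma scale_vars_hom: "comm_ring_hom (scale_vars W)"
  unfolding scale_vars_def by (intro meval_hom const_poly_hom mconst_hom)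

lemma scale_vars_mconst [simp]: "scale_vars W (mconst c) = [:mconst c:]"
  by (simp add: scale_vars_def meval_mconst[OF const_poly_hom[OF mconst_hom]])

lemma scale_vars_mvar [simp]: "scale_vars W (mvar v) = (if v \<in> W then [:0, mvar v:] else [:mvar v:])"
  by (simp add: scale_vars_def meval_mvar[OF const_poly_hom[OF mconst_hom]])

lemma scale_vars_at_0: "poly (scale_vars W p) 0 = kill W p"
  by (rule hom_eqI[where V = UNIV and f = "\<lambda>p. poly (scale_vars W p) 0"])
     (auto intro: comp_hom[OF poly_eval_hom scale_vars_hom] kill_hom)

lemma LSS_poly_Suc:
  "LSS_poly (Suc q) i j = LSS_poly q i j + mvar (i, Suc q) * mvar (j, Suc q)"
  by (simp add: LSS_poly_def)

lemma LSS_poly_0 [simp]: "LSS_poly 0 i j = 0"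
  by (simp add: LSS_poly_def)

lemma LSS_poly_in_mpolys:
  assumes "{i, j} \<times> {1..q} \<subseteq> V"
  shows "LSS_poly q i j \<in> mpolys V"
  unfolding LSS_poly_def using assms by (intro mpolys_sum mpolys_mult mpolys_mvar) auto

lemma kill_LSS_poly:
  assumes "i \<noteq> n"
  shows "kill {(n, Suc q)} (LSS_poly (Suc q) i n) = LSS_poly q i n"
proof -
  interpret comm_ring_hom "kill {(n, Suc q)} :: 'a ypoly \<Rightarrow> _" by (rule kill_hom)
  have "kill {(n, Suc q)} (LSS_poly q i n) = LSS_poly q i n"
    by (rule kill_free[of _ "{i, n} \<times> {1..q}"]) (auto intro: LSS_poly_in_mpolys)
  then show ?thesis by (simp add: LSS_poly_Suc hom_add hom_mult)
qed

lemma scale_LSS_poly: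
  assumes "i \<noteq> n"
  shows "scale_vars ({n} \<times> {1..q}) (LSS_poly q i n) = [:0, LSS_poly q i n :: 'k::comm_ring_1 ypoly:]"
proof -
  let ?X = "{n} \<times> {1..q}"
  interpret comm_ring_hom "scale_vars ?X :: 'k ypoly \<Rightarrow> _" by (rule scale_vars_hom)
  have "scale_vars ?X (LSS_poly q i n :: 'k ypoly) = (\<Sum>k=1..q. [:0, mvar (i, k) * mvar (n, k):])"
    unfolding LSS_poly_def hom_sum hom_mult using assms by (intro sum.cong) auto
  also have "\<dots> = [:0, LSS_poly q i n:]"
    unfolding LSS_poly_def by (induction q) simp_all
  finally show ?thesis .
qed

text \<open>
  The ideal of the forms of the rows \<open>1, \<dots>, m\<close>, truncated to the first \<open>q\<close> columns, in the ring of
  all polynomials.  For \<open>m = n - 1\<close> and \<open>q = n\<close> it cuts out the ideal of the star; smaller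
  parameters are for induction.
\<close>

definition star_ideal :: "nat \<Rightarrow> nat \<Rightarrow> nat \<Rightarrow> 'k::comm_ring_1 ypoly set" where
  "star_ideal n m q = {\<Sum>i=1..m. c i * LSS_poly q i n | c. True}"

lemma star_idealI: "a = (\<Sum>i=1..m. c i * LSS_poly q i n) \<Longrightarrow> a \<in> star_ideal n m q"
  by (auto simp: star_ideal_def)

lemma star_idealE:
  assumes "a \<in> star_ideal n m q"
  obtains c where "a = (\<Sum>i=1..m. c i * LSS_poly q i n)"
  using assms by (auto simp: star_ideal_def)

lemma star_ideal_0 [simp]: "0 \<in> star_ideal n m q"
  by (rule star_idealI[of _ "\<lambda>_. 0"]) simp

lemma star_ideal_add:
  assumes "a \<in> star_ideal n m q" "b \<in> star_ideal n m q"
  shows "a + b \<in> star_ideal n m q"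
proof -
  obtain c d where "a = (\<Sum>i=1..m. c i * LSS_poly q i n)" "b = (\<Sum>i=1..m. d i * LSS_poly q i n)"
    using assms by (elim star_idealE)
  then show ?thesis
    by (intro star_idealI[of _ "\<lambda>i. c i + d i"]) (simp add: ring_distribs sum.distrib)
qed

lemma star_ideal_mult:
  assumes "a \<in> star_ideal n m q"
  shows "b * a \<in> star_ideal n m q"
proof -
  obtain c where "a = (\<Sum>i=1..m. c i * LSS_poly q i n)"
    using assms by (elim star_idealE)
  then show ?thesis
    by (intro star_idealI[of _ "\<lambda>i. b * c i"]) (simp add: sum_distrib_left mult.assoc)
qed

lemma star_ideal_diff:
  "a \<in> star_ideal n m q \<Longrightarrow> b \<in> star_ideal n m q \<Longrightarrow> a - b \<in> star_ideal n m q"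
  using star_ideal_add[of a n m q "-1 * b"] star_ideal_mult[of b n m q "-1"] by simp

lemma star_ideal_sum:
  "(\<And>i. i \<in> F \<Longrightarrow> f i \<in> star_ideal n m q) \<Longrightarrow> sum f F \<in> star_ideal n m q"
  by (induction F rule: infinite_finite_induct) (auto intro: star_ideal_add)

lemma star_ideal_gen:
  assumes "i \<in> {1..m}"
  shows "LSS_poly q i n \<in> star_ideal n m q"
proof (rule star_idealI)
  have "(\<Sum>j=1..m. (if j = i then 1 else 0) * LSS_poly q j n) = (\<Sum>j=1..m. if j = i then LSS_poly q j n else 0)"
    by (intro sum.cong) auto
  also have "\<dots> = LSS_poly q i n" using assms by simp
  finally show "LSS_poly q i n = (\<Sum>j=1..m. (if j = i then 1 else 0) * LSS_poly q j n)" ..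
qed

lemma star_ideal_mono: "m \<le> m' \<Longrightarrow> a \<in> star_ideal n m q \<Longrightarrow> a \<in> star_ideal n m' q"
  by (erule star_idealE) (auto intro!: star_ideal_sum star_ideal_mult star_ideal_gen)

text \<open>
  The variable \<open>w = y\<^sub>m\<^sub>+\<^sub>1\<^sub>,\<^sub>q\<close> does not occur in the generators, so membership in the ideal can be
  tested on the coefficients of the powers of \<open>w\<close>.  The form of the new row is \<open>g + x\<^sub>q w\<close> with \<open>g\<close> free
  of \<open>w\<close>.  Hence \<open>g C\<^sub>j\<^sub>+\<^sub>1 + x\<^sub>q C\<^sub>j\<close> lies in the ideal for all coefficients \<open>C\<^sub>j\<close> of \<open>c\<close>, and the claim
  follows from the top coefficient downwards.
\<close>

lemma fresh_form_torsion:
  fixes c :: "'k::idom ypoly"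
  assumes "Suc m < n" "q \<ge> 1" and mem: "LSS_poly q (Suc m) n * c \<in> star_ideal n m q"
  shows "\<exists>N. mvar (n, q) ^ N * c \<in> star_ideal n m q"
proof -
  obtain r where r: "q = Suc r" using assms(2) by (cases q) auto
  let ?w = "(Suc m, q)"
  let ?I = "star_ideal n m q :: 'k ypoly set"
  let ?x = "mvar (n, q) :: 'k ypoly"
  let ?g = "LSS_poly r (Suc m) n :: 'k ypoly"
  interpret comm_ring_hom "split_var ?w :: 'k ypoly \<Rightarrow> _" by (rule split_var_hom)
  have free: "split_var ?w (LSS_poly q i n) = [:LSS_poly q i n:]" if "i \<in> {1..m}" for i
    by (rule split_var_free[of _ "{i, n} \<times> {1..q}"]) (use that assms in \<open>auto intro: LSS_poly_in_mpolys\<close>)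
  have coeffs: "poly.coeff (split_var ?w a) j \<in> ?I" if a: "a \<in> ?I" for a j
  proof -
    obtain d where d: "a = (\<Sum>i=1..m. d i * LSS_poly q i n)" using a by (rule star_idealE)
    have "split_var ?w a = (\<Sum>i=1..m. split_var ?w (d i) * [:LSS_poly q i n:])"
      unfolding d hom_sum hom_mult by (intro sum.cong refl) (simp only: free)
    then have "poly.coeff (split_var ?w a) j = (\<Sum>i=1..m. poly.coeff (split_var ?w (d i)) j * LSS_poly q i n)"
      by (simp add: coeff_sum mult.commute)
    then show ?thesis by (rule star_idealI)
  qed
  define C where "C = split_var ?w c"
  have "split_var ?w ?g = [:?g:]"
    by (rule split_var_free[of _ "{Suc m, n} \<times> {1..r}"]) (use r in \<open>auto intro: LSS_poly_in_mpolys\<close>)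
  then have "split_var ?w (LSS_poly q (Suc m) n) = [:?g, ?x:]"
    using assms(1) unfolding r LSS_poly_Suc hom_add[unfolded r] hom_mult[unfolded r] by simp
  then have split_mult: "split_var ?w (LSS_poly q (Suc m) n * c) = [:?g, ?x:] * C"
    by (simp only: hom_mult C_def)
  have rel: "?g * poly.coeff C (Suc j) + ?x * poly.coeff C j \<in> ?I" for j
    using coeffs[OF mem, of "Suc j"] unfolding split_mult by simp
  have high_torsion: "?x ^ k * poly.coeff C j \<in> ?I" if "degree C < j + k" for k j
    using that
  proof (induction k arbitrary: j)
    case 0
    then show ?case by (simp add: coeff_eq_0)
  next
    case (Suc k)
    have "?x ^ Suc k * poly.coeff C j = ?x ^ k * (?g * poly.coeff C (Suc j) + ?x * poly.coeff C j) -
        ?g * (?x ^ k * poly.coeff C (Suc j))" by (simp add: algebra_simps)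
    moreover have "?x ^ k * poly.coeff C (Suc j) \<in> ?I" using Suc by simp
    ultimately show ?case using star_ideal_diff[OF star_ideal_mult[OF rel] star_ideal_mult] by simp
  qed
  have *: "?x ^ Suc (degree C) * poly.coeff C j \<in> ?I" for j
    by (rule high_torsion) simp
  have "?x ^ Suc (degree C) * c = ?x ^ Suc (degree C) * poly C (mvar ?w)"
    unfolding C_def by simp
  also have "\<dots> = (\<Sum>j\<le>degree C. mvar ?w ^ j * (?x ^ Suc (degree C) * poly.coeff C j))"
    unfolding poly_altdef sum_distrib_left by (intro sum.cong refl) (simp only: mult_ac)
  also have "\<dots> \<in> ?I" by (intro star_ideal_sum star_ideal_mult *)
  finally show ?thesis by blast
qed

text \<open>
  This is the part of degree one in \<open>x\<^sub>1, \<dots>, x\<^sub>q\<close> of the given equation: the left side has degree at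
  least two.  It allows the coefficients \<open>c\<^sub>i\<close> to be replaced by ones without constant part.
\<close>

lemma constant_coefficients_syzygy:
  fixes a :: "'k::idom ypoly"
  assumes "m < n" "q \<ge> 1" and a: "kill ({n} \<times> {1..q}) a = 0"
    and eq: "mvar (n, q) * a = (\<Sum>i=1..m. c i * LSS_poly q i n)"
  shows "(\<Sum>i=1..m. kill ({n} \<times> {1..q}) (c i) * LSS_poly q i n) = 0"
proof -
  let ?X = "{n} \<times> {1..q}"
  interpret comm_ring_hom "scale_vars ?X :: 'k ypoly \<Rightarrow> _" by (rule scale_vars_hom)
  have c0: "poly.coeff (scale_vars ?X p) 0 = kill ?X p" for p :: "'k ypoly"
    using scale_vars_at_0[of ?X p] by (simp add: poly_0_coeff_0)
  have "scale_vars ?X (mvar (n, q) * a) = [:0, mvar (n, q):] * scale_vars ?X a"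
    unfolding hom_mult scale_vars_mvar using assms(2) by simp
  then have "poly.coeff (scale_vars ?X (mvar (n, q) * a)) 1 = mvar (n, q) * kill ?X a"
    unfolding c0[symmetric] by simp
  also have "\<dots> = 0" using a by simp
  finally have "0 = poly.coeff (scale_vars ?X (\<Sum>i=1..m. c i * LSS_poly q i n)) 1"
    unfolding eq by simp
  also have "scale_vars ?X (\<Sum>i=1..m. c i * LSS_poly q i n) =
      (\<Sum>i=1..m. scale_vars ?X (c i) * [:0, LSS_poly q i n:])"
    unfolding hom_sum hom_mult
    by (intro sum.cong refl arg_cong2[of _ _ _ _ "(*)"] scale_LSS_poly) (use assms(1) in auto)
  also have "poly.coeff \<dots> 1 = (\<Sum>i=1..m. kill ?X (c i) * LSS_poly q i n)"
    unfolding coeff_sum by (intro sum.cong refl) (simp add: c0[unfolded One_nat_def] mult_pCons_right mult.commute)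
  finally show ?thesis by simp
qed

text \<open>
  Let \<open>x\<^sub>q a = c\<^sub>1 f\<^sub>1 + \<dots> + c\<^sub>m\<^sub>+\<^sub>1 f\<^sub>m\<^sub>+\<^sub>1\<close>.  For \<open>x\<^sub>q = 0\<close> this says that \<open>c\<^sub>m\<^sub>+\<^sub>1\<close> times the last form,
  cut to \<open>q - 1\<close> columns, lies in the ideal of the other cut forms.  By \<open>fresh_form_torsion\<close> and the
  induction hypothesis for \<open>q - 1\<close> columns, so does \<open>c\<^sub>m\<^sub>+\<^sub>1\<close> itself.  Restoring \<open>x\<^sub>q\<close>, one finds
  \<open>c\<^sub>m\<^sub>+\<^sub>1 = \<Sum>i\<le>m. h\<^sub>i f\<^sub>i + x\<^sub>q h\<close>, hence \<open>x\<^sub>q (a - h f\<^sub>m\<^sub>+\<^sub>1)\<close> is in the ideal of the first \<open>m\<close> forms, to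
  which the induction hypothesis for \<open>q\<close> columns applies.

  For \<open>m = q\<close> the determinant of the square matrix is killed by \<open>x\<^sub>q\<close> modulo the forms, so the
  restriction on \<open>a\<close> cannot be dropped.  It carries over to the coefficients by
  \<open>constant_coefficients_syzygy\<close>.
\<close>

theorem star_ideal_saturated:
  fixes a :: "'k::idom ypoly"
  assumes "m \<le> q" "m < n" "mvar (n, q) * a \<in> star_ideal n m q"
    and "m = q \<Longrightarrow> kill ({n} \<times> {1..q}) a = 0"
  shows "a \<in> star_ideal n m q"
  using assms
proof (induction m arbitrary: q a)
  case 0
  then have "mvar (n, q) * a = 0" by (simp add: star_ideal_def)
  then have "a = 0" by simp
  then show ?case by simp
next
  case (Suc m)
  obtain r where r: "q = Suc r" "m \<le> r" using Suc.prems(1) by (cases q) auto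
  let ?X = "{n} \<times> {1..q}"
  let ?f = "\<lambda>i. LSS_poly q i n :: 'k ypoly"
  interpret X: comm_ring_hom "kill ?X :: 'k ypoly \<Rightarrow> _" by (rule kill_hom)
  interpret x: comm_ring_hom "kill {(n, q)} :: 'k ypoly \<Rightarrow> _" by (rule kill_hom)
  obtain c0 where c0: "mvar (n, q) * a = (\<Sum>i=1..Suc m. c0 i * ?f i)"
    using Suc.prems(3) by (rule star_idealE)
  have "\<exists>c. mvar (n, q) * a = (\<Sum>i=1..Suc m. c i * ?f i) \<and> (Suc m = q \<longrightarrow> (\<forall>i. kill ?X (c i) = 0))"
  proof (cases "Suc m = q")
    case True
    have "(\<Sum>i=1..Suc m. kill ?X (c0 i) * ?f i) = 0"
      using Suc.prems True r(1) by (intro constant_coefficients_syzygy[OF _ _ _ c0]) auto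
    then have "mvar (n, q) * a = (\<Sum>i=1..Suc m. (c0 i - kill ?X (c0 i)) * ?f i)"
      unfolding c0 left_diff_distrib sum_subtractf by simp
    moreover have "kill ?X (c0 i - kill ?X (c0 i)) = 0" for i
      unfolding X.hom_minus kill_kill by simp
    ultimately show ?thesis by (intro exI[of _ "\<lambda>i. c0 i - kill ?X (c0 i)"]) simp
  qed (use c0 in blast)
  then obtain c where c: "mvar (n, q) * a = (\<Sum>i=1..Suc m. c i * ?f i)"
    and c_kill: "Suc m = q \<Longrightarrow> kill ?X (c (Suc m)) = 0" by blast
  define b where "b = kill {(n, q)} (c (Suc m))"
  have "b \<in> star_ideal n m r"
  proof (cases "r = 0")
    case True
    \<comment> \<open>There are no columns left: the hypothesis on \<open>a\<close> makes \<open>b\<close> vanish.\<close>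
    then have "Suc m = q" "?X = {(n, q)}" using r by auto
    then have "b = 0" using c_kill by (simp add: b_def)
    then show ?thesis by simp
  next
    case False
    have "0 = kill {(n, q)} (\<Sum>i=1..Suc m. c i * ?f i)"
      unfolding c[symmetric] by (simp add: x.hom_mult)
    also have "\<dots> = (\<Sum>i=1..Suc m. kill {(n, q)} (c i) * LSS_poly r i n)"
      unfolding x.hom_sum x.hom_mult unfolding r(1)
      by (intro sum.cong refl arg_cong2[of _ _ _ _ "(*)"] kill_LSS_poly) (use Suc.prems(2) in auto)
    finally have "LSS_poly r (Suc m) n * b = (\<Sum>i=1..m. (- kill {(n, q)} (c i)) * LSS_poly r i n)"
      by (simp add: b_def sum_negf mult.commute eq_neg_iff_add_eq_0 add.commute)
    then have "LSS_poly r (Suc m) n * b \<in> star_ideal n m r" by (rule star_idealI)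
    then obtain N where N: "mvar (n, r) ^ N * b \<in> star_ideal n m r"
      using fresh_form_torsion[of m n r b] False Suc.prems(2) by auto
    have bX: "kill ({n} \<times> {1..r}) b = 0" if "m = r"
    proof -
      have "{n} \<times> {1..r} \<union> {(n, q)} = ?X" using r by auto
      then show ?thesis using c_kill that r unfolding b_def kill_kill by simp
    qed
    interpret R: comm_ring_hom "kill ({n} \<times> {1..r}) :: 'k ypoly \<Rightarrow> _" by (rule kill_hom)
    have step: "d \<in> star_ideal n m r"
      if "mvar (n, r) * d \<in> star_ideal n m r" "m = r \<Longrightarrow> kill ({n} \<times> {1..r}) d = 0" for d :: "'k ypoly"
      by (rule Suc.IH[OF r(2) Suc_lessD[OF Suc.prems(2)] that])
    from N show "b \<in> star_ideal n m r"
    proof (induction N)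
      case (Suc N)
      have "mvar (n, r) ^ N * b \<in> star_ideal n m r"
      proof (rule step)
        show "mvar (n, r) * (mvar (n, r) ^ N * b) \<in> star_ideal n m r"
          using Suc.prems by (simp add: mult.assoc)
        show "kill ({n} \<times> {1..r}) (mvar (n, r) ^ N * b) = 0" if "m = r"
          unfolding R.hom_mult bX[OF that] by (rule mult_zero_right)
      qed
      then show ?case by (rule Suc.IH)
    qed simp
  qed
  then obtain h where h: "b = (\<Sum>i=1..m. h i * LSS_poly r i n)" by (rule star_idealE)
  obtain h' where h': "c (Suc m) - b = mvar (n, q) * h'"
    unfolding b_def using mvar_dvd_diff_kill by (rule dvdE)
  \<comment> \<open>The correction turns the cut forms in the expression of \<open>b\<close> into forms with \<open>q\<close> columns.\<close>
  define h'' where "h'' = h' - (\<Sum>i=1..m. h i * mvar (i, q))"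
  have "b = (\<Sum>i=1..m. h i * ?f i) - mvar (n, q) * (\<Sum>i=1..m. h i * mvar (i, q))"
    unfolding h r(1) LSS_poly_Suc by (simp add: algebra_simps sum.distrib sum_distrib_left)
  then have cm: "c (Suc m) = (\<Sum>i=1..m. h i * ?f i) + mvar (n, q) * h''"
    using h' by (simp add: h''_def algebra_simps)
  have "mvar (n, q) * (a - h'' * ?f (Suc m)) = (\<Sum>i=1..m. c i * ?f i) + (\<Sum>i=1..m. h i * ?f i) * ?f (Suc m)"
    unfolding right_diff_distrib c using cm by (simp add: algebra_simps)
  also have "\<dots> = (\<Sum>i=1..m. (c i + ?f (Suc m) * h i) * ?f i)"
    by (simp add: ring_distribs sum.distrib sum_distrib_left sum_distrib_right mult_ac)
  finally have "mvar (n, q) * (a - h'' * ?f (Suc m)) \<in> star_ideal n m q" by (rule star_idealI)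
  then have "a - h'' * ?f (Suc m) \<in> star_ideal n m q"
    by (rule Suc.IH[rotated 2]) (use Suc.prems(1,2) in simp_all)
  then have "a - h'' * ?f (Suc m) \<in> star_ideal n (Suc m) q" by (rule star_ideal_mono[rotated]) simp
  moreover have "h'' * ?f (Suc m) \<in> star_ideal n (Suc m) q"
    by (intro star_ideal_mult star_ideal_gen) simp
  ultimately have "(a - h'' * ?f (Suc m)) + h'' * ?f (Suc m) \<in> star_ideal n (Suc m) q"
    by (rule star_ideal_add)
  then show ?case by simp
qed

lemma star_ideal_saturated_power:
  fixes a :: "'k::idom ypoly"
  assumes "m \<le> q" "m < n" "mvar (n, q) ^ N * a \<in> star_ideal n m q"
    and "m = q \<Longrightarrow> kill ({n} \<times> {1..q}) a = 0"
  shows "a \<in> star_ideal n m q"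
  using assms(3)
proof (induction N)
  case (Suc N)
  interpret comm_ring_hom "kill ({n} \<times> {1..q}) :: 'k ypoly \<Rightarrow> _" by (rule kill_hom)
  have "mvar (n, q) ^ N * a \<in> star_ideal n m q"
  proof (rule star_ideal_saturated[OF assms(1,2)])
    show "mvar (n, q) * (mvar (n, q) ^ N * a) \<in> star_ideal n m q"
      using Suc.prems by (simp add: mult.assoc)
    show "kill ({n} \<times> {1..q}) (mvar (n, q) ^ N * a) = 0" if "m = q"
      unfolding hom_mult assms(4)[OF that] by (rule mult_zero_right)
  qed
  then show ?case by (rule Suc.IH)
qed simp

section \<open>Orders of vanishing along prime elements\<close>

text \<open>
  The exponent of \<open>p\<close> in \<open>a\<close>, provided that not all powers of \<open>p\<close> divide \<open>a\<close>.
\<close>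

definition prime_ord :: "'a::comm_semiring_1 \<Rightarrow> 'a \<Rightarrow> nat" where
  "prime_ord p a = (LEAST k. \<not> p ^ Suc k dvd a)"

locale discrete_prime =
  fixes p :: "'a::idom"
  assumes prime: "prime_elem p"
    and bounded: "\<And>a. a \<noteq> 0 \<Longrightarrow> \<exists>k. \<not> p ^ k dvd a"
begin

lemma power_dvd_iff:
  assumes "a \<noteq> 0"
  shows "p ^ k dvd a \<longleftrightarrow> k \<le> prime_ord p a"
proof -
  let ?m = "prime_ord p a"
  obtain k0 where "\<not> p ^ k0 dvd a" using bounded[OF assms] by blast
  then have ex: "\<exists>k. \<not> p ^ Suc k dvd a"
    by (metis dvd_power_le dvd_refl dvd_trans le_SucI order_refl)
  have notdvd: "\<not> p ^ Suc ?m dvd a"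
    unfolding prime_ord_def by (rule LeastI_ex[OF ex])
  have dvd: "p ^ ?m dvd a"
  proof (cases ?m)
    case (Suc l)
    then have "l < ?m" by simp
    then show ?thesis using not_less_Least[of l "\<lambda>k. \<not> p ^ Suc k dvd a"] Suc
      unfolding prime_ord_def by simp
  qed simp
  show ?thesis
  proof
    assume "p ^ k dvd a"
    show "k \<le> ?m"
    proof (rule ccontr)
      assume "\<not> k \<le> ?m"
      then have "p ^ Suc ?m dvd p ^ k" by (intro le_imp_power_dvd) simp
      then show False using \<open>p ^ k dvd a\<close> notdvd dvd_trans by blast
    qed
  next
    assume "k \<le> ?m"
    then have "p ^ k dvd p ^ ?m" by (rule le_imp_power_dvd)
    then show "p ^ k dvd a" using dvd by (rule dvd_trans)
  qed
qed

lemma prime_ord_unique: "a \<noteq> 0 \<Longrightarrow> p ^ k dvd a \<Longrightarrow> \<not> p ^ Suc k dvd a \<Longrightarrow> prime_ord p a = k"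
  unfolding power_dvd_iff by simp

lemma prime_ord_pos_iff: "a \<noteq> 0 \<Longrightarrow> 0 < prime_ord p a \<longleftrightarrow> p dvd a"
  using power_dvd_iff[of a 1] by (simp add: Suc_le_eq)

lemma prime_ord_0_iff: "a \<noteq> 0 \<Longrightarrow> prime_ord p a = 0 \<longleftrightarrow> \<not> p dvd a"
  using prime_ord_pos_iff[of a] by (cases "prime_ord p a") auto

lemma p_nonzero: "p \<noteq> 0"
  using prime by (simp add: prime_elem_def)

lemma prime_ord_mult:
  assumes "a \<noteq> 0" "b \<noteq> 0"
  shows "prime_ord p (a * b) = prime_ord p a + prime_ord p b"
proof -
  have dec: "\<exists>c'. c = p ^ prime_ord p c * c' \<and> \<not> p dvd c'" if "c \<noteq> 0" for c
  proof -
    have "p ^ prime_ord p c dvd c" using power_dvd_iff[OF that] by simp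
    then obtain c' where c': "c = p ^ prime_ord p c * c'" by (rule dvdE)
    have "\<not> p dvd c'"
    proof
      assume "p dvd c'"
      then have "p ^ prime_ord p c * p dvd p ^ prime_ord p c * c'" by (rule mult_dvd_mono[OF dvd_refl])
      then have "p ^ Suc (prime_ord p c) dvd c" unfolding c'[symmetric] by (simp add: mult.commute)
      then show False unfolding power_dvd_iff[OF that] by simp
    qed
    then show ?thesis using c' by blast
  qed
  obtain a' where a': "a = p ^ prime_ord p a * a'" "\<not> p dvd a'" using dec[OF assms(1)] by blast
  obtain b' where b': "b = p ^ prime_ord p b * b'" "\<not> p dvd b'" using dec[OF assms(2)] by blast
  let ?k = "prime_ord p a + prime_ord p b"
  have ab: "a * b = p ^ ?k * (a' * b')"
    by (subst a'(1), subst b'(1)) (simp add: power_add mult_ac)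
  show ?thesis
  proof (rule prime_ord_unique)
    show "a * b \<noteq> 0" using assms by simp
    show "p ^ ?k dvd a * b" unfolding ab by simp
    show "\<not> p ^ Suc ?k dvd a * b"
    proof
      assume "p ^ Suc ?k dvd a * b"
      then have "p ^ ?k * p dvd p ^ ?k * (a' * b')" unfolding ab by (simp add: mult.commute)
      then have "p dvd a' * b'" using p_nonzero by (subst (asm) dvd_mult_cancel_left) simp
      then show False using prime a'(2) b'(2) by (simp add: prime_elem_dvd_mult_iff)
    qed
  qed
qed

lemma prime_ord_add:
  assumes "a \<noteq> 0" "b \<noteq> 0" "a + b \<noteq> 0"
  shows "min (prime_ord p a) (prime_ord p b) \<le> prime_ord p (a + b)"
  using power_dvd_iff[OF assms(1)] power_dvd_iff[OF assms(2)] power_dvd_iff[OF assms(3)]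
  by (metis dvd_add min.cobounded1 min.cobounded2)

lemma prime_ord_self: "prime_ord p p = 1"
proof (rule prime_ord_unique)
  show "\<not> p ^ Suc 1 dvd p"
  proof
    assume "p ^ Suc 1 dvd p"
    then have "p * p dvd p * 1" by simp
    then have "p dvd 1" using p_nonzero by (subst (asm) dvd_mult_cancel_left) simp
    then show False using prime by (simp add: prime_elem_def)
  qed
qed (use p_nonzero in auto)

lemma prime_ord_power: "a \<noteq> 0 \<Longrightarrow> prime_ord p (a ^ k) = k * prime_ord p a"
proof (induction k)
  case 0
  have "\<not> p dvd 1" using prime by (simp add: prime_elem_def)
  then show ?case by (simp add: prime_ord_0_iff)
next
  case (Suc k)
  then show ?case by (simp add: prime_ord_mult)
qed

end

lemma discrete_prime_var: "discrete_prime ([:0, 1:] :: 'a::idom poly)"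
proof
  have dvd: "[:0, 1:] dvd F \<longleftrightarrow> poly F 0 = 0" for F :: "'a poly"
    using poly_eq_0_iff_dvd[of F 0] by simp
  show "prime_elem ([:0, 1:] :: 'a poly)" by (rule prime_elemI) (auto simp: dvd)
  show "\<exists>k. \<not> [:0, 1:] ^ k dvd F" if F: "F \<noteq> 0" for F :: "'a poly"
  proof (intro exI[of _ "Suc (degree F)"] notI)
    assume dvd: "[:0, 1:] ^ Suc (degree F) dvd F"
    have "degree ([:0, 1 :: 'a:] ^ Suc (degree F)) \<le> degree F" by (rule dvd_imp_degree_le[OF dvd F])
    then show False by (simp add: degree_power_eq del: power_Suc)
  qed
qed

lemma unit_is_constant:
  fixes u :: "('v::linorder, 'k::idom) mpoly"
  assumes "u dvd 1"
  obtains e where "u = mconst e" "u \<noteq> 0"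
proof -
  have "u \<in> mpolys {}" by (rule mpolys_dvd[OF assms]) simp_all
  then have "u \<in> range mconst" unfolding mpolys_empty .
  then obtain e where "u = mconst e" by (elim rangeE)
  moreover have "u \<noteq> 0" using assms by auto
  ultimately show ?thesis by (rule that)
qed

text \<open>
  A prime polynomial involves some variable \<open>w\<close>, and the degree in \<open>w\<close> bounds the exponent.
\<close>

lemma discrete_prime_mpoly:
  fixes p :: "('v::linorder, 'k::field) mpoly"
  assumes p: "prime_elem p"
  shows "discrete_prime p"
proof
  show "prime_elem p" by (rule p)
  have nz: "p \<noteq> 0" and nu: "\<not> p dvd 1" using p by (auto simp: prime_elem_def)
  have "p \<notin> mpolys {}"
  proof
    assume "p \<in> mpolys {}"
    then have "p \<in> range mconst" unfolding mpolys_empty .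
    then obtain c where c: "p = mconst c" by (elim rangeE)
    interpret comm_ring_hom "mconst :: 'k \<Rightarrow> ('v, 'k) mpoly" by (rule mconst_hom)
    have "c \<noteq> 0" using nz c by auto
    from mconst_unit[OF this, where 'v = 'v] have "p dvd 1" unfolding c by (metis dvd_triv_left)
    then show False using nu by simp
  qed
  then obtain w where w: "p \<notin> mpolys (- {w})" using mpolys_iff_free[of p "{}"] by blast
  have deg: "degree (split_var w p) \<noteq> 0"
  proof
    assume "degree (split_var w p) = 0"
    then obtain c where c: "split_var w p = [:c:]" by (rule degree_eq_zeroE)
    then have "p = c" using poly_split_var[of w p] by simp
    then show False using w coeff_split_var[of p UNIV w 0] c by (simp add: Compl_eq_Diff_UNIV)
  qed
  interpret comm_ring_hom "split_var w :: ('v, 'k) mpoly \<Rightarrow> _" by (rule split_var_hom)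
  show "\<exists>k. \<not> p ^ k dvd a" if a: "a \<noteq> 0" for a
  proof (intro exI[of _ "Suc (degree (split_var w a))"] notI)
    let ?k = "Suc (degree (split_var w a))"
    assume "p ^ ?k dvd a"
    then have dvd: "split_var w p ^ ?k dvd split_var w a" unfolding hom_power[symmetric] by (rule hom_dvd)
    have "split_var w a \<noteq> 0" using a poly_split_var[of w a] by (metis poly_0)
    from dvd_imp_degree_le[OF dvd this] have "?k * degree (split_var w p) \<le> degree (split_var w a)"
      using deg by (subst (asm) degree_power_eq) auto
    moreover have "?k * 1 \<le> ?k * degree (split_var w p)" using deg by (intro mult_le_mono2) simp
    ultimately have "?k * 1 \<le> degree (split_var w a)" by (rule order.trans[rotated])
    then show False by simp
  qed
qed

lemma divisors_of_prime_power:
  fixes p c d :: "'a::idom"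
  assumes p: "prime_elem p" and cd: "c * d = p ^ M"
  shows "\<exists>u k. u dvd 1 \<and> c = u * p ^ k"
  using cd
proof (induction M arbitrary: c d)
  case 0
  then have "c dvd 1" by (metis dvd_triv_left power_0)
  then show ?case by (intro exI[of _ c] exI[of _ 0]) simp
next
  case (Suc M)
  have p0: "p \<noteq> 0" using p by (auto simp: prime_elem_def)
  have "p dvd c * d" unfolding Suc.prems by simp
  then consider "p dvd c" | "p dvd d" using p by (auto simp: prime_elem_dvd_mult_iff)
  then show ?case
  proof cases
    case 1
    then obtain c' where c': "c = p * c'" by (rule dvdE)
    then have "c' * d = p ^ M" using Suc.prems p0 by (simp add: mult.assoc)
    from Suc.IH[OF this] obtain u k where "u dvd 1" "c' = u * p ^ k" by blast
    then show ?thesis by (intro exI[of _ u] exI[of _ "Suc k"]) (simp add: c' mult_ac)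
  next
    case 2
    then obtain d' where d': "d = p * d'" by (rule dvdE)
    then have "c * d' = p ^ M" using Suc.prems p0 by (simp add: mult.left_commute)
    then show ?thesis by (rule Suc.IH)
  qed
qed

text \<open>
  Induction on the prime factors of \<open>B\<close>.  Those that divide \<open>x\<close> are absorbed by a power of \<open>x\<close>; each
  other one divides \<open>A\<close> and is cancelled on both sides.
\<close>

lemma dvd_up_to_prime:
  fixes A B x :: "('v::linorder, 'k::field) mpoly"
  assumes A: "A \<noteq> 0" and B: "B \<noteq> 0"
    and ord: "\<And>q. prime_elem q \<Longrightarrow> \<not> q dvd x \<Longrightarrow> prime_ord q B \<le> prime_ord q A"
  shows "\<exists>N. B dvd x ^ N * A"
proof -
  obtain u ps where u: "u dvd 1" and ps: "\<And>q. q \<in> set ps \<Longrightarrow> prime_elem q" and fac: "B = u * prod_list ps"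
    using mpoly_prime_factorization[OF B] by metis
  have "\<exists>N. prod_list ps dvd x ^ N * A"
    if "\<And>q. q \<in> set ps \<Longrightarrow> prime_elem q"
      "\<And>q. prime_elem q \<Longrightarrow> \<not> q dvd x \<Longrightarrow> prime_ord q (prod_list ps) \<le> prime_ord q A" "A \<noteq> 0"
    for ps A
    using that
  proof (induction ps arbitrary: A)
    case Nil
    then show ?case by simp
  next
    case (Cons p ps)
    have p: "prime_elem p" using Cons.prems(1) by simp
    interpret p: discrete_prime p by (rule discrete_prime_mpoly[OF p])
    have ps0: "prod_list ps \<noteq> 0"
      using Cons.prems(1)[of 0] by (auto simp: prod_list_zero_iff prime_elem_def)
    show ?case
    proof (cases "p dvd x")
      case True
      have "prime_ord q (prod_list ps) \<le> prime_ord q A" if q: "prime_elem q" "\<not> q dvd x" for q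
      proof -
        interpret q: discrete_prime q by (rule discrete_prime_mpoly[OF q(1)])
        show ?thesis using Cons.prems(2)[OF q] q.prime_ord_mult[OF p.p_nonzero ps0] by simp
      qed
      then obtain N where "prod_list ps dvd x ^ N * A"
        using Cons.IH[of A] Cons.prems by auto
      with True have "p * prod_list ps dvd x * (x ^ N * A)" by (rule mult_dvd_mono)
      then show ?thesis by (intro exI[of _ "Suc N"]) (simp add: mult.assoc)
    next
      case False
      have "0 < prime_ord p (p * prod_list ps)"
        using p.prime_ord_mult[OF p.p_nonzero ps0] p.prime_ord_self by simp
      then have "0 < prime_ord p A" using Cons.prems(2)[OF p False] by simp
      then have "p dvd A" using p.prime_ord_pos_iff[OF Cons.prems(3)] by simp
      then obtain A' where A': "A = p * A'" by (rule dvdE)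
      have A'0: "A' \<noteq> 0" using A' Cons.prems(3) by auto
      have "prime_ord q (prod_list ps) \<le> prime_ord q A'" if q: "prime_elem q" "\<not> q dvd x" for q
      proof -
        interpret q: discrete_prime q by (rule discrete_prime_mpoly[OF q(1)])
        show ?thesis
          using Cons.prems(2)[OF q] q.prime_ord_mult[OF p.p_nonzero ps0]
            q.prime_ord_mult[OF p.p_nonzero A'0] by (simp add: A')
      qed
      then obtain N where "prod_list ps dvd x ^ N * A'"
        using Cons.IH[of A'] Cons.prems A'0 by auto
      then have "p * prod_list ps dvd p * (x ^ N * A')" by (rule mult_dvd_mono[OF dvd_refl])
      then show ?thesis by (intro exI[of _ N]) (simp add: A' mult.left_commute)
    qed
  qed
  moreover have "prime_ord q (prod_list ps) \<le> prime_ord q A" if q: "prime_elem q" "\<not> q dvd x" for q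
  proof -
    interpret q: discrete_prime q by (rule discrete_prime_mpoly[OF q(1)])
    have "u \<noteq> 0" "prod_list ps \<noteq> 0" using B fac by auto
    then show ?thesis using ord[OF q] q.prime_ord_mult[of u "prod_list ps"] by (simp add: fac)
  qed
  ultimately obtain N where "prod_list ps dvd x ^ N * A" using ps A by blast
  with u have "u * prod_list ps dvd 1 * (x ^ N * A)" by (rule mult_dvd_mono)
  then show ?thesis unfolding fac by (intro exI[of _ N]) simp
qed

text \<open>
  A choice of one element in each class of associates, so that distinct representatives define distinct
  valuations.
\<close>

definition prime_rep :: "'a::comm_semiring_1 \<Rightarrow> 'a" where
  "prime_rep p = (SOME q. q dvd p \<and> p dvd q)"

lemma prime_rep: "prime_rep p dvd p" "p dvd prime_rep p"
proof -
  have "\<exists>q. q dvd p \<and> p dvd q" by (intro exI[of _ p]) simp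
  from someI_ex[OF this] show "prime_rep p dvd p" "p dvd prime_rep p"
    by (auto simp: prime_rep_def)
qed

lemma prime_rep_cong:
  assumes "p dvd q" "q dvd p"
  shows "prime_rep p = prime_rep q"
proof -
  have "(\<lambda>r. r dvd p \<and> p dvd r) = (\<lambda>r. r dvd q \<and> q dvd r)"
    using assms by (auto intro: dvd_trans)
  then show ?thesis by (simp add: prime_rep_def)
qed

lemma prime_dvd_prime:
  fixes p q :: "'a::idom"
  assumes "prime_elem p" "prime_elem q" "p dvd q"
  shows "q dvd p"
proof -
  obtain c where c: "q = p * c" using assms(3) by (rule dvdE)
  have q0: "q \<noteq> 0" and p1: "\<not> p dvd 1" using assms by (auto simp: prime_elem_def)
  have "q dvd p * c" by (simp add: c)
  then have "q dvd p \<or> q dvd c" using assms(2) by (simp add: prime_elem_dvd_mult_iff)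
  moreover have "\<not> q dvd c"
  proof
    assume "q dvd c"
    then obtain d where d: "c = q * d" by (rule dvdE)
    have "q * (p * d) = p * (q * d)" by (rule mult.left_commute)
    also have "\<dots> = q * 1" unfolding d[symmetric] c[symmetric] by simp
    finally have "q * 1 = q * (p * d)" ..
    then have "1 = p * d" using mult_left_cancel[OF q0, of 1 "p * d"] by simp
    then show False using p1 by (metis dvd_triv_left)
  qed
  ultimately show ?thesis by simp
qed

lemma prime_elem_assoc:
  fixes p q :: "'a::idom"
  assumes "prime_elem p" "p dvd q" "q dvd p"
  shows "prime_elem q"
proof (rule prime_elemI)
  show "q \<noteq> 0" using assms by (auto simp: prime_elem_def)
  show "\<not> q dvd 1" using assms by (meson dvd_trans prime_elem_def)
  show "q dvd a \<or> q dvd b" if "q dvd a * b" for a b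
    using that assms by (meson dvd_trans prime_elem_dvd_multD)
qed

lemma prime_ord_assoc:
  fixes p q :: "'a::idom"
  assumes "p dvd q" "q dvd p"
  shows "prime_ord p = prime_ord q"
proof
  fix a
  have "p ^ k dvd a \<longleftrightarrow> q ^ k dvd a" for k
    using dvd_power_same[OF assms(1)] dvd_power_same[OF assms(2)] by (meson dvd_trans)
  then show "prime_ord p a = prime_ord q a" unfolding prime_ord_def by presburger
qed

section \<open>Charts of the star ring\<close>

text \<open>
  On the locus \<open>x\<^sub>j \<noteq> 0\<close> the relation of row \<open>i\<close> determines \<open>y\<^sub>i\<^sub>j\<close> as
  \<open>- (\<Sum>l\<noteq>j. y\<^sub>i\<^sub>l x\<^sub>l) / x\<^sub>j\<close>.  The relations are homogeneous in each row, and scaling all rows by \<open>x\<^sub>j\<close>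
  turns this into a substitution by polynomials.
\<close>

definition chart :: "nat \<Rightarrow> nat \<Rightarrow> 'k::comm_ring_1 ypoly \<Rightarrow> 'k ypoly" where
  "chart n j = meval mconst (\<lambda>(i, k). if i = n then mvar (i, k)
     else if k = j then - (\<Sum>l\<in>{1..n} - {j}. mvar (i, l) * mvar (n, l))
     else mvar (n, j) * mvar (i, k))"

definition chart_vars :: "nat \<Rightarrow> nat \<Rightarrow> (nat \<times> nat) set" where
  "chart_vars n j = {(i, k). i = n \<or> k \<noteq> j}"

lemma chart_hom: "comm_ring_hom (chart n j)"
  unfolding chart_def by (intro meval_hom mconst_hom)

lemma chart_mconst [simp]: "chart n j (mconst c) = mconst c"
  by (simp add: chart_def meval_mconst[OF mconst_hom])

lemma chart_center [simp]: "chart n j (mvar (n, k)) = mvar (n, k)"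
  by (simp add: chart_def meval_mvar[OF mconst_hom])

lemma chart_column: "i \<noteq> n \<Longrightarrow> chart n j (mvar (i, j)) = - (\<Sum>l\<in>{1..n} - {j}. mvar (i, l) * mvar (n, l))"
  by (simp add: chart_def meval_mvar[OF mconst_hom])

lemma chart_other: "i \<noteq> n \<Longrightarrow> k \<noteq> j \<Longrightarrow> chart n j (mvar (i, k)) = mvar (n, j) * mvar (i, k)"
  by (simp add: chart_def meval_mvar[OF mconst_hom])

lemma chart_LSS_poly:
  assumes "i \<noteq> n" "j \<in> {1..n}"
  shows "chart n j (LSS_poly n i n) = (0 :: 'k::comm_ring_1 ypoly)"
proof -
  interpret comm_ring_hom "chart n j :: 'k ypoly \<Rightarrow> _" by (rule chart_hom)
  let ?S = "\<Sum>l\<in>{1..n} - {j}. mvar (i, l) * mvar (n, l) :: 'k ypoly"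
  have "chart n j (LSS_poly n i n) = (\<Sum>k\<in>{1..n}. chart n j (mvar (i, k)) * mvar (n, k) :: 'k ypoly)"
    unfolding LSS_poly_def hom_sum hom_mult chart_center by (rule refl)
  also have "\<dots> = - ?S * mvar (n, j) + (\<Sum>k\<in>{1..n} - {j}. chart n j (mvar (i, k)) * mvar (n, k))"
    using assms by (subst sum.remove[of _ j]) (auto simp: chart_column)
  also have "(\<Sum>k\<in>{1..n} - {j}. chart n j (mvar (i, k)) * mvar (n, k)) =
      (\<Sum>k\<in>{1..n} - {j}. mvar (n, j) * (mvar (i, k) * mvar (n, k) :: 'k ypoly))"
    by (intro sum.cong refl) (use assms(1) in \<open>simp add: chart_other mult.assoc\<close>)
  also have "\<dots> = mvar (n, j) * ?S" by (rule sum_distrib_left[symmetric])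
  finally show ?thesis by (simp add: mult.commute)
qed

lemma chart_star_ideal:
  assumes a: "a \<in> star_ideal n (n - 1) n" and j: "j \<in> {1..n}"
  shows "chart n j a = (0 :: 'k::comm_ring_1 ypoly)"
proof -
  interpret comm_ring_hom "chart n j :: 'k ypoly \<Rightarrow> _" by (rule chart_hom)
  obtain c where c: "a = (\<Sum>i=1..n - 1. c i * LSS_poly n i n)" using a by (rule star_idealE)
  show ?thesis unfolding c hom_sum hom_mult
    by (rule sum.neutral) (use j in \<open>auto simp: chart_LSS_poly\<close>)
qed

lemma chart_in_mpolys:
  assumes a: "a \<in> mpolys ({1..n} \<times> {1..n})" and j: "j \<in> {1..n}"
  shows "chart n j a \<in> mpolys ({1..n} \<times> {1..n} \<inter> chart_vars n j)"
proof -
  interpret comm_ring_hom "chart n j" by (rule chart_hom)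
  let ?W = "{1..n} \<times> {1..n} \<inter> chart_vars n j"
  from a show ?thesis
  proof (induction rule: mpolys_induct)
    case (var v)
    obtain i k where v: "v = (i, k)" "i \<in> {1..n}" "k \<in> {1..n}" using var by auto
    have x: "(n, l) \<in> ?W" if "l \<in> {1..n}" for l using that j by (auto simp: chart_vars_def)
    have y: "(i, l) \<in> ?W" if "l \<in> {1..n}" "l \<noteq> j" for l using that v by (auto simp: chart_vars_def)
    consider "i = n" | "i \<noteq> n" "k = j" | "i \<noteq> n" "k \<noteq> j" by blast
    then show ?case
    proof cases
      case 1
      then show ?thesis unfolding v(1) 1 chart_center by (intro mpolys_mvar x v)
    next
      case 2
      show ?thesis unfolding v(1) 2(2) chart_column[OF 2(1)]
        by (intro mpolys_uminus mpolys_sum mpolys_mult mpolys_mvar x y) auto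
    next
      case 3
      show ?thesis unfolding v(1) chart_other[OF 3] by (intro mpolys_mult mpolys_mvar x y v 3 j)
    qed
  qed (simp_all only: hom_add hom_mult chart_mconst mpolys_add mpolys_mult mpolys_mconst)
qed

lemma to_fract_hom: "comm_ring_hom (\<lambda>a::'a::idom. Fract a 1)"
  by unfold_locales (simp_all add: Zero_fract_def One_fract_def)

text \<open>
  On polynomials without \<open>y\<^sub>i\<^sub>j\<close> the chart only replaces \<open>y\<^sub>i\<^sub>k\<close> by \<open>x\<^sub>j y\<^sub>i\<^sub>k\<close>.  This is undone in the
  field of fractions.
\<close>

lemma chart_inj:
  fixes b :: "'k::idom ypoly"
  assumes b: "b \<in> mpolys (chart_vars n j)" and 0: "chart n j b = 0"
  shows "b = 0"
proof -
  let ?e = "\<lambda>a :: 'k ypoly. Fract a 1"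
  \<comment> \<open>\<open>\<rho>\<close> divides the \<open>y\<^sub>i\<^sub>k\<close> by \<open>x\<^sub>j\<close>.\<close>
  define \<rho> where "\<rho> = meval (\<lambda>c. ?e (mconst c))
    (\<lambda>(i, k). if i = n then ?e (mvar (i, k)) else Fract (mvar (i, k)) (mvar (n, j)))"
  have h: "comm_ring_hom (\<lambda>c. ?e (mconst c))" by (intro comp_hom[OF to_fract_hom mconst_hom])
  interpret \<rho>: comm_ring_hom \<rho> unfolding \<rho>_def by (rule meval_hom[OF h])
  have "\<rho> (chart n j b) = ?e b"
  proof (rule hom_eqI[OF comp_hom[OF \<rho>.comm_ring_hom_axioms chart_hom] to_fract_hom b])
    show "\<rho> (chart n j (mconst c)) = ?e (mconst c)" for c
      by (simp add: \<rho>_def meval_mconst[OF h])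
    show "\<rho> (chart n j (mvar v)) = ?e (mvar v)" if mem: "v \<in> chart_vars n j" for v
    proof -
      obtain i k where v: "v = (i, k)" "i = n \<or> k \<noteq> j" using mem by (auto simp: chart_vars_def)
      show ?thesis
      proof (cases "i = n")
        case True
        then show ?thesis unfolding v(1) by (simp add: \<rho>_def meval_mvar[OF h])
      next
        case False
        then have "chart n j (mvar v) = mvar (n, j) * (mvar (i, k) :: 'k ypoly)"
          using v by (simp add: chart_other)
        then have "\<rho> (chart n j (mvar v)) = ?e (mvar (n, j)) * Fract (mvar (i, k)) (mvar (n, j))"
          using False by (simp add: \<rho>.hom_mult) (simp add: \<rho>_def meval_mvar[OF h])
        also have "\<dots> = ?e (mvar v)" unfolding v(1) by (simp add: eq_fract)
        finally show ?thesis .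
      qed
    qed
  qed
  then have "?e b = 0" using 0 by simp
  then show "b = 0" by (simp add: Zero_fract_def eq_fract)
qed

text \<open>
  Modulo the forms, \<open>x\<^sub>j y\<^sub>i\<^sub>j\<close> can be rewritten without the variables of column \<open>j\<close>.
\<close>

lemma chart_clear_column:
  fixes a :: "'k::comm_ring_1 ypoly"
  assumes a: "a \<in> mpolys ({1..n} \<times> {1..n})" and j: "j \<in> {1..n}"
  shows "\<exists>N. \<exists>b\<in>mpolys ({1..n} \<times> {1..n} \<inter> chart_vars n j). mvar (n, j) ^ N * a - b \<in> star_ideal n (n - 1) n"
  using a
proof (induction rule: mpolys_induct)
  let ?W = "{1..n} \<times> {1..n} \<inter> chart_vars n j"
  let ?L = "star_ideal n (n - 1) n :: 'k ypoly set"
  let ?x = "mvar (n, j) :: 'k ypoly"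
  have xW: "?x \<in> mpolys ?W" using j by (intro mpolys_mvar) (auto simp: chart_vars_def)
  {
    case (const c)
    show ?case by (intro exI[of _ 0] bexI[of _ "mconst c"]) auto
  next
    case (var v)
    show ?case
    proof (cases "v \<in> chart_vars n j")
      case True
      then show ?thesis using var by (intro exI[of _ 0] bexI[of _ "mvar v"]) auto
    next
      case False
      then obtain i where v: "v = (i, j)" "i \<noteq> n" "i \<in> {1..n}"
        using var by (auto simp: chart_vars_def)
      let ?b = "- (\<Sum>l\<in>{1..n} - {j}. mvar (i, l) * mvar (n, l)) :: 'k ypoly"
      have "LSS_poly n i n = mvar (i, j) * ?x - ?b"
        unfolding LSS_poly_def using j by (subst sum.remove[of _ j]) auto
      then have "?x ^ 1 * mvar v - ?b = LSS_poly n i n" by (simp add: v mult.commute)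
      moreover have "LSS_poly n i n \<in> ?L" using v by (intro star_ideal_gen) auto
      moreover have "?b \<in> mpolys ?W"
        using v by (intro mpolys_uminus mpolys_sum mpolys_mult mpolys_mvar) (auto simp: chart_vars_def)
      ultimately show ?thesis by (intro exI[of _ 1] bexI[of _ ?b]) auto
    qed
  next
    case (add p q)
    obtain N b where p: "b \<in> mpolys ?W" "?x ^ N * p - b \<in> ?L" using add(1) by blast
    obtain M c where q: "c \<in> mpolys ?W" "?x ^ M * q - c \<in> ?L" using add(2) by blast
    have "?x ^ (N + M) * (p + q) - (?x ^ M * b + ?x ^ N * c) =
        ?x ^ M * (?x ^ N * p - b) + ?x ^ N * (?x ^ M * q - c)"
      by (simp add: power_add algebra_simps)
    also have "\<dots> \<in> ?L" by (intro star_ideal_add star_ideal_mult p q)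
    finally show ?case
      by (intro exI bexI[of _ "?x ^ M * b + ?x ^ N * c"] mpolys_add mpolys_mult mpolys_power xW p q)
  next
    case (mult p q)
    obtain N b where p: "b \<in> mpolys ?W" "?x ^ N * p - b \<in> ?L" using mult(1) by blast
    obtain M c where q: "c \<in> mpolys ?W" "?x ^ M * q - c \<in> ?L" using mult(2) by blast
    have "?x ^ (N + M) * (p * q) - b * c =
        (?x ^ M * q) * (?x ^ N * p - b) + b * (?x ^ M * q - c)"
      by (simp add: power_add algebra_simps)
    also have "\<dots> \<in> ?L" by (intro star_ideal_add star_ideal_mult p q)
    finally show ?case by (intro exI bexI[of _ "b * c"] mpolys_mult p q)
  }
qed

text \<open>
  Clear the column \<open>n\<close>: some \<open>x\<^sub>n\<^sup>N a\<close> is congruent to a polynomial without the \<open>y\<^sub>i\<^sub>n\<close>, which the chart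
  sends to zero and which therefore is zero.  Now \<open>x\<^sub>n\<close> can be cancelled, as there are fewer forms
  than columns.
\<close>

lemma chart_kernel:
  fixes a :: "'k::idom ypoly"
  assumes n: "n \<ge> 1" and a: "a \<in> mpolys ({1..n} \<times> {1..n})" and 0: "chart n n a = 0"
  shows "a \<in> star_ideal n (n - 1) n"
proof -
  let ?L = "star_ideal n (n - 1) n :: 'k ypoly set"
  interpret comm_ring_hom "chart n n :: 'k ypoly \<Rightarrow> _" by (rule chart_hom)
  have nn: "n \<in> {1..n}" using n by simp
  obtain N b where b: "b \<in> mpolys ({1..n} \<times> {1..n} \<inter> chart_vars n n)" "mvar (n, n) ^ N * a - b \<in> ?L"
    using chart_clear_column[OF a nn] by blast
  have "chart n n (mvar (n, n) ^ N * a - b) = 0" by (rule chart_star_ideal[OF b(2) nn])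
  then have "chart n n b = 0" unfolding hom_minus hom_mult 0 by simp
  moreover have "b \<in> mpolys (chart_vars n n)"
    using b(1) mpolys_mono[of "{1..n} \<times> {1..n} \<inter> chart_vars n n" "chart_vars n n"] by blast
  ultimately have "b = 0" by (rule chart_inj[rotated])
  then have "mvar (n, n) ^ N * a \<in> ?L" using b(2) by simp
  then show ?thesis by (rule star_ideal_saturated_power[rotated 2]) (use n in auto)
qed

text \<open>
  The kernel of every chart is contained in that of \<open>chart n n\<close>, because \<open>chart n n\<close> maps \<open>x\<^sub>j\<close> to a
  nonzero element of a domain.
\<close>

lemma chart_kernel':
  fixes a :: "'k::idom ypoly"
  assumes n: "n \<ge> 1" and a: "a \<in> mpolys ({1..n} \<times> {1..n})" and j: "j \<in> {1..n}" and 0: "chart n j a = 0"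
  shows "a \<in> star_ideal n (n - 1) n"
proof (rule chart_kernel[OF n a])
  let ?L = "star_ideal n (n - 1) n :: 'k ypoly set"
  interpret j: comm_ring_hom "chart n j :: 'k ypoly \<Rightarrow> _" by (rule chart_hom)
  interpret n: comm_ring_hom "chart n n :: 'k ypoly \<Rightarrow> _" by (rule chart_hom)
  have nn: "n \<in> {1..n}" using n by simp
  obtain N b where b: "b \<in> mpolys ({1..n} \<times> {1..n} \<inter> chart_vars n j)" "mvar (n, j) ^ N * a - b \<in> ?L"
    using chart_clear_column[OF a j] by blast
  have "chart n j (mvar (n, j) ^ N * a - b) = 0" by (rule chart_star_ideal[OF b(2) j])
  then have "chart n j b = 0" unfolding j.hom_minus j.hom_mult 0 by simp
  moreover have "b \<in> mpolys (chart_vars n j)"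
    using b(1) mpolys_mono[of "{1..n} \<times> {1..n} \<inter> chart_vars n j" "chart_vars n j"] by blast
  ultimately have "b = 0" by (rule chart_inj[rotated])
  then have "mvar (n, j) ^ N * a \<in> ?L" using b(2) by simp
  then have "chart n n (mvar (n, j) ^ N * a) = 0" by (rule chart_star_ideal[OF _ nn])
  then show "chart n n a = 0" unfolding n.hom_mult n.hom_power chart_center by simp
qed

text \<open>
  Up to powers of \<open>x\<^sub>j\<close>, every polynomial without the \<open>y\<^sub>i\<^sub>j\<close> lies in the image of the chart: the star
  ring and the polynomial ring become equal when \<open>x\<^sub>j\<close> is inverted.
\<close>

lemma chart_image:
  fixes c :: "'k::comm_ring_1 ypoly"
  assumes c: "c \<in> mpolys ({1..n} \<times> {1..n} \<inter> chart_vars n j)" and j: "j \<in> {1..n}"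
  shows "\<exists>M. \<exists>a\<in>mpolys ({1..n} \<times> {1..n}). chart n j a = mvar (n, j) ^ M * c"
proof -
  let ?x = "mvar (n, j) :: 'k ypoly"
  interpret comm_ring_hom "chart n j :: 'k ypoly \<Rightarrow> _" by (rule chart_hom)
  have xS: "?x \<in> mpolys ({1..n} \<times> {1..n})" using j by (intro mpolys_mvar) auto
  from c show ?thesis
  proof (induction rule: mpolys_induct)
    case (const c)
    show ?case by (intro exI[of _ 0] bexI[of _ "mconst c"]) auto
  next
    case (var v)
    obtain i k where v: "v = (i, k)" "i \<in> {1..n}" "k \<in> {1..n}" "i = n \<or> k \<noteq> j"
      using var by (auto simp: chart_vars_def)
    show ?case
    proof (cases "i = n")
      case True
      then show ?thesis unfolding v(1) using v by (intro exI[of _ 0] bexI[of _ "mvar v"]) auto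
    next
      case False
      then show ?thesis unfolding v(1) using v
        by (intro exI[of _ 1] bexI[of _ "mvar v"]) (auto simp: chart_other)
    qed
  next
    case (add p q)
    obtain N a where p: "a \<in> mpolys ({1..n} \<times> {1..n})" "chart n j a = ?x ^ N * p" using add(1) by blast
    obtain M b where q: "b \<in> mpolys ({1..n} \<times> {1..n})" "chart n j b = ?x ^ M * q" using add(2) by blast
    have "chart n j (?x ^ M * a + ?x ^ N * b) = ?x ^ (N + M) * (p + q)"
      unfolding hom_add hom_mult hom_power chart_center p(2) q(2) by (simp add: power_add algebra_simps)
    then show ?case
      by (intro exI bexI[of _ "?x ^ M * a + ?x ^ N * b"] mpolys_add mpolys_mult mpolys_power xS p q)
  next
    case (mult p q)
    obtain N a where p: "a \<in> mpolys ({1..n} \<times> {1..n})" "chart n j a = ?x ^ N * p" using mult(1) by blast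
    obtain M b where q: "b \<in> mpolys ({1..n} \<times> {1..n})" "chart n j b = ?x ^ M * q" using mult(2) by blast
    have "chart n j (a * b) = ?x ^ (N + M) * (p * q)"
      unfolding hom_mult p(2) q(2) by (simp add: power_add algebra_simps)
    then show ?case by (intro exI bexI[of _ "a * b"] mpolys_mult p q)
  qed
qed

lemma mpolys_kill: "kill (- V) p \<in> mpolys V"
proof -
  interpret comm_ring_hom "kill (- V)" by (rule kill_hom)
  have "p \<in> mpolys UNIV" by simp
  then show ?thesis
    by (induction rule: mpolys_induct) (auto simp: hom_add hom_mult)
qed

lemma kill_star_ideal_subset:
  fixes a :: "'k::comm_ring_1 ypoly"
  assumes "a \<in> star_ideal n m q" "{1..m} \<times> {1..q} \<union> {n} \<times> {1..q} \<subseteq> V"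
  shows "kill (- V) a \<in> star_ideal n m q"
proof -
  interpret comm_ring_hom "kill (- V) :: 'k ypoly \<Rightarrow> _" by (rule kill_hom)
  obtain c where c: "a = (\<Sum>i=1..m. c i * LSS_poly q i n)" using assms(1) by (rule star_idealE)
  have "kill (- V) (LSS_poly q i n) = (LSS_poly q i n :: 'k ypoly)" if "i \<in> {1..m}" for i
  proof (rule kill_free)
    show "LSS_poly q i n \<in> mpolys ({i, n} \<times> {1..q})" by (rule LSS_poly_in_mpolys) simp
    show "{i, n} \<times> {1..q} \<inter> - V = {}" using that assms(2) by blast
  qed
  then have "kill (- V) a = (\<Sum>i=1..m. kill (- V) (c i) * LSS_poly q i n)"
    unfolding c hom_sum hom_mult by (intro sum.cong refl) simp
  then show ?thesis by (rule star_idealI)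
qed

lemma kill_center_star_ideal:
  fixes a :: "'k::comm_ring_1 ypoly"
  assumes "a \<in> star_ideal n m q" "{n} \<times> {1..q} \<subseteq> W"
  shows "kill W a = 0"
proof -
  interpret comm_ring_hom "kill W :: 'k ypoly \<Rightarrow> _" by (rule kill_hom)
  obtain c where c: "a = (\<Sum>i=1..m. c i * LSS_poly q i n)" using assms(1) by (rule star_idealE)
  have "kill W (LSS_poly q i n) = (0 :: 'k ypoly)" for i
    unfolding LSS_poly_def hom_sum hom_mult by (rule sum.neutral) (use assms(2) in auto)
  then show ?thesis unfolding c hom_sum hom_mult by simp
qed

text \<open>
  The hypotheses say that \<open>a\<close> lies in both primes over \<open>x\<^sub>n\<close>.  The first gives that \<open>a\<close> vanishes for
  \<open>x\<^sub>1 = \<dots> = x\<^sub>n = 0\<close>, since no nonzero polynomial free of these variables is in the ideal.  From the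
  second, clearing column \<open>n - 1\<close> yields that some \<open>x\<^sub>n\<^sub>-\<^sub>1\<^sup>N a\<close> lies in the ideal after setting
  \<open>x\<^sub>n = 0\<close>.  That ideal belongs to \<open>n - 1\<close> forms in \<open>n - 1\<close> columns, the case of
  \<open>star_ideal_saturated\<close> in which elements like \<open>a\<close> may be divided by \<open>x\<^sub>n\<^sub>-\<^sub>1\<close>.
\<close>

theorem divisible_by_center_var:
  fixes a :: "'k::idom ypoly"
  assumes n: "n \<ge> 2" and a: "a \<in> mpolys ({1..n} \<times> {1..n})"
    and P: "chart n n (kill ({n} \<times> {1..n}) a) = 0"
    and Q: "mvar (n, n) dvd chart n (n - 1) a"
  shows "\<exists>c\<in>mpolys ({1..n} \<times> {1..n}). a - mvar (n, n) * c \<in> star_ideal n (n - 1) n"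
proof -
  let ?S = "{1..n} \<times> {1..n}" and ?X = "{n} \<times> {1..n}"
  let ?L = "star_ideal n (n - 1) n :: 'k ypoly set"
  let ?x = "mvar (n, n) :: 'k ypoly"
  obtain j where j: "n = Suc j" "j \<ge> 1" using n by (cases n) auto
  have jn: "j \<in> {1..n}" and jnn: "j \<noteq> n" "n \<noteq> j" using j by auto
  interpret X: comm_ring_hom "kill ?X :: 'k ypoly \<Rightarrow> _" by (rule kill_hom)
  interpret x: comm_ring_hom "kill {(n, n)} :: 'k ypoly \<Rightarrow> _" by (rule kill_hom)
  interpret j: comm_ring_hom "chart n j :: 'k ypoly \<Rightarrow> _" by (rule chart_hom)
  interpret S: comm_ring_hom "kill (- ?S) :: 'k ypoly \<Rightarrow> _" by (rule kill_hom)
  have "kill (- ?S) (kill ?X a) = kill ?X (kill (- ?S) a)" by (simp add: kill_kill Un_commute)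
  also have "kill (- ?S) a = a" by (rule kill_free[OF a]) simp
  finally have "kill ?X a \<in> mpolys ?S" using mpolys_kill[of ?S "kill ?X a"] by simp
  then have "kill ?X a \<in> ?L" using n by (intro chart_kernel[OF _ _ P]) auto
  then have "kill ?X (kill ?X a) = 0" by (rule kill_center_star_ideal) simp
  then have aX: "kill ?X a = 0" by (simp add: kill_kill)
  obtain N b where b: "b \<in> mpolys (?S \<inter> chart_vars n j)" "mvar (n, j) ^ N * a - b \<in> ?L"
    using chart_clear_column[OF a jn] by blast
  have "chart n j (mvar (n, j) ^ N * a - b) = 0" by (rule chart_star_ideal[OF b(2) jn])
  then have cb: "chart n j b = mvar (n, j) ^ N * chart n j a"
    unfolding j.hom_minus j.hom_mult j.hom_power chart_center by simp
  have b': "b \<in> mpolys (chart_vars n j)"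
    using b(1) mpolys_mono[of "?S \<inter> chart_vars n j" "chart_vars n j"] by blast
  have "kill {(n, n)} (chart n j b) = chart n j (kill {(n, n)} b)"
  proof (rule hom_eqI[OF comp_hom[OF kill_hom chart_hom] comp_hom[OF chart_hom kill_hom] b'])
    fix v assume "v \<in> chart_vars n j"
    then obtain i k where v: "v = (i, k)" "i = n \<or> k \<noteq> j" by (auto simp: chart_vars_def)
    show "kill {(n, n)} (chart n j (mvar v)) = chart n j (kill {(n, n)} (mvar v) :: 'k ypoly)"
    proof (cases "i = n")
      case True
      then show ?thesis unfolding v(1) by simp
    next
      case False
      then have "chart n j (mvar v) = mvar (n, j) * (mvar v :: 'k ypoly)" using v by (simp add: chart_other)
      then show ?thesis using False jnn by (simp add: v x.hom_mult)
    qed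
  qed simp
  also have "kill {(n, n)} (chart n j b) = 0"
  proof -
    have "?x dvd chart n j b" unfolding cb using Q j by simp
    then show ?thesis by (simp add: mvar_dvd_iff_kill)
  qed
  finally have "chart n j (kill {(n, n)} b) = 0" by simp
  moreover have "kill {(n, n)} b \<in> mpolys (chart_vars n j)"
  proof -
    have "kill (- chart_vars n j) (kill {(n, n)} b) = kill {(n, n)} (kill (- chart_vars n j) b)"
      by (simp add: kill_kill Un_commute)
    also have "kill (- chart_vars n j) b = b" by (rule kill_free[OF b']) simp
    finally show ?thesis using mpolys_kill[of "chart_vars n j" "kill {(n, n)} b"] by simp
  qed
  ultimately have kb: "kill {(n, n)} b = 0" by (rule chart_inj[rotated])
  obtain d where d: "mvar (n, j) ^ N * a - b = (\<Sum>i=1..n - 1. d i * LSS_poly n i n)"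
    using b(2) by (rule star_idealE)
  have "mvar (n, j) ^ N * kill {(n, n)} a = kill {(n, n)} (mvar (n, j) ^ N * a - b)"
    using jnn by (simp add: x.hom_minus x.hom_mult x.hom_power kb)
  also have "\<dots> = (\<Sum>i=1..j. kill {(n, n)} (d i) * kill {(n, n)} (LSS_poly n i n))"
    unfolding d x.hom_sum x.hom_mult using j by simp
  also have "\<dots> = (\<Sum>i=1..j. kill {(n, n)} (d i) * LSS_poly j i n)"
  proof (rule sum.cong[OF refl])
    fix i assume "i \<in> {1..j}"
    then have "i \<noteq> n" using j by simp
    from kill_LSS_poly[OF this, of j] have "kill {(n, n)} (LSS_poly n i n) = (LSS_poly j i n :: 'k ypoly)"
      unfolding j(1)[symmetric] .
    then show "kill {(n, n)} (d i) * kill {(n, n)} (LSS_poly n i n) = kill {(n, n)} (d i) * LSS_poly j i n"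
      by simp
  qed
  finally have "mvar (n, j) ^ N * kill {(n, n)} a \<in> star_ideal n j j" by (rule star_idealI)
  then have "kill {(n, n)} a \<in> star_ideal n j j"
  proof (rule star_ideal_saturated_power[rotated 2])
    have "{n} \<times> {1..j} \<union> {(n, n)} = ?X" using j by auto
    then show "kill ({n} \<times> {1..j}) (kill {(n, n)} a) = 0" using aX by (simp add: kill_kill)
  qed (use j in auto)
  then obtain h where h: "kill {(n, n)} a = (\<Sum>i=1..j. h i * LSS_poly j i n)" by (rule star_idealE)
  obtain h' where h': "a - kill {(n, n)} a = ?x * h'" using mvar_dvd_diff_kill by (rule dvdE)
  define c where "c = h' - (\<Sum>i=1..j. h i * mvar (i, n))"
  have "a - ?x * c = kill {(n, n)} a + ?x * (\<Sum>i=1..j. h i * mvar (i, n))"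
    unfolding c_def using h' by (simp add: algebra_simps)
  also have "\<dots> = (\<Sum>i=1..j. h i * LSS_poly n i n)"
    unfolding h unfolding j(1) LSS_poly_Suc by (simp add: algebra_simps sum.distrib sum_distrib_left)
  finally have "a - ?x * c \<in> ?L" using j by (intro star_idealI) simp
  then have "kill (- ?S) (a - ?x * c) \<in> ?L" using n by (intro kill_star_ideal_subset) auto
  moreover have "kill (- ?S) (a - ?x * c) = a - ?x * kill (- ?S) c"
    unfolding S.hom_minus S.hom_mult kill_mvar \<open>kill (- ?S) a = a\<close> using n by simp
  ultimately show ?thesis using mpolys_kill[of ?S c] by auto
qed

section \<open>Domains defined by discrete valuations\<close>

text \<open>
  A Krull domain given by its essential valuations.  The values at zero are arbitrary.  The last
  assumption says that no center is contained in another.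
\<close>

locale krull_family = domain R for R (structure) +
  fixes I :: "'i set" and v :: "'i \<Rightarrow> 'a \<Rightarrow> nat"
  assumes v_mult: "\<And>i a b. i \<in> I \<Longrightarrow> a \<in> carrier R - {\<zero>} \<Longrightarrow> b \<in> carrier R - {\<zero>} \<Longrightarrow>
      v i (a \<otimes> b) = v i a + v i b"
    and v_add: "\<And>i a b. i \<in> I \<Longrightarrow> a \<in> carrier R - {\<zero>} \<Longrightarrow> b \<in> carrier R - {\<zero>} \<Longrightarrow>
      a \<oplus> b \<noteq> \<zero> \<Longrightarrow> min (v i a) (v i b) \<le> v i (a \<oplus> b)"
    and v_finite: "\<And>a. a \<in> carrier R - {\<zero>} \<Longrightarrow> finite {i \<in> I. v i a \<noteq> 0}"
    and v_divides: "\<And>a b. a \<in> carrier R - {\<zero>} \<Longrightarrow> b \<in> carrier R - {\<zero>} \<Longrightarrow>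
      (\<And>i. i \<in> I \<Longrightarrow> v i b \<le> v i a) \<Longrightarrow> \<exists>c\<in>carrier R. a = c \<otimes> b"
    and v_uniformizer: "\<And>i. i \<in> I \<Longrightarrow> \<exists>u\<in>carrier R - {\<zero>}. v i u = 1"
    and v_separate: "\<And>i j. i \<in> I \<Longrightarrow> j \<in> I \<Longrightarrow> i \<noteq> j \<Longrightarrow>
      \<exists>s\<in>carrier R - {\<zero>}. v j s > 0 \<and> v i s = 0"
begin

definition center :: "'i \<Rightarrow> 'a set" where
  "center i = {a \<in> carrier R. a = \<zero> \<or> v i a > 0}"

lemma mult_nonzero: "a \<in> carrier R - {\<zero>} \<Longrightarrow> b \<in> carrier R - {\<zero>} \<Longrightarrow> a \<otimes> b \<in> carrier R - {\<zero>}"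
  using integral_iff by auto

lemma pow_nonzero: "a \<in> carrier R - {\<zero>} \<Longrightarrow> a [^] (k::nat) \<in> carrier R - {\<zero>}"
  by (induction k) (use mult_nonzero in auto)

lemma one_nonzero: "\<one> \<in> carrier R - {\<zero>}"
  using one_not_zero by auto

lemma v_one: "i \<in> I \<Longrightarrow> v i \<one> = 0"
  using v_mult[of i \<one> \<one>] one_nonzero by simp

lemma v_pow: "i \<in> I \<Longrightarrow> a \<in> carrier R - {\<zero>} \<Longrightarrow> v i (a [^] (k::nat)) = k * v i a"
  by (induction k) (use v_mult[OF _ pow_nonzero] v_one in auto)

lemma finprod_nonzero:
  assumes "finite F" "\<And>j. j \<in> F \<Longrightarrow> s j \<in> carrier R - {\<zero>}"
  shows "finprod R s F \<in> carrier R - {\<zero>}"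
  using assms
proof (induction F)
  case (insert j F)
  then have "finprod R s (insert j F) = s j \<otimes> finprod R s F"
    by (intro finprod_insert) auto
  then show ?case using insert mult_nonzero by auto
qed (use one_nonzero in simp)

lemma v_finprod:
  assumes "i \<in> I" "finite F" "\<And>j. j \<in> F \<Longrightarrow> s j \<in> carrier R - {\<zero>}"
  shows "v i (finprod R s F) = (\<Sum>j\<in>F. v i (s j))"
  using assms(2,3)
proof (induction F)
  case (insert j F)
  then have "finprod R s (insert j F) = s j \<otimes> finprod R s F"
    by (intro finprod_insert) auto
  moreover have "finprod R s F \<in> carrier R - {\<zero>}" using insert by (intro finprod_nonzero) auto
  ultimately show ?case using insert v_mult[OF assms(1), of "s j" "finprod R s F"] by auto
qed (use v_one assms(1) in simp)

lemma v_add_ge: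
  assumes "i \<in> I" "a \<in> carrier R" "b \<in> carrier R"
    "a = \<zero> \<or> k \<le> v i a" "b = \<zero> \<or> k \<le> v i b"
  shows "a \<oplus> b = \<zero> \<or> k \<le> v i (a \<oplus> b)"
proof (cases "a = \<zero> \<or> b = \<zero> \<or> a \<oplus> b = \<zero>")
  case False
  then show ?thesis using v_add[of i a b] assms by auto
qed (use assms in auto)

lemma v_uminus:
  assumes "i \<in> I" "a \<in> carrier R - {\<zero>}"
  shows "v i (\<ominus> a) = v i a"
proof -
  have m1: "\<ominus> \<one> \<in> carrier R - {\<zero>}" using one_nonzero by auto
  have "v i (\<ominus> \<one> \<otimes> \<ominus> \<one>) = 0" using v_one[OF assms(1)] by (simp add: l_minus r_minus)
  then have "v i (\<ominus> \<one>) = 0" using v_mult[OF assms(1) m1 m1] by simp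
  moreover have "\<ominus> a = \<ominus> \<one> \<otimes> a" using assms by (simp add: l_minus)
  ultimately show ?thesis using v_mult[OF assms(1) m1 assms(2)] by simp
qed

lemma center_ideal:
  assumes i: "i \<in> I"
  shows "ideal (center i) R"
proof (rule idealI)
  show "ring R" by (rule ring_axioms)
  show "subgroup (center i) (add_monoid R)"
  proof (rule add.subgroupI)
    show "center i \<subseteq> carrier R" "center i \<noteq> {}" by (auto simp: center_def)
    show "\<ominus> a \<in> center i" if "a \<in> center i" for a
      using that v_uminus[OF i, of a] by (cases "a = \<zero>") (auto simp: center_def)
    show "a \<oplus> b \<in> center i" if "a \<in> center i" "b \<in> center i" for a b
      using that v_add_ge[OF i, of a b 1] by (auto simp: center_def)
  qed
  show "x \<otimes> a \<in> center i" if "a \<in> center i" "x \<in> carrier R" for a x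
    using that v_mult[OF i, of x a] by (cases "x = \<zero> \<or> a = \<zero>") (auto simp: center_def)
  then show "a \<otimes> x \<in> center i" if "a \<in> center i" "x \<in> carrier R" for a x
    using that by (metis (no_types, lifting) center_def m_comm mem_Collect_eq)
qed

lemma center_prime:
  assumes i: "i \<in> I"
  shows "primeideal (center i) R"
proof (rule primeidealI)
  show "ideal (center i) R" by (rule center_ideal[OF i])
  show "cring R" by (rule is_cring)
  show "carrier R \<noteq> center i"
  proof
    assume "carrier R = center i"
    then have "\<one> \<in> center i" by auto
    then show False using v_one[OF i] one_nonzero by (auto simp: center_def)
  qed
  show "a \<in> center i \<or> b \<in> center i" if "a \<in> carrier R" "b \<in> carrier R" "a \<otimes> b \<in> center i" for a b
  proof (cases "a = \<zero> \<or> b = \<zero>")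
    case True
    then show ?thesis using that by (auto simp: center_def)
  next
    case False
    then have "v i (a \<otimes> b) = v i a + v i b" using that v_mult[OF i] by simp
    moreover have "v i (a \<otimes> b) > 0" using that False integral[of a b] by (auto simp: center_def)
    ultimately show ?thesis using that by (auto simp: center_def)
  qed
qed

lemma center_nonzero: "i \<in> I \<Longrightarrow> center i \<noteq> {\<zero>}"
proof
  assume i: "i \<in> I" and eq: "center i = {\<zero>}"
  obtain u where "u \<in> carrier R - {\<zero>}" "v i u = 1" using v_uniformizer[OF i] by blast
  then have "u \<in> center i" "u \<noteq> \<zero>" by (auto simp: center_def)
  then show False using eq by simp
qed

lemma center_subset_imp_eq:
  assumes "i \<in> I" "j \<in> I" "center j \<subseteq> center i"
  shows "i = j"
proof (rule ccontr)
  assume "i \<noteq> j"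
  then obtain s where s: "s \<in> carrier R - {\<zero>}" "v j s > 0" "v i s = 0"
    using v_separate[OF assms(1,2)] by blast
  then have "s \<in> center j" by (simp add: center_def)
  then have "s \<in> center i" by (rule subsetD[OF assms(3)])
  then show False using s by (simp add: center_def)
qed

text \<open>
  If no center of a valuation in the support of \<open>a \<in> Q\<close> were contained in \<open>Q\<close>, one could choose
  elements of these centers outside \<open>Q\<close>.  A product of their powers is divisible by \<open>a\<close>, so \<open>Q\<close> would
  contain one of them.
\<close>

lemma prime_contains_center:
  assumes Q: "primeideal Q R" "Q \<noteq> {\<zero>}"
  obtains i where "i \<in> I" "center i \<subseteq> Q"
proof -
  interpret Q: primeideal Q R by (rule Q)
  obtain a where a: "a \<in> Q" "a \<noteq> \<zero>" using Q(2) Q.zero_closed by blast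
  then have aR: "a \<in> carrier R - {\<zero>}" using Q.Icarr by auto
  define F where "F = {i \<in> I. v i a \<noteq> 0}"
  have finF: "finite F" unfolding F_def by (rule v_finite[OF aR])
  have "\<exists>i\<in>F. center i \<subseteq> Q"
  proof (rule ccontr)
    assume "\<not> ?thesis"
    then have "\<forall>i\<in>F. \<exists>s. s \<in> center i - Q" by blast
    then obtain s where s: "\<And>i. i \<in> F \<Longrightarrow> s i \<in> center i - Q" by metis
    have sR: "s i \<in> carrier R - {\<zero>}" "v i (s i) > 0" if "i \<in> F" for i
      using s[OF that] Q.zero_closed by (auto simp: center_def)
    define t where "t i = s i [^] v i a" for i
    have tR: "t i \<in> carrier R - {\<zero>}" if "i \<in> F" for i
      unfolding t_def using sR(1)[OF that] by (rule pow_nonzero)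
    have pow_notin: "x [^] (k::nat) \<notin> Q" if "x \<in> carrier R" "x \<notin> Q" for x k
    proof (induction k)
      case 0
      then show ?case using Q.I_notcarr Q.one_imp_carrier by auto
    next
      case (Suc k)
      then show ?case using that Q.I_prime[of "x [^] k" x] by auto
    qed
    have "finprod R t G \<in> carrier R \<and> finprod R t G \<notin> Q" if "finite G" "G \<subseteq> F" for G
      using that
    proof (induction G)
      case empty
      then show ?case using Q.I_notcarr Q.one_imp_carrier by auto
    next
      case (insert j G)
      then have eq: "finprod R t (insert j G) = t j \<otimes> finprod R t G"
        using tR by (intro finprod_insert) auto
      have "t j \<notin> Q" unfolding t_def using s[of j] sR[of j] insert.prems by (intro pow_notin) auto
      then show ?case unfolding eq using insert Q.I_prime[of "t j" "finprod R t G"] tR[of j] by auto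
    qed
    from this[OF finF] have notin: "finprod R t F \<notin> Q" by simp
    have "v i a \<le> v i (finprod R t F)" if i: "i \<in> I" for i
    proof (cases "i \<in> F")
      case True
      have "v i a \<le> v i (t i)" unfolding t_def using sR[OF True] by (simp add: v_pow[OF i])
      also have "\<dots> \<le> (\<Sum>j\<in>F. v i (t j))" using finF True by (intro member_le_sum) auto
      finally show ?thesis using v_finprod[of i F t, OF i finF tR] by simp
    qed (use i in \<open>simp add: F_def\<close>)
    then have "\<exists>c\<in>carrier R. finprod R t F = c \<otimes> a"
      by (intro v_divides finprod_nonzero finF tR aR)
    then obtain c where "c \<in> carrier R" "finprod R t F = c \<otimes> a" by (elim bexE)
    then show False using notin a(1) Q.I_l_closed by auto
  qed
  then show ?thesis using that by (auto simp: F_def)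
qed

theorem height_one_primes_eq: "height_one_primes R = center ` I"
proof (intro equalityI subsetI)
  fix Q assume "Q \<in> height_one_primes R"
  then have Q: "primeideal Q R" "Q \<noteq> {\<zero>}" and min: "\<And>P. primeideal P R \<Longrightarrow> P \<subset> Q \<Longrightarrow> P = {\<zero>}"
    by (auto simp: height_one_primes_def)
  obtain i where i: "i \<in> I" "center i \<subseteq> Q" by (rule prime_contains_center[OF Q])
  then have "center i = Q" using min[OF center_prime[OF i(1)]] center_nonzero[OF i(1)] by blast
  then show "Q \<in> center ` I" using i by blast
next
  fix Q assume "Q \<in> center ` I"
  then obtain i where i: "i \<in> I" "Q = center i" by blast
  have "P = {\<zero>}" if P: "primeideal P R" "P \<subset> Q" for P
  proof (rule ccontr)
    assume "P \<noteq> {\<zero>}"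
    then obtain j where j: "j \<in> I" "center j \<subseteq> P" using prime_contains_center[OF P(1)] by blast
    then have "i = j" using P(2) i by (intro center_subset_imp_eq) auto
    then show False using j P(2) i by blast
  qed
  then show "Q \<in> height_one_primes R"
    using i center_prime center_nonzero by (auto simp: height_one_primes_def)
qed

lemma inj_center: "inj_on center I"
  using center_subset_imp_eq by (intro inj_onI) blast

lemma ideal_power_ideal: "ideal P R \<Longrightarrow> ideal (P [^]\<^bsub>ideals_set R\<^esub> (k::nat)) R"
  by (induction k) (auto simp: ideals_set_def oneideal intro: ideal_prod_is_ideal)

lemma ideal_power_val:
  assumes i: "i \<in> I" and a: "a \<in> center i [^]\<^bsub>ideals_set R\<^esub> (k::nat)"
  shows "a \<in> carrier R \<and> (a = \<zero> \<or> k \<le> v i a)"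
  using a
proof (induction k arbitrary: a)
  case 0
  then show ?case by (simp add: ideals_set_def)
next
  case (Suc k)
  let ?J = "center i [^]\<^bsub>ideals_set R\<^esub> k"
  have "a \<in> ideal_prod R ?J (center i)" using Suc.prems by (simp add: ideals_set_def)
  then show ?case
  proof (induction rule: ideal_prod.induct)
    case (prod x y)
    then have x: "x \<in> carrier R" "x = \<zero> \<or> k \<le> v i x" using Suc.IH by auto
    have y: "y \<in> carrier R" "y = \<zero> \<or> 1 \<le> v i y" using prod(2) by (auto simp: center_def)
    show ?case using x y v_mult[OF i, of x y] by (cases "x = \<zero> \<or> y = \<zero>") auto
  next
    case (sum x y)
    then show ?case using v_add_ge[OF i, of x y "Suc k"] by auto
  qed
qed

lemma uniformizer_power_in:
  assumes "u \<in> center i"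
  shows "u [^] (k::nat) \<in> center i [^]\<^bsub>ideals_set R\<^esub> k"
proof (induction k)
  case 0
  then show ?case by (simp add: ideals_set_def)
next
  case (Suc k)
  then show ?case using assms by (auto simp: ideals_set_def intro: ideal_prod.prod)
qed

text \<open>
  Let \<open>u\<close> be a uniformizer.  Multiplying \<open>a\<close> by elements of the other centers in the support of \<open>u\<close>, all
  of value zero at \<open>i\<close>, makes it divisible by \<open>u\<close> to the power \<open>v i a\<close>.  The converse holds since values
  on the power \<open>k\<close> of the center are at least \<open>k\<close>.
\<close>

theorem prime_val_center:
  assumes i: "i \<in> I" and a: "a \<in> carrier R - {\<zero>}"
  shows "prime_val R (center i) a = v i a"
  unfolding prime_val_def
proof (rule Greatest_equality)
  let ?k = "v i a"
  obtain u where u: "u \<in> carrier R - {\<zero>}" "v i u = 1" using v_uniformizer[OF i] by blast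
  define F where "F = {j \<in> I. v j u \<noteq> 0} - {i}"
  have finF: "finite F" unfolding F_def using v_finite[OF u(1)] by simp
  have "\<forall>j\<in>F. \<exists>s. s \<in> carrier R - {\<zero>} \<and> v j s > 0 \<and> v i s = 0"
    using v_separate[OF i] by (auto simp: F_def)
  then obtain s where s: "\<And>j. j \<in> F \<Longrightarrow> s j \<in> carrier R - {\<zero>} \<and> v j (s j) > 0 \<and> v i (s j) = 0"
    by metis
  define t where "t j = s j [^] (?k * v j u)" for j
  have tR: "t j \<in> carrier R - {\<zero>}" if "j \<in> F" for j
    unfolding t_def using s[OF that] by (intro pow_nonzero) auto
  let ?t = "finprod R t F"
  have tF: "?t \<in> carrier R - {\<zero>}" by (rule finprod_nonzero[OF finF tR])
  have "v i (t j) = 0" if "j \<in> F" for j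
    unfolding t_def using s[OF that] by (simp add: v_pow[OF i])
  then have "v i ?t = 0"
    using v_finprod[of i F t, OF i finF tR] by simp
  then have t_center: "?t \<in> carrier R - center i" using tF by (auto simp: center_def)
  have ta: "?t \<otimes> a \<in> carrier R - {\<zero>}" by (rule mult_nonzero[OF tF a])
  have "v j (u [^] ?k) \<le> v j (?t \<otimes> a)" if j: "j \<in> I" for j
  proof -
    consider "j = i" | "j \<in> F" | "v j u = 0" using j by (auto simp: F_def)
    then show ?thesis
    proof cases
      case 1
      then show ?thesis using u v_mult[OF j tF a] v_pow[OF i u(1)] by simp
    next
      case 2
      have "?k * v j u \<le> v j (t j)" unfolding t_def using s[OF 2] by (simp add: v_pow[OF j])
      also have "\<dots> \<le> (\<Sum>l\<in>F. v j (t l))" using finF 2 by (intro member_le_sum) auto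
      also have "\<dots> = v j ?t" using v_finprod[of j F t, OF j finF tR] by simp
      finally show ?thesis using v_mult[OF j tF a] v_pow[OF j u(1)] by simp
    next
      case 3
      then show ?thesis using v_pow[OF j u(1)] by simp
    qed
  qed
  then have "\<exists>c\<in>carrier R. ?t \<otimes> a = c \<otimes> u [^] ?k"
    by (intro v_divides ta pow_nonzero[OF u(1)])
  then obtain c where c: "c \<in> carrier R" "?t \<otimes> a = c \<otimes> u [^] ?k" by (elim bexE)
  have "u \<in> center i" using u by (simp add: center_def)
  then have "c \<otimes> u [^] ?k \<in> center i [^]\<^bsub>ideals_set R\<^esub> ?k"
    using ideal.I_l_closed[OF ideal_power_ideal[OF center_ideal[OF i]] uniformizer_power_in c(1)] by simp
  then show "\<exists>s\<in>carrier R - center i. s \<otimes> a \<in> center i [^]\<^bsub>ideals_set R\<^esub> ?k"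
    using c(2) by (intro bexI[of _ ?t] t_center) simp
next
  fix k :: nat assume "\<exists>s\<in>carrier R - center i. s \<otimes> a \<in> center i [^]\<^bsub>ideals_set R\<^esub> k"
  then obtain s where s: "s \<in> carrier R - center i" "s \<otimes> a \<in> center i [^]\<^bsub>ideals_set R\<^esub> k" by blast
  have s0: "s \<in> carrier R - {\<zero>}" "v i s = 0" using s(1) by (auto simp: center_def)
  then show "k \<le> v i a"
    using ideal_power_val[OF i s(2)] mult_nonzero[OF s0(1) a] v_mult[OF i s0(1) a] by auto
qed

text \<open>
  If \<open>v i a < v i b\<close>, all terms of an equation of integral dependence other than \<open>a\<^sup>m\<close> have a value
  larger than that of \<open>a\<^sup>m\<close>, so they cannot cancel it.
\<close>

theorem is_normal: "normal_domain R"
  unfolding normal_domain_def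
proof (intro conjI ballI allI impI)
  show "domain R" by (rule domain_axioms)
next
  fix a b m c
  assume a: "a \<in> carrier R" and b: "b \<in> carrier R - {\<zero>}" and c: "c \<in> {..<m} \<rightarrow> carrier R"
    and eq: "a [^] (m::nat) \<oplus> (\<Oplus>i\<in>{..<m}. c i \<otimes> a [^] i \<otimes> b [^] (m - i)) = \<zero>"
  show "\<exists>r\<in>carrier R. a = r \<otimes> b"
  proof (cases "a = \<zero>")
    case True
    then show ?thesis using b by (intro bexI[of _ \<zero>]) auto
  next
    case False
    then have aR: "a \<in> carrier R - {\<zero>}" using a by simp
    have "v i b \<le> v i a" if i: "i \<in> I" for i
    proof (rule ccontr)
      assume lt: "\<not> ?thesis"
      let ?K = "m * v i a + 1"
      let ?f = "\<lambda>j. c j \<otimes> a [^] j \<otimes> b [^] (m - j)"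
      have term_ge: "?f j \<in> carrier R \<and> (?f j = \<zero> \<or> ?K \<le> v i (?f j))" if j: "j < m" for j
      proof (cases "c j = \<zero>")
        case True
        then show ?thesis using a b by simp
      next
        case False
        then have cj: "c j \<in> carrier R - {\<zero>}" using c j by auto
        have "m * v i a + 1 \<le> j * v i a + (m - j) * (v i a + 1)"
        proof -
          have "m * v i a = j * v i a + (m - j) * v i a"
            using j by (simp flip: add_mult_distrib)
          then show ?thesis using j by (simp add: algebra_simps)
        qed
        also have "\<dots> \<le> j * v i a + (m - j) * v i b" using lt by (intro add_left_mono mult_le_mono2) auto
        also have "\<dots> \<le> v i (?f j)"
          using v_mult[OF i mult_nonzero[OF cj pow_nonzero[OF aR]] pow_nonzero[OF b]]
            v_mult[OF i cj pow_nonzero[OF aR]] by (simp add: v_pow[OF i aR] v_pow[OF i b])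
        finally show ?thesis using cj a b by auto
      qed
      have "finsum R ?f G \<in> carrier R \<and> (finsum R ?f G = \<zero> \<or> ?K \<le> v i (finsum R ?f G))"
        if "finite G" "G \<subseteq> {..<m}" for G
        using that
      proof (induction G)
        case (insert j G)
        then have "finsum R ?f (insert j G) = ?f j \<oplus> finsum R ?f G"
          using term_ge by (intro finsum_insert) auto
        then show ?case using insert term_ge[of j] v_add_ge[OF i, of "?f j" "finsum R ?f G" ?K] by auto
      qed simp
      from this[of "{..<m}"] have sum: "finsum R ?f {..<m} \<in> carrier R"
        "finsum R ?f {..<m} = \<zero> \<or> ?K \<le> v i (finsum R ?f {..<m})" by auto
      have am: "a [^] m \<in> carrier R - {\<zero>}" by (rule pow_nonzero[OF aR])
      have "a [^] m = \<ominus> finsum R ?f {..<m}" using eq sum(1) am by (metis DiffD1 minus_equality)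
      moreover have "finsum R ?f {..<m} \<noteq> \<zero>" using calculation am by auto
      ultimately have "v i (a [^] m) \<ge> ?K" using sum v_uminus[OF i] by auto
      then show False using v_pow[OF i aR] by simp
    qed
    then show ?thesis by (intro v_divides aR b)
  qed
qed

lemma principal_divisors_eq:
  "principal_divisors R = {D. Poly_Mapping.keys D \<subseteq> center ` I \<and>
     (\<exists>a\<in>carrier R - {\<zero>}. \<exists>b\<in>carrier R - {\<zero>}. \<forall>i\<in>I.
        Poly_Mapping.lookup D (center i) = int (v i a) - int (v i b))}"
  by (auto simp: principal_divisors_def divisor_group_def height_one_primes_eq prime_val_center)

text \<open>
  Nagata's argument.  The divisors of the \<open>u i\<close> generate the group of divisors modulo the two special places \<open>p\<close> and
  \<open>q\<close>, so every divisor is equivalent to one supported on \<open>p\<close> and \<open>q\<close>, and \<open>x\<close> identifies \<open>q\<close> with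
  \<open>- p\<close>.  The isomorphism counts \<open>p\<close> with \<open>1\<close>, \<open>q\<close> with \<open>- 1\<close>, and every other place with the weight that
  sends the divisor of \<open>u i\<close> to zero.  The assumption \<open>key\<close> says that principal divisors supported
  on \<open>p\<close> and \<open>q\<close> are multiples of that of \<open>x\<close>.
\<close>

theorem class_group_integers:
  fixes x :: 'a and u :: "'i \<Rightarrow> 'a" and p q :: 'i
  assumes pq: "p \<in> I" "q \<in> I" "p \<noteq> q"
    and x: "x \<in> carrier R - {\<zero>}" "v p x = 1" "v q x = 1" "\<And>i. i \<in> I - {p, q} \<Longrightarrow> v i x = 0"
    and u: "\<And>i. i \<in> I - {p, q} \<Longrightarrow> u i \<in> carrier R - {\<zero>}"
      "\<And>i j. i \<in> I - {p, q} \<Longrightarrow> j \<in> I - {p, q} \<Longrightarrow> v j (u i) = (if j = i then 1 else 0)"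
    and key: "\<And>a b. a \<in> carrier R - {\<zero>} \<Longrightarrow> b \<in> carrier R - {\<zero>} \<Longrightarrow>
      (\<And>i. i \<in> I - {p, q} \<Longrightarrow> v i a = v i b) \<Longrightarrow> v p a + v q b = v p b + v q a"
  shows "class_group R \<cong> integer_group"
proof -
  define w where "w i = (if i = p then 1 else if i = q then - 1 else int (v q (u i)) - int (v p (u i)))" for i
  define \<theta> where "\<theta> D = (\<Sum>P\<in>Poly_Mapping.keys D. Poly_Mapping.lookup D P * w (inv_into I center P))" for D
  have \<theta>_superset: "\<theta> D = (\<Sum>P\<in>F. Poly_Mapping.lookup D P * w (inv_into I center P))"
    if "finite F" "Poly_Mapping.keys D \<subseteq> F" for D F
    unfolding \<theta>_def using that by (intro sum.mono_neutral_left) (auto simp: in_keys_iff)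
  have \<theta>_index: "\<theta> D = (\<Sum>i\<in>F. Poly_Mapping.lookup D (center i) * w i)"
    if F: "finite F" "F \<subseteq> I" "Poly_Mapping.keys D \<subseteq> center ` F" for D F
  proof -
    have "\<theta> D = (\<Sum>P\<in>center ` F. Poly_Mapping.lookup D P * w (inv_into I center P))"
      by (rule \<theta>_superset) (use F in auto)
    also have "\<dots> = (\<Sum>i\<in>F. Poly_Mapping.lookup D (center i) * w (inv_into I center (center i)))"
      by (subst sum.reindex) (auto intro: inj_on_subset[OF inj_center F(2)])
    also have "\<dots> = (\<Sum>i\<in>F. Poly_Mapping.lookup D (center i) * w i)"
      by (intro sum.cong refl) (use F(2) in \<open>auto simp: inv_into_f_f[OF inj_center]\<close>)
    finally show ?thesis .
  qed
  have \<theta>_add: "\<theta> (D + E) = \<theta> D + \<theta> E" for D E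
  proof -
    let ?F = "Poly_Mapping.keys D \<union> Poly_Mapping.keys E"
    have "\<theta> (D + E) = (\<Sum>P\<in>?F. Poly_Mapping.lookup (D + E) P * w (inv_into I center P))"
      by (rule \<theta>_superset) (use keys_add[of D E] in auto)
    also have "\<dots> = (\<Sum>P\<in>?F. Poly_Mapping.lookup D P * w (inv_into I center P)) +
        (\<Sum>P\<in>?F. Poly_Mapping.lookup E P * w (inv_into I center P))"
      by (simp add: lookup_add ring_distribs sum.distrib)
    also have "\<dots> = \<theta> D + \<theta> E" by (subst (1 2) \<theta>_superset[symmetric]) auto
    finally show ?thesis .
  qed
  have split: "(\<Sum>i\<in>insert p (insert q G). f i * w i) =
      f p - f q + (\<Sum>i\<in>G. f i * (int (v q (u i)) - int (v p (u i))))"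
    if "finite G" "G \<subseteq> I - {p, q}" for G and f :: "'i \<Rightarrow> int"
  proof -
    have "p \<notin> insert q G" "q \<notin> G" using that pq by auto
    then have "(\<Sum>i\<in>insert p (insert q G). f i * w i) = f p * w p + (f q * w q + (\<Sum>i\<in>G. f i * w i))"
      using that(1) by simp
    also have "(\<Sum>i\<in>G. f i * w i) = (\<Sum>i\<in>G. f i * (int (v q (u i)) - int (v p (u i))))"
      by (intro sum.cong refl) (use that in \<open>auto simp: w_def\<close>)
    finally show ?thesis using pq by (simp add: w_def)
  qed
  define U where "U e G = finprod R (\<lambda>i. u i [^] (e i :: nat)) G" for e G
  have U: "U e G \<in> carrier R - {\<zero>}"
    and v_U: "i \<in> I \<Longrightarrow> v i (U e G) = (\<Sum>j\<in>G. e j * v i (u j))"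
    and v_U_other: "i \<in> I - {p, q} \<Longrightarrow> v i (U e G) = (if i \<in> G then e i else 0)"
    if G: "finite G" "G \<subseteq> I - {p, q}" for e G i
  proof -
    have uR: "u j [^] e j \<in> carrier R - {\<zero>}" if "j \<in> G" for j
      by (rule pow_nonzero[OF u(1)]) (use that G in auto)
    show "U e G \<in> carrier R - {\<zero>}"
      unfolding U_def by (rule finprod_nonzero[OF G(1) uR])
    show *: "v i (U e G) = (\<Sum>j\<in>G. e j * v i (u j))" if i: "i \<in> I" for i
    proof -
      have "v i (U e G) = (\<Sum>j\<in>G. v i (u j [^] e j))"
        unfolding U_def by (rule v_finprod[OF i G(1) uR])
      also have "\<dots> = (\<Sum>j\<in>G. e j * v i (u j))"
        by (intro sum.cong refl v_pow[OF i u(1)]) (use G in auto)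
      finally show ?thesis .
    qed
    show "v i (U e G) = (if i \<in> G then e i else 0)" if i: "i \<in> I - {p, q}" for i
    proof -
      have "v i (U e G) = (\<Sum>j\<in>G. if i = j then e j else 0)"
      proof (subst *)
        show "(\<Sum>j\<in>G. e j * v i (u j)) = (\<Sum>j\<in>G. if i = j then e j else 0)"
        proof (rule sum.cong[OF refl])
          fix j assume "j \<in> G"
          then have "v i (u j) = (if i = j then 1 else 0)" using G i by (intro u(2)) auto
          then show "e j * v i (u j) = (if i = j then e j else 0)" by simp
        qed
      qed (use i in simp)
      then show ?thesis using G(1) by simp
    qed
  qed
  have trivial_on_elements: "(\<Sum>i\<in>insert p (insert q G). int (v i a) * w i) = 0"
    if a: "a \<in> carrier R - {\<zero>}" and G: "finite G" "G \<subseteq> I - {p, q}"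
      "{i \<in> I - {p, q}. v i a \<noteq> 0} \<subseteq> G" for a G
  proof -
    let ?A = "U (\<lambda>i. v i a) G"
    have "v p a + v q ?A = v p ?A + v q a"
      by (rule key[OF a U[OF G(1,2)]]) (use G(3) in \<open>auto simp: v_U_other[OF G(1,2)]\<close>)
    then have "int (v p a) - int (v q a) = int (v p ?A) - int (v q ?A)" by linarith
    also have "\<dots> = (\<Sum>j\<in>G. int (v j a) * int (v p (u j))) - (\<Sum>j\<in>G. int (v j a) * int (v q (u j)))"
      using v_U[OF G(1,2) pq(1)] v_U[OF G(1,2) pq(2)] by simp
    also have "\<dots> = - (\<Sum>i\<in>G. int (v i a) * (int (v q (u i)) - int (v p (u i))))"
      by (simp add: sum_subtractf right_diff_distrib)
    finally show ?thesis unfolding split[OF G(1,2)] by simp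
  qed
  have supp: "\<exists>G. finite G \<and> G \<subseteq> I - {p, q} \<and> Poly_Mapping.keys D \<subseteq> center ` insert p (insert q G)"
    if "Poly_Mapping.keys D \<subseteq> center ` I" for D :: "'a set \<Rightarrow>\<^sub>0 int"
  proof -
    obtain F where F: "finite F" "F \<subseteq> I" "Poly_Mapping.keys D = center ` F"
      using finite_subset_image[OF finite_keys \<open>Poly_Mapping.keys D \<subseteq> center ` I\<close>] by blast
    then show ?thesis by (intro exI[of _ "F - {p, q}"]) auto
  qed
  let ?G = "divisor_group R"
  have div_eq: "?G = free_Abelian_group (center ` I)"
    by (simp add: divisor_group_def height_one_primes_eq)
  interpret \<theta>: group_hom ?G integer_group \<theta>
  proof (intro group_hom.intro group_hom_axioms.intro homI)
    show "group ?G" "group integer_group" by (simp_all add: div_eq)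
    show "\<theta> D \<in> carrier integer_group" for D by (simp add: integer_group_def)
    show "\<theta> (D \<otimes>\<^bsub>?G\<^esub> E) = \<theta> D \<otimes>\<^bsub>integer_group\<^esub> \<theta> E" for D E
      by (simp add: div_eq integer_group_def \<theta>_add)
  qed
  have surj: "\<theta> ` carrier ?G = carrier integer_group"
  proof -
    have "k \<in> \<theta> ` carrier ?G" for k
    proof
      let ?D = "frag_cmul k (frag_of (center p))"
      show "?D \<in> carrier ?G" using pq by (auto simp: div_eq keys_frag_of)
      have "\<theta> ?D = (\<Sum>i\<in>{p}. Poly_Mapping.lookup ?D (center i) * w i)"
        by (rule \<theta>_index) (use pq in \<open>auto simp: keys_frag_of\<close>)
      then show "k = \<theta> ?D" by (simp add: w_def)
    qed
    then show ?thesis by (auto simp: integer_group_def)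
  qed
  have "kernel ?G integer_group \<theta> = principal_divisors R"
  proof (intro equalityI subsetI)
    fix D assume "D \<in> principal_divisors R"
    then obtain a b where D: "Poly_Mapping.keys D \<subseteq> center ` I"
      and a: "a \<in> carrier R - {\<zero>}" and b: "b \<in> carrier R - {\<zero>}"
      and eq: "\<And>i. i \<in> I \<Longrightarrow> Poly_Mapping.lookup D (center i) = int (v i a) - int (v i b)"
      unfolding principal_divisors_eq by blast
    obtain G0 where G0: "finite G0" "G0 \<subseteq> I - {p, q}" "Poly_Mapping.keys D \<subseteq> center ` insert p (insert q G0)"
      using supp[OF D] by blast
    let ?A = "{i \<in> I. v i a \<noteq> 0}" and ?B = "{i \<in> I. v i b \<noteq> 0}"
    define G where "G = G0 \<union> (?A \<union> ?B - {p, q})"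
    have G: "finite G" "G \<subseteq> I - {p, q}"
      "{i \<in> I - {p, q}. v i a \<noteq> 0} \<subseteq> G" "{i \<in> I - {p, q}. v i b \<noteq> 0} \<subseteq> G"
      using G0(1,2) v_finite[OF a] v_finite[OF b] by (auto simp: G_def)
    have "\<theta> D = (\<Sum>i\<in>insert p (insert q G). Poly_Mapping.lookup D (center i) * w i)"
      by (rule \<theta>_index) (use G pq G0(3) in \<open>auto simp: G_def\<close>)
    also have "\<dots> = (\<Sum>i\<in>insert p (insert q G). (int (v i a) - int (v i b)) * w i)"
      by (intro sum.cong refl) (use G(2) pq eq in auto)
    also have "\<dots> = 0"
      using trivial_on_elements[OF a G(1,2,3)] trivial_on_elements[OF b G(1,2,4)]
      by (simp add: left_diff_distrib sum_subtractf)
    finally have "\<theta> D = \<one>\<^bsub>integer_group\<^esub>" by (simp add: integer_group_def)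
    moreover have "D \<in> carrier ?G" unfolding div_eq using D by simp
    ultimately show "D \<in> kernel ?G integer_group \<theta>" by (simp add: kernel_def)
  next
    fix D assume "D \<in> kernel ?G integer_group \<theta>"
    then have "D \<in> carrier ?G" "\<theta> D = \<one>\<^bsub>integer_group\<^esub>" by (simp_all add: kernel_def)
    then have D: "Poly_Mapping.keys D \<subseteq> center ` I" and zero: "\<theta> D = 0"
      unfolding div_eq by (simp_all add: integer_group_def)
    obtain G where G: "finite G" "G \<subseteq> I - {p, q}" and keys: "Poly_Mapping.keys D \<subseteq> center ` insert p (insert q G)"
      using supp[OF D] by blast
    define d where "d i = Poly_Mapping.lookup D (center i)" for i
    have d0: "d i = 0" if "i \<in> I - {p, q}" "i \<notin> G" for i
    proof -
      have "center i \<notin> center ` insert p (insert q G)"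
        using that G pq inj_on_image_mem_iff[OF inj_center, of i "insert p (insert q G)"] by auto
      then show ?thesis using keys by (auto simp: d_def in_keys_iff)
    qed
    \<comment> \<open>\<open>A\<close> and \<open>B\<close> realize the positive and the negative part of \<open>D\<close> away from \<open>p\<close> and \<open>q\<close>;
      what remains of \<open>D\<close> is \<open>\<alpha>\<close> times the divisor of \<open>x\<close>.\<close>
    define A where "A = U (\<lambda>i. nat (d i)) G"
    define B where "B = U (\<lambda>i. nat (- d i)) G"
    have A: "A \<in> carrier R - {\<zero>}" and B: "B \<in> carrier R - {\<zero>}"
      unfolding A_def B_def by (rule U[OF G])+
    have diff: "int (v i A) - int (v i B) = (\<Sum>j\<in>G. d j * int (v i (u j)))" if i: "i \<in> I" for i
    proof -
      have "int (v i A) - int (v i B) =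
          (\<Sum>j\<in>G. int (nat (d j)) * int (v i (u j)) - int (nat (- d j)) * int (v i (u j)))"
        unfolding A_def B_def v_U[OF G i] by (simp add: sum_subtractf)
      also have "\<dots> = (\<Sum>j\<in>G. d j * int (v i (u j)))"
        by (intro sum.cong refl) (simp flip: left_diff_distrib)
      finally show ?thesis .
    qed
    define \<alpha> where "\<alpha> = d p - (int (v p A) - int (v p B))"
    have "\<theta> D = (\<Sum>i\<in>insert p (insert q G). d i * w i)"
      unfolding d_def by (rule \<theta>_index) (use G pq keys in auto)
    then have "0 = (\<Sum>i\<in>insert p (insert q G). d i * w i)" using zero by simp
    also have "\<dots> = \<alpha> - (d q - (int (v q A) - int (v q B)))"
      unfolding split[OF G] \<alpha>_def diff[OF pq(1)] diff[OF pq(2)]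
      by (simp add: sum_subtractf right_diff_distrib)
    finally have \<alpha>_q: "\<alpha> = d q - (int (v q A) - int (v q B))" by simp
    define a where "a = A \<otimes> x [^] nat \<alpha>"
    define b where "b = B \<otimes> x [^] nat (- \<alpha>)"
    have ab: "a \<in> carrier R - {\<zero>}" "b \<in> carrier R - {\<zero>}"
      unfolding a_def b_def using mult_nonzero A B pow_nonzero[OF x(1)] by blast+
    have v_ab: "int (v i a) - int (v i b) = int (v i A) - int (v i B) + \<alpha> * int (v i x)" if i: "i \<in> I" for i
    proof -
      have "int (v i a) - int (v i b) =
          int (v i A) - int (v i B) + (int (nat \<alpha>) - int (nat (- \<alpha>))) * int (v i x)"
        unfolding a_def b_def v_mult[OF i A pow_nonzero[OF x(1)]] v_mult[OF i B pow_nonzero[OF x(1)]]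
          v_pow[OF i x(1)] by (simp add: algebra_simps)
      then show ?thesis by simp
    qed
    have "Poly_Mapping.lookup D (center i) = int (v i a) - int (v i b)" if i: "i \<in> I" for i
    proof -
      consider "i = p" | "i = q" | "i \<in> I - {p, q}" using i by blast
      then show ?thesis
      proof cases
        case 3
        have "int (v i A) - int (v i B) = d i"
          unfolding A_def B_def v_U_other[OF G 3] using d0[OF 3] by auto
        then show ?thesis using v_ab[OF i] x(4)[OF 3] by (simp add: d_def)
      qed (use v_ab[OF i] x(2,3) \<alpha>_q in \<open>auto simp: d_def \<alpha>_def\<close>)
    qed
    then show "D \<in> principal_divisors R"
      unfolding principal_divisors_eq using D ab by blast
  qed
  then have "class_group R = ?G Mod kernel ?G integer_group \<theta>" by (simp add: class_group_def)
  then show ?thesis using \<theta>.FactGroup_iso[OF surj] by simp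
qed

end

section \<open>The valuations of the star ring\<close>

text \<open>
  The chart with \<open>x\<^sub>1, \<dots>, x\<^sub>n\<close> scaled by \<open>t\<close>, but only where they occur in the argument and not where the
  chart introduces them.  The order at \<open>t\<close> is then the least degree in these variables of a nonzero
  component modulo the ideal.
\<close>

definition graded_chart :: "nat \<Rightarrow> 'k::comm_ring_1 ypoly \<Rightarrow> 'k ypoly poly" where
  "graded_chart n = meval (\<lambda>c. [:mconst c:])
     (\<lambda>v. if v \<in> {n} \<times> {1..n} then [:0, mvar v:] else [:chart n n (mvar v):])"

lemma graded_chart_hom: "comm_ring_hom (graded_chart n)"
  unfolding graded_chart_def by (intro meval_hom const_poly_hom mconst_hom)

lemma graded_chart_mconst [simp]: "graded_chart n (mconst c) = [:mconst c:]"
  by (simp add: graded_chart_def meval_mconst[OF const_poly_hom[OF mconst_hom]])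

lemma graded_chart_mvar:
  "graded_chart n (mvar v) = (if v \<in> {n} \<times> {1..n} then [:0, mvar v:] else [:chart n n (mvar v):])"
  by (simp add: graded_chart_def meval_mvar[OF const_poly_hom[OF mconst_hom]])

lemma graded_chart_at_1:
  fixes a :: "'k::comm_ring_1 ypoly"
  shows "poly (graded_chart n a) 1 = chart n n a"
proof (rule hom_eqI[OF comp_hom[OF poly_eval_hom graded_chart_hom] chart_hom, of a UNIV])
  show "poly (graded_chart n (mvar v)) 1 = (chart n n (mvar v) :: 'k ypoly)" for v
    by (auto simp: graded_chart_mvar)
qed simp_all

text \<open>
  An element has positive order at \<open>t\<close> iff it becomes zero in the star ring when \<open>x\<^sub>1, \<dots>, x\<^sub>n\<close> are set
  to zero.
\<close>

lemma graded_chart_at_0: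
  fixes a :: "'k::comm_ring_1 ypoly"
  shows "poly (graded_chart n a) 0 = chart n n (kill ({n} \<times> {1..n}) a)"
proof (rule hom_eqI[OF comp_hom[OF poly_eval_hom graded_chart_hom] comp_hom[OF chart_hom kill_hom], of a UNIV])
  interpret comm_ring_hom "chart n n :: 'k ypoly \<Rightarrow> _" by (rule chart_hom)
  show "poly (graded_chart n (mvar v)) 0 = chart n n (kill ({n} \<times> {1..n}) (mvar v) :: 'k ypoly)" for v
    by (simp add: graded_chart_mvar)
qed simp_all

lemma graded_chart_LSS_poly:
  assumes "i \<noteq> n" "n \<ge> 1"
  shows "graded_chart n (LSS_poly n i n) = (0 :: 'k::comm_ring_1 ypoly poly)"
proof -
  interpret comm_ring_hom "graded_chart n :: 'k ypoly \<Rightarrow> _" by (rule graded_chart_hom)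
  interpret c: comm_ring_hom "chart n n :: 'k ypoly \<Rightarrow> _" by (rule chart_hom)
  have pCons_sum: "(\<Sum>k=1..q. [:0, f k:]) = [:0, \<Sum>k=1..q. f k:]" for q and f :: "nat \<Rightarrow> 'k ypoly"
    by (induction q) simp_all
  have "graded_chart n (LSS_poly n i n) = (\<Sum>k=1..n. [:0, chart n n (mvar (i, k) * mvar (n, k)) :: 'k ypoly:])"
    unfolding LSS_poly_def hom_sum hom_mult c.hom_mult
    by (intro sum.cong refl) (use assms(1) in \<open>simp add: graded_chart_mvar\<close>)
  also have "\<dots> = [:0, chart n n (LSS_poly n i n):]"
    unfolding pCons_sum LSS_poly_def c.hom_sum by (rule refl)
  also have "\<dots> = 0" using assms by (simp add: chart_LSS_poly)
  finally show ?thesis .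
qed

text \<open>
  The three kinds of valuations: \<open>Chart_prime p\<close> is the order at a prime \<open>p\<close> of the main chart,
  \<open>Center_place\<close> has the center \<open>(x\<^sub>1, \<dots>, x\<^sub>n)\<close>, and \<open>Minor_place\<close> the prime over \<open>x\<^sub>n\<close> and the minor of
  the first \<open>n - 1\<close> columns.
\<close>

datatype 'p place = Chart_prime 'p | Center_place | Minor_place

text \<open>
  Elements of the star ring are represented by elements of \<open>S\<close>; the nonzero ones by \<open>S - L\<close>.
\<close>

locale star_ring =
  fixes n :: nat and K :: "'k::field itself"
  assumes n: "n \<ge> 2"
begin

abbreviation S :: "'k ypoly set" where "S \<equiv> mpolys ({1..n} \<times> {1..n})"
abbreviation L :: "'k ypoly set" where "L \<equiv> star_ideal n (n - 1) n"
abbreviation x :: "'k ypoly" where "x \<equiv> mvar (n, n)"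

lemma n_in: "n \<in> {1..n}" and pred_in: "n - 1 \<in> {1..n}" and pred_ne: "n - 1 \<noteq> n"
  using n by auto

lemma x_in_S: "x \<in> S" using n_in by simp

lemma chart_0_iff:
  assumes "a \<in> S" "j \<in> {1..n}"
  shows "chart n j a = 0 \<longleftrightarrow> a \<in> L"
proof -
  have "n \<ge> 1" using n by simp
  from chart_kernel'[OF this assms] chart_star_ideal[OF _ assms(2), of a] show ?thesis by blast
qed

lemma graded_chart_0_iff:
  assumes a: "a \<in> S"
  shows "graded_chart n a = 0 \<longleftrightarrow> a \<in> L"
proof
  assume "graded_chart n a = 0"
  then have "chart n n a = 0" using graded_chart_at_1[of n a] by simp
  then show "a \<in> L" using chart_0_iff[OF a n_in] by simp
next
  interpret comm_ring_hom "graded_chart n :: 'k ypoly \<Rightarrow> _" by (rule graded_chart_hom)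
  assume "a \<in> L"
  then obtain c where c: "a = (\<Sum>i=1..n - 1. c i * LSS_poly n i n)" by (rule star_idealE)
  show "graded_chart n a = 0" unfolding c hom_sum hom_mult
    by (rule sum.neutral) (use n in \<open>auto simp: graded_chart_LSS_poly\<close>)
qed

lemma S_minus_L_mult:
  assumes "a \<in> S - L" "b \<in> S - L"
  shows "a * b \<in> S - L"
proof -
  interpret comm_ring_hom "chart n n :: 'k ypoly \<Rightarrow> _" by (rule chart_hom)
  have "chart n n a \<noteq> 0" "chart n n b \<noteq> 0" using assms chart_0_iff n_in by auto
  then have "chart n n (a * b) \<noteq> 0" by (simp add: hom_mult)
  then show ?thesis using assms chart_0_iff[of "a * b", OF _ n_in] by simp
qed

lemma one_in: "1 \<in> S - L"
proof -
  interpret comm_ring_hom "chart n n :: 'k ypoly \<Rightarrow> _" by (rule chart_hom)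
  show ?thesis using chart_0_iff[of 1, OF _ n_in] by simp
qed

lemma S_minus_L_power: "a \<in> S - L \<Longrightarrow> a ^ k \<in> S - L"
  by (induction k) (use one_in S_minus_L_mult in auto)

lemma x_in: "x \<in> S - L"
  using x_in_S chart_0_iff[OF x_in_S n_in] by simp

lemma mult_in_iff: 
  assumes "a \<in> S" "b \<in> S" "a * b \<in> L" "a \<notin> L"
  shows "b \<in> L"
  using S_minus_L_mult[of a b] assms by blast

lemma congruent_nonzero:
  assumes "a \<in> S" "b \<in> S - L" "a - b \<in> L \<or> b - a \<in> L"
  shows "a \<in> S - L"
proof -
  have "a \<notin> L"
  proof
    assume "a \<in> L"
    then have "a - (a - b) \<in> L \<or> (b - a) + a \<in> L" using assms(3) star_ideal_diff star_ideal_add by blast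
    then show False using assms(2) by simp
  qed
  then show ?thesis using assms(1) by simp
qed

definition places :: "'k ypoly place set" where
  "places = Chart_prime ` {p. prime_elem p \<and> prime_rep p = p \<and>
      p \<in> mpolys ({1..n} \<times> {1..n} \<inter> chart_vars n n) \<and> \<not> p dvd x} \<union> {Center_place, Minor_place}"

definition val :: "'k ypoly place \<Rightarrow> 'k ypoly \<Rightarrow> nat" where
  "val i a = (case i of Chart_prime p \<Rightarrow> prime_ord p (chart n n a)
     | Center_place \<Rightarrow> prime_ord [:0, 1:] (graded_chart n a)
     | Minor_place \<Rightarrow> prime_ord x (chart n (n - 1) a))"

lemma val_simps [simp]:
  "val (Chart_prime p) a = prime_ord p (chart n n a)"
  "val Center_place a = prime_ord [:0, 1:] (graded_chart n a)"
  "val Minor_place a = prime_ord x (chart n (n - 1) a)"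
  by (simp_all add: val_def)

lemma ord_hom:
  assumes p: "discrete_prime p" and f: "comm_ring_hom f" and ker: "\<And>a. a \<in> S \<Longrightarrow> f a = 0 \<longleftrightarrow> a \<in> L"
    and a: "a \<in> S - L" and b: "b \<in> S - L"
  shows "prime_ord p (f (a * b)) = prime_ord p (f a) + prime_ord p (f b)"
    and "a + b \<notin> L \<Longrightarrow> min (prime_ord p (f a)) (prime_ord p (f b)) \<le> prime_ord p (f (a + b))"
proof -
  interpret p: discrete_prime p by (rule p)
  interpret f: comm_ring_hom f by (rule f)
  have nz: "f a \<noteq> 0" "f b \<noteq> 0" using a b ker by auto
  show "prime_ord p (f (a * b)) = prime_ord p (f a) + prime_ord p (f b)"
    unfolding f.hom_mult by (rule p.prime_ord_mult[OF nz])
  show "min (prime_ord p (f a)) (prime_ord p (f b)) \<le> prime_ord p (f (a + b))" if "a + b \<notin> L"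
  proof -
    have "f (a + b) \<noteq> 0" using a b ker[of "a + b"] that by simp
    then show ?thesis unfolding f.hom_add by (rule p.prime_ord_add[OF nz])
  qed
qed

lemma x_prime: "discrete_prime x"
  by (rule discrete_prime_mpoly[OF mvar_prime])

lemma place_prime: "Chart_prime p \<in> places \<Longrightarrow> discrete_prime p"
  by (auto simp: places_def intro: discrete_prime_mpoly)

lemma val_mult:
  assumes "i \<in> places" "a \<in> S - L" "b \<in> S - L"
  shows "val i (a * b) = val i a + val i b"
proof (cases i)
  case (Chart_prime p)
  show ?thesis unfolding Chart_prime val_simps
    by (rule ord_hom(1)[OF place_prime chart_hom chart_0_iff[OF _ n_in] assms(2,3)])
       (use assms(1) Chart_prime in simp_all)
next
  case Center_place
  show ?thesis unfolding Center_place val_simps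
    by (rule ord_hom(1)[OF discrete_prime_var graded_chart_hom graded_chart_0_iff assms(2,3)])
next
  case Minor_place
  show ?thesis unfolding Minor_place val_simps
    by (rule ord_hom(1)[OF x_prime chart_hom chart_0_iff[OF _ pred_in] assms(2,3)])
qed

lemma val_add:
  assumes "i \<in> places" "a \<in> S - L" "b \<in> S - L" "a + b \<notin> L"
  shows "min (val i a) (val i b) \<le> val i (a + b)"
proof (cases i)
  case (Chart_prime p)
  show ?thesis unfolding Chart_prime val_simps
    by (rule ord_hom(2)[OF place_prime chart_hom chart_0_iff[OF _ n_in] assms(2,3,4)])
       (use assms(1) Chart_prime in simp_all)
next
  case Center_place
  show ?thesis unfolding Center_place val_simps
    by (rule ord_hom(2)[OF discrete_prime_var graded_chart_hom graded_chart_0_iff assms(2,3,4)])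
next
  case Minor_place
  show ?thesis unfolding Minor_place val_simps
    by (rule ord_hom(2)[OF x_prime chart_hom chart_0_iff[OF _ pred_in] assms(2,3,4)])
qed

lemma val_cong:
  assumes a: "a \<in> S" and b: "b \<in> S" and ab: "a - b \<in> L"
  shows "val i a = val i b"
proof -
  interpret c: comm_ring_hom "chart n n :: 'k ypoly \<Rightarrow> _" by (rule chart_hom)
  interpret j: comm_ring_hom "chart n (n - 1) :: 'k ypoly \<Rightarrow> _" by (rule chart_hom)
  interpret g: comm_ring_hom "graded_chart n :: 'k ypoly \<Rightarrow> _" by (rule graded_chart_hom)
  have d: "a - b \<in> S" using a b by simp
  have "chart n n (a - b) = 0" "chart n (n - 1) (a - b) = 0" "graded_chart n (a - b) = 0"
    using chart_0_iff[OF d n_in] chart_0_iff[OF d pred_in] graded_chart_0_iff[OF d] ab by simp_all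
  then have "chart n n a = chart n n b" "chart n (n - 1) a = chart n (n - 1) b" "graded_chart n a = graded_chart n b"
    unfolding c.hom_minus j.hom_minus g.hom_minus by simp_all
  then show ?thesis unfolding val_def by (cases i) (simp_all only: place.case)
qed

lemma val_one: "i \<in> places \<Longrightarrow> val i 1 = 0"
  using val_mult[OF _ one_in one_in] by simp

lemma val_power: "i \<in> places \<Longrightarrow> a \<in> S - L \<Longrightarrow> val i (a ^ k) = k * val i a"
  by (induction k) (use val_one val_mult S_minus_L_power in auto)

lemma special_places [simp]: "Center_place \<in> places" "Minor_place \<in> places"
  by (simp_all add: places_def)

lemma chart_prime_place:
  assumes "Chart_prime p \<in> places"
  shows "prime_elem p" "prime_rep p = p" "p \<in> mpolys ({1..n} \<times> {1..n} \<inter> chart_vars n n)" "\<not> p dvd x"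
  using assms by (auto simp: places_def)

lemma val_x:
  "val Center_place x = 1" "val Minor_place x = 1" "Chart_prime p \<in> places \<Longrightarrow> val (Chart_prime p) x = 0"
proof -
  interpret t: discrete_prime "[:0, 1:] :: 'k ypoly poly" by (rule discrete_prime_var)
  interpret x: discrete_prime x by (rule x_prime)
  have gx: "graded_chart n x = [:0, 1:] * [:x:]"
    using n_in by (simp add: graded_chart_mvar)
  have "prime_ord [:0, 1:] [:x:] = 0"
    using t.prime_ord_0_iff[of "[:x:]"] poly_eq_0_iff_dvd[of "[:x:]" 0] by simp
  then show "val Center_place x = 1"
    unfolding val_simps gx using t.prime_ord_mult[of "[:0, 1:]" "[:x:]"] t.prime_ord_self by simp
  show "val Minor_place x = 1" by (simp add: x.prime_ord_self)
  assume p: "Chart_prime p \<in> places"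
  interpret p: discrete_prime p by (rule place_prime[OF p])
  show "val (Chart_prime p) x = 0"
    using chart_prime_place(4)[OF p] by (simp add: p.prime_ord_0_iff)
qed

lemma divide_by_x:
  assumes c: "c \<in> S - L" and "0 < val Center_place c" "0 < val Minor_place c"
  shows "\<exists>d\<in>S - L. c - x * d \<in> L"
proof -
  interpret t: discrete_prime "[:0, 1:] :: 'k ypoly poly" by (rule discrete_prime_var)
  interpret x: discrete_prime x by (rule x_prime)
  have cS: "c \<in> S" using c by simp
  have "graded_chart n c \<noteq> 0" "chart n (n - 1) c \<noteq> 0"
    using c graded_chart_0_iff[OF cS] chart_0_iff[OF cS pred_in] by simp_all
  then have "[:0, 1:] dvd graded_chart n c" and Q: "x dvd chart n (n - 1) c"
    using assms(2,3) t.prime_ord_pos_iff x.prime_ord_pos_iff by simp_all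
  then have "poly (graded_chart n c) 0 = 0"
    using poly_eq_0_iff_dvd[of "graded_chart n c" 0] by simp
  then have "chart n n (kill ({n} \<times> {1..n}) c) = 0" by (simp only: graded_chart_at_0)
  from divisible_by_center_var[OF n cS this Q]
  obtain d where d: "d \<in> S" "c - x * d \<in> L" by blast
  have "x * d \<in> S - L" using d c x_in_S by (intro congruent_nonzero[of "x * d" c]) auto
  then have "d \<notin> L" using star_ideal_mult[of d n "n - 1" n x] by blast
  then show ?thesis using d by blast
qed

lemma divide_by_x_power:
  assumes "c \<in> S - L" "k \<le> val Center_place c" "k \<le> val Minor_place c"
  shows "\<exists>d\<in>S - L. c - x ^ k * d \<in> L"
  using assms
proof (induction k arbitrary: c)
  case 0
  then show ?case by (intro bexI[of _ c]) simp_all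
next
  case (Suc k)
  have "0 < val Center_place c" "0 < val Minor_place c" using Suc.prems(2,3) by simp_all
  from divide_by_x[OF Suc.prems(1) this] obtain d where d: "d \<in> S - L" "c - x * d \<in> L" by blast
  have "val i c = val i x + val i d" if "i \<in> places" for i
    using val_cong[OF _ _ d(2), of i] val_mult[OF that x_in d(1)] Suc.prems(1) d(1) x_in_S by simp
  from this[of Center_place] this[of Minor_place]
  have "k \<le> val Center_place d" "k \<le> val Minor_place d"
    using Suc.prems(2,3) val_x by (simp_all del: val_simps)
  from Suc.IH[OF d(1) this] obtain e where e: "e \<in> S - L" "d - x ^ k * e \<in> L" by blast
  have "c - x ^ Suc k * e = (c - x * d) + x * (d - x ^ k * e)" by (simp add: algebra_simps)
  also have "\<dots> \<in> L" by (intro star_ideal_add d star_ideal_mult e)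
  finally show ?case using e by blast
qed

text \<open>
  The main chart turns the inequalities into divisibility up to a power of \<open>x\<^sub>n\<close> of polynomials, and by
  \<open>chart_image\<close> the quotient comes from the star ring after multiplication by another power.
\<close>

lemma divides_locally:
  assumes a: "a \<in> S - L" and b: "b \<in> S - L"
    and le: "\<And>p. Chart_prime p \<in> places \<Longrightarrow> val (Chart_prime p) b \<le> val (Chart_prime p) a"
  shows "\<exists>N. \<exists>c\<in>S - L. x ^ N * a - b * c \<in> L"
proof -
  let ?W = "{1..n} \<times> {1..n} \<inter> chart_vars n n"
  interpret c: comm_ring_hom "chart n n :: 'k ypoly \<Rightarrow> _" by (rule chart_hom)
  have nz: "chart n n a \<noteq> 0" "chart n n b \<noteq> 0" using a b chart_0_iff n_in by auto
  have ab: "a \<in> S" "b \<in> S" using a b by simp_all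
  have W: "chart n n a \<in> mpolys ?W" "chart n n b \<in> mpolys ?W"
    by (rule chart_in_mpolys[OF ab(1) n_in], rule chart_in_mpolys[OF ab(2) n_in])
  have "prime_ord q (chart n n b) \<le> prime_ord q (chart n n a)" if q: "prime_elem q" "\<not> q dvd x" for q
  proof (cases "q dvd chart n n b")
    case False
    interpret q: discrete_prime q by (rule discrete_prime_mpoly[OF q(1)])
    have "prime_ord q (chart n n b) = 0" using False q.prime_ord_0_iff[OF nz(2)] by blast
    then show ?thesis by simp
  next
    case True
    let ?p = "prime_rep q"
    have "?p dvd chart n n b" using prime_rep(1) True by (rule dvd_trans)
    then have "?p \<in> mpolys ?W" using W(2) nz(2) by (rule mpolys_dvd)
    moreover have "prime_elem ?p" by (rule prime_elem_assoc[OF q(1) prime_rep(2,1)])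
    moreover have "\<not> ?p dvd x" using q(2) prime_rep(2) dvd_trans by blast
    moreover have "prime_rep ?p = ?p" by (rule prime_rep_cong[OF prime_rep])
    ultimately have "Chart_prime ?p \<in> places" by (auto simp: places_def)
    from le[OF this] show ?thesis using prime_ord_assoc[OF prime_rep, of q] by simp
  qed
  from dvd_up_to_prime[OF nz this] obtain N where "chart n n b dvd x ^ N * chart n n a" by blast
  then obtain C where C: "x ^ N * chart n n a = chart n n b * C" by (rule dvdE)
  have xW: "x \<in> mpolys ?W" using n_in by (intro mpolys_mvar) (auto simp: chart_vars_def)
  have "C * chart n n b \<in> mpolys ?W" "C * chart n n b \<noteq> 0"
    unfolding mult.commute[of C] C[symmetric] using W(1) xW nz(1) by auto
  then have "C \<in> mpolys ?W" by (rule mpolys_mult_left)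
  then obtain M c where c: "c \<in> S" "chart n n c = x ^ M * C"
    using chart_image[OF _ n_in, of C] by blast
  have "chart n n (x ^ (N + M) * a) = x ^ M * (x ^ N * chart n n a)"
    unfolding c.hom_mult c.hom_power chart_center by (simp add: power_add mult_ac)
  also have "\<dots> = chart n n (b * c)" unfolding C c.hom_mult c(2) by (simp add: mult_ac)
  finally have "chart n n (x ^ (N + M) * a - b * c) = 0" unfolding c.hom_minus by simp
  then have L: "x ^ (N + M) * a - b * c \<in> L"
    using chart_0_iff[of "x ^ (N + M) * a - b * c", OF _ n_in] a b c x_in_S by simp
  have "x ^ (N + M) * a \<in> S - L" by (intro S_minus_L_mult S_minus_L_power x_in a)
  from congruent_nonzero[OF _ this, of "b * c"] L have "b * c \<in> S - L" using b c by auto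
  then have "c \<notin> L" using star_ideal_mult[of c n "n - 1" n b] by blast
  then show ?thesis using L c by blast
qed

text \<open>
  By \<open>divides_locally\<close>, \<open>b\<close> divides \<open>x\<^sub>n\<^sup>N a\<close> with a quotient \<open>c\<close>.  The inequalities at the two special
  places give \<open>c\<close> the values needed to divide it by \<open>x\<^sub>n\<^sup>N\<close>.
\<close>

lemma val_divides:
  assumes a: "a \<in> S - L" and b: "b \<in> S - L" and le: "\<And>i. i \<in> places \<Longrightarrow> val i b \<le> val i a"
  shows "\<exists>c\<in>S. a - c * b \<in> L"
proof -
  obtain N c where c: "c \<in> S - L" "x ^ N * a - b * c \<in> L" using divides_locally[OF a b le] by blast
  have xa: "x ^ N * a \<in> S - L" by (intro S_minus_L_mult S_minus_L_power x_in a)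
  have bc: "b * c \<in> S - L" by (rule S_minus_L_mult[OF b c(1)])
  have "N * val i x + val i a = val i b + val i c" if i: "i \<in> places" for i
    using val_cong[OF _ _ c(2), of i] xa bc
      val_mult[OF i S_minus_L_power[OF x_in] a] val_power[OF i x_in] val_mult[OF i b c(1)] by simp
  from this[of Center_place] this[of Minor_place] le[of Center_place] le[of Minor_place]
  have "N \<le> val Center_place c" "N \<le> val Minor_place c"
    using val_x by (simp_all del: val_simps)
  from divide_by_x_power[OF c(1) this] obtain d where d: "d \<in> S - L" "c - x ^ N * d \<in> L" by blast
  have "x ^ N * (a - d * b) = (x ^ N * a - b * c) + b * (c - x ^ N * d)" by (simp add: algebra_simps)
  also have "\<dots> \<in> L" by (intro star_ideal_add c star_ideal_mult d)
  finally have "a - d * b \<in> L"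
    using mult_in_iff[of "x ^ N" "a - d * b"] S_minus_L_power[OF x_in, of N] a b d by simp
  then show ?thesis using d by blast
qed

lemma val_finite:
  assumes a: "a \<in> S - L"
  shows "finite {i \<in> places. val i a \<noteq> 0}"
proof -
  have nz: "chart n n a \<noteq> 0" using a chart_0_iff n_in by auto
  then obtain u ps where u: "u dvd 1" and ps: "\<And>q. q \<in> set ps \<Longrightarrow> prime_elem q"
    and fac: "chart n n a = u * prod_list ps"
    using mpoly_prime_factorization by metis
  have "i \<in> Chart_prime ` prime_rep ` set ps \<union> {Center_place, Minor_place}"
    if i: "i \<in> places" "val i a \<noteq> 0" for i
  proof (cases i)
    case (Chart_prime p)
    note p = chart_prime_place[OF i(1)[unfolded Chart_prime]]
    interpret p: discrete_prime p by (rule discrete_prime_mpoly[OF p(1)])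
    have "prime_ord p (chart n n a) \<noteq> 0" using i(2) unfolding Chart_prime by simp
    then have "p dvd u * prod_list ps" unfolding fac[symmetric] p.prime_ord_0_iff[OF nz] by simp
    moreover have "\<not> p dvd u" using u p(1) by (meson dvd_trans prime_elem_def)
    ultimately have "p dvd prod_list ps" using p(1) by (simp add: prime_elem_dvd_mult_iff)
    then have "\<exists>q\<in>set ps. p dvd q"
    proof (induction ps)
      case Nil
      then show ?case using p(1) by (simp add: prime_elem_def)
    next
      case (Cons q ps)
      then show ?case using p(1) by (auto simp: prime_elem_dvd_mult_iff)
    qed
    then obtain q where q: "q \<in> set ps" "p dvd q" by blast
    have "q dvd p" by (rule prime_dvd_prime[OF p(1) ps[OF q(1)] q(2)])
    then have "p = prime_rep q" using prime_rep_cong[OF q(2)] p(2) by simp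
    then show ?thesis unfolding Chart_prime using q(1) by blast
  qed simp_all
  then have "{i \<in> places. val i a \<noteq> 0} \<subseteq> Chart_prime ` prime_rep ` set ps \<union> {Center_place, Minor_place}"
    by blast
  then show ?thesis by (rule finite_subset) simp
qed

text \<open>
  By \<open>chart_image\<close> some multiple of \<open>p\<close> by a power of \<open>x\<^sub>n\<close> comes from the star ring; the power of
  \<open>x\<^sub>n\<close> is invisible at the places of the main chart.
\<close>

lemma prime_representative:
  assumes p: "Chart_prime p \<in> places"
  shows "\<exists>u\<in>S - L. \<forall>q. Chart_prime q \<in> places \<longrightarrow> val (Chart_prime q) u = (if q = p then 1 else 0)"
proof -
  obtain M u where u: "u \<in> S" "chart n n u = x ^ M * p"
    using chart_image[OF chart_prime_place(3)[OF p] n_in] by blast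
  interpret p: discrete_prime p by (rule place_prime[OF p])
  have "chart n n u \<noteq> 0" unfolding u(2) using p.p_nonzero by simp
  then have uL: "u \<in> S - L" using chart_0_iff[OF u(1) n_in] u(1) by simp
  have "val (Chart_prime q) u = (if q = p then 1 else 0)" if q: "Chart_prime q \<in> places" for q
  proof -
    interpret q: discrete_prime q by (rule place_prime[OF q])
    have "prime_ord q (x ^ M) = 0"
      using val_x(3)[OF q] q.prime_ord_power[of x M] by simp
    then have eq: "val (Chart_prime q) u = prime_ord q p"
      using q.prime_ord_mult[of "x ^ M" p] p.p_nonzero by (simp add: u(2))
    show ?thesis
    proof (cases "q = p")
      case True
      then show ?thesis using eq p.prime_ord_self by simp
    next
      case False
      have "\<not> q dvd p"
      proof
        assume dvd: "q dvd p"
        have "p dvd q" by (rule prime_dvd_prime[OF q.prime p.prime dvd])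
        then have "prime_rep q = prime_rep p" using dvd by (intro prime_rep_cong)
        then show False using False chart_prime_place(2)[OF p] chart_prime_place(2)[OF q] by simp
      qed
      then show ?thesis using False eq p.p_nonzero q.prime_ord_0_iff by simp
    qed
  qed
  then show ?thesis using uL by blast
qed

definition y :: "'k ypoly" where "y = mvar (n, n - 1)"

lemma y_in: "y \<in> S - L"
proof -
  have "y \<in> S" unfolding y_def using n_in pred_in by simp
  then show ?thesis using chart_0_iff[OF _ n_in, of y] by (simp add: y_def)
qed

lemma val_y: "val Center_place y = 1" "val Minor_place y = 0"
proof -
  interpret t: discrete_prime "[:0, 1:] :: 'k ypoly poly" by (rule discrete_prime_var)
  interpret x: discrete_prime x by (rule x_prime)
  have gy: "graded_chart n y = [:0, 1:] * [:y:]"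
    using n_in pred_in by (simp add: graded_chart_mvar y_def)
  have y0: "[:y:] \<noteq> 0" by (simp add: y_def)
  then have "prime_ord [:0, 1:] [:y:] = 0"
    using t.prime_ord_0_iff[of "[:y:]"] poly_eq_0_iff_dvd[of "[:y:]" 0] by simp
  then show "val Center_place y = 1"
    unfolding val_simps gy using t.prime_ord_mult[of "[:0, 1:]" "[:y:]"] t.prime_ord_self y0 by simp
  have "\<not> x dvd y" using pred_ne by (simp add: mvar_dvd_iff_kill y_def)
  then show "val Minor_place y = 0" using x.prime_ord_0_iff[of y] by (simp add: y_def)
qed

text \<open>
  The minor \<open>\<delta>\<close> of the first \<open>n - 1\<close> columns.  By Cramer's rule \<open>\<delta> x\<^sub>n\<^sub>-\<^sub>1\<close> is a combination of the forms
  cut to \<open>n - 1\<close> columns, so modulo the full forms it is a multiple of \<open>x\<^sub>n\<close>.  It is nonzero, being \<open>1\<close>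
  at the identity matrix, and free of the \<open>x\<^sub>k\<close>, so its value at \<open>Center_place\<close> is zero.
\<close>

lemma minor:
  obtains \<delta> where "\<delta> \<in> S - L" "val Center_place \<delta> = 0" "0 < val Minor_place \<delta>"
proof -
  obtain j where j: "n = Suc j" "j \<ge> 1" using n by (cases n) auto
  define A :: "'k ypoly mat" where "A = mat j j (\<lambda>(r, s). mvar (Suc r, Suc s))"
  define \<delta> where "\<delta> = det A"
  have A: "A \<in> carrier_mat j j" by (simp add: A_def)
  have kill_A: "kill W \<delta> = \<delta>" if "W \<inter> {1..j} \<times> {1..j} = {}" for W
  proof -
    interpret comm_ring_hom "kill W :: 'k ypoly \<Rightarrow> _" by (rule kill_hom)
    have "map_mat (kill W) A = A"
      by (rule eq_matI) (use that in \<open>auto simp: A_def\<close>)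
    then show ?thesis unfolding \<delta>_def hom_det[symmetric] by simp
  qed
  have \<delta>S: "\<delta> \<in> S"
    using mpolys_kill[of "{1..n} \<times> {1..n}" \<delta>] kill_A[of "- ({1..n} \<times> {1..n})"] j by fastforce
  have \<delta>X: "kill ({n} \<times> {1..n}) \<delta> = \<delta>" by (rule kill_A) (use j in auto)
  have "\<delta> \<noteq> 0"
  proof
    assume 0: "\<delta> = 0"
    define e :: "'k ypoly \<Rightarrow> 'k" where "e = meval (\<lambda>c. c) (\<lambda>(i, k). if i = k then 1 else 0)"
    interpret e: comm_ring_hom e unfolding e_def by (intro meval_hom id_hom)
    have "map_mat e A = 1\<^sub>m j"
      by (rule eq_matI) (auto simp: A_def e_def meval_mvar[OF id_hom])
    then have "e \<delta> = 1" unfolding \<delta>_def e.hom_det[symmetric] by simp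
    then show False using 0 by simp
  qed
  then have \<delta>L: "\<delta> \<notin> L" using kill_center_star_ideal[of \<delta> n "n - 1" n "{n} \<times> {1..n}"] \<delta>X by auto
  interpret t: discrete_prime "[:0, 1:] :: 'k ypoly poly" by (rule discrete_prime_var)
  interpret x: discrete_prime x by (rule x_prime)
  interpret c: comm_ring_hom "chart n (n - 1) :: 'k ypoly \<Rightarrow> _" by (rule chart_hom)
  have nz: "graded_chart n \<delta> \<noteq> 0" "chart n (n - 1) \<delta> \<noteq> 0" "chart n n \<delta> \<noteq> 0"
    using graded_chart_0_iff[OF \<delta>S] chart_0_iff[OF \<delta>S pred_in] chart_0_iff[OF \<delta>S n_in] \<delta>L by simp_all
  have "poly (graded_chart n \<delta>) 0 \<noteq> 0" unfolding graded_chart_at_0 \<delta>X by (rule nz(3))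
  then have "\<not> [:0, 1:] dvd graded_chart n \<delta>"
    using poly_eq_0_iff_dvd[of "graded_chart n \<delta>" 0] by simp
  then have center: "val Center_place \<delta> = 0" using t.prime_ord_0_iff[OF nz(1)] by simp
  \<comment> \<open>The last row of the adjugate matrix eliminates all \<open>x\<^sub>k\<close> with \<open>k < n - 1\<close> from the cut forms.\<close>
  let ?B = "adj_mat A"
  have B: "?B \<in> carrier_mat j j" "?B * A = \<delta> \<cdot>\<^sub>m 1\<^sub>m j" using adj_mat[OF A] by (simp_all add: \<delta>_def)
  have cramer: "(\<Sum>r<j. ?B $$ (j - 1, r) * mvar (Suc r, Suc s)) = (if s = j - 1 then \<delta> else 0)" if s: "s < j" for s
  proof -
    have "(?B * A) $$ (j - 1, s) = (\<Sum>r<j. ?B $$ (j - 1, r) * A $$ (r, s))"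
      using A B(1) j s by (simp add: times_mat_def scalar_prod_def atLeast0LessThan)
    also have "\<dots> = (\<Sum>r<j. ?B $$ (j - 1, r) * mvar (Suc r, Suc s))"
      using s by (intro sum.cong refl) (simp add: A_def)
    finally show ?thesis unfolding B(2) using j s by auto
  qed
  have "(\<Sum>r<j. ?B $$ (j - 1, r) * LSS_poly j (Suc r) n) =
      (\<Sum>r<j. \<Sum>s<j. ?B $$ (j - 1, r) * mvar (Suc r, Suc s) * mvar (n, Suc s))"
    unfolding LSS_poly_def sum_distrib_left
    by (intro sum.cong refl sum.reindex_bij_witness[of _ Suc "\<lambda>k. k - 1"]) (auto simp: mult.assoc)
  also have "\<dots> = (\<Sum>s<j. (\<Sum>r<j. ?B $$ (j - 1, r) * mvar (Suc r, Suc s)) * mvar (n, Suc s))"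
    unfolding sum_distrib_right by (rule sum.swap)
  also have "\<dots> = (\<Sum>s<j. if s = j - 1 then \<delta> * mvar (n, Suc s) else 0)"
    by (intro sum.cong refl) (use cramer in auto)
  also have "\<dots> = \<delta> * mvar (n, j)" using j by simp
  finally have 1: "\<delta> * mvar (n, j) = (\<Sum>r<j. ?B $$ (j - 1, r) * LSS_poly j (Suc r) n)" ..
  define g where "g = (\<Sum>r<j. ?B $$ (j - 1, r) * mvar (Suc r, n))"
  have "\<delta> * mvar (n, j) + x * g = (\<Sum>r<j. ?B $$ (j - 1, r) * LSS_poly n (Suc r) n)"
    unfolding 1 g_def unfolding j(1) LSS_poly_Suc by (simp add: algebra_simps sum.distrib sum_distrib_left)
  also have "\<dots> \<in> L" using j by (intro star_ideal_sum star_ideal_mult star_ideal_gen) auto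
  finally have "chart n (n - 1) (\<delta> * mvar (n, j) + x * g) = 0" by (rule chart_star_ideal[OF _ pred_in])
  then have "chart n (n - 1) \<delta> * mvar (n, j) = x * (- chart n (n - 1) g)"
    unfolding c.hom_add c.hom_mult chart_center by (simp add: eq_neg_iff_add_eq_0)
  then have "x dvd chart n (n - 1) \<delta> * mvar (n, j)" by (metis dvd_triv_left)
  moreover have "\<not> x dvd mvar (n, j)" using j by (simp add: mvar_dvd_iff_kill)
  ultimately have "x dvd chart n (n - 1) \<delta>" using x.prime by (simp add: prime_elem_dvd_mult_iff)
  then have "0 < val Minor_place \<delta>" using x.prime_ord_pos_iff[OF nz(2)] by simp
  then show ?thesis using that[of \<delta>] \<delta>S \<delta>L center by blast
qed

end

context star_ring
begin

lemma val_uniformizer: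
  assumes "i \<in> places"
  shows "\<exists>u\<in>S - L. val i u = 1"
proof (cases i)
  case (Chart_prime p)
  then have p: "Chart_prime p \<in> places" using assms by simp
  from prime_representative[OF this] obtain u where "u \<in> S - L" "val (Chart_prime p) u = 1"
    using p by (metis (full_types))
  then show ?thesis unfolding Chart_prime by blast
next
  case Center_place
  then show ?thesis using x_in val_x(1) by blast
next
  case Minor_place
  then show ?thesis using x_in val_x(2) by blast
qed

lemma cancel_x_power:
  assumes "a \<in> S - L" "k \<le> val Center_place a" "k \<le> val Minor_place a"
  obtains b where "b \<in> S - L" "val Center_place b + k = val Center_place a"
    "val Minor_place b + k = val Minor_place a"
    "\<And>p. Chart_prime p \<in> places \<Longrightarrow> val (Chart_prime p) b = val (Chart_prime p) a"
proof -
  obtain b where b: "b \<in> S - L" "a - x ^ k * b \<in> L" using divide_by_x_power[OF assms] by blast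
  have xb: "x ^ k * b \<in> S - L" by (intro S_minus_L_mult S_minus_L_power x_in b)
  have val: "val i a = k * val i x + val i b" if i: "i \<in> places" for i
    using val_cong[OF _ _ b(2), of i] assms(1) xb val_mult[OF i S_minus_L_power[OF x_in] b(1)]
      val_power[OF i x_in] by simp
  show ?thesis
  proof (rule that[OF b(1)])
    show "val Center_place b + k = val Center_place a"
      using val[of Center_place] val_x(1) by (simp del: val_simps)
    show "val Minor_place b + k = val Minor_place a"
      using val[of Minor_place] val_x(2) by (simp del: val_simps)
    show "val (Chart_prime p) b = val (Chart_prime p) a" if p: "Chart_prime p \<in> places" for p
      using val[OF p] val_x(3)[OF p] by (simp del: val_simps)
  qed
qed

text \<open>
  Start with an element that vanishes at \<open>p\<close>.  Its value at \<open>Center_place\<close> is removed by a multiplication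
  with a power of the minor and a division by the same power of \<open>x\<^sub>n\<close>; then the value at
  \<open>Minor_place\<close> in the same way with \<open>x\<^sub>n\<^sub>-\<^sub>1\<close> in place of the minor.
\<close>

lemma prime_away_from_special:
  assumes p: "Chart_prime p \<in> places"
  shows "\<exists>s\<in>S - L. 0 < val (Chart_prime p) s \<and> val Center_place s = 0 \<and> val Minor_place s = 0"
proof -
  obtain u where u: "u \<in> S - L" "val (Chart_prime p) u = 1" using val_uniformizer[OF p] by blast
  obtain \<delta> where \<delta>: "\<delta> \<in> S - L" "val Center_place \<delta> = 0" "0 < val Minor_place \<delta>" by (rule minor)
  define \<alpha> where "\<alpha> = val Center_place u"
  define a where "a = u * \<delta> ^ \<alpha>"
  have a: "a \<in> S - L" unfolding a_def by (intro S_minus_L_mult S_minus_L_power u \<delta>)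
  have val_a: "val i a = val i u + \<alpha> * val i \<delta>" if "i \<in> places" for i
    unfolding a_def using val_mult[OF that u(1) S_minus_L_power[OF \<delta>(1)]] val_power[OF that \<delta>(1)] by simp
  have "val Center_place a = \<alpha>" using val_a[of Center_place] \<delta>(2) by (simp add: \<alpha>_def del: val_simps)
  moreover have "\<alpha> \<le> val Minor_place a"
  proof -
    have "\<alpha> * 1 \<le> \<alpha> * val Minor_place \<delta>" using \<delta>(3) by (intro mult_le_mono2) simp
    then show ?thesis unfolding val_a[OF special_places(2)] mult_1_right by (rule trans_le_add2)
  qed
  ultimately obtain b where b: "b \<in> S - L" "val Center_place b + \<alpha> = \<alpha>"
    "val (Chart_prime p) b = val (Chart_prime p) a"
    using cancel_x_power[OF a, of \<alpha>] p by (metis order_refl)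
  have b_p: "0 < val (Chart_prime p) b" using b(3) val_a[OF p] u(2) by (simp del: val_simps)
  define \<beta> where "\<beta> = val Minor_place b"
  define c where "c = b * y ^ \<beta>"
  have c: "c \<in> S - L" unfolding c_def by (intro S_minus_L_mult S_minus_L_power b y_in)
  have val_c: "val i c = val i b + \<beta> * val i y" if "i \<in> places" for i
    unfolding c_def using val_mult[OF that b(1) S_minus_L_power[OF y_in]] val_power[OF that y_in] by simp
  have c_val: "val Center_place c = \<beta>" "val Minor_place c = \<beta>"
    using val_c[of Center_place] val_c[of Minor_place] val_y b(2) by (simp_all add: \<beta>_def del: val_simps)
  then obtain d where d: "d \<in> S - L" "val Center_place d + \<beta> = \<beta>" "val Minor_place d + \<beta> = \<beta>"
    "val (Chart_prime p) d = val (Chart_prime p) c"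
    using cancel_x_power[OF c, of \<beta>] p by (metis order_refl)
  then have "0 < val (Chart_prime p) d" "val Center_place d = 0" "val Minor_place d = 0"
    using val_c[OF p] b_p by (simp_all del: val_simps)
  then show ?thesis using d(1) by blast
qed

lemma val_separate:
  assumes i: "i \<in> places" and j: "j \<in> places" and ne: "i \<noteq> j"
  shows "\<exists>s\<in>S - L. val j s > 0 \<and> val i s = 0"
proof (cases j)
  case (Chart_prime p)
  then have p: "Chart_prime p \<in> places" using j by simp
  show ?thesis
  proof (cases i)
    case i_eq: (Chart_prime q)
    obtain u where u: "u \<in> S - L"
      "\<And>q. Chart_prime q \<in> places \<Longrightarrow> val (Chart_prime q) u = (if q = p then 1 else 0)"
      using prime_representative[OF p] by blast
    have "q \<noteq> p" using ne i_eq Chart_prime by simp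
    then have "val (Chart_prime p) u = 1" "val (Chart_prime q) u = 0"
      using u(2)[OF p] u(2)[of q] i i_eq by (simp_all del: val_simps)
    then show ?thesis unfolding i_eq Chart_prime using u(1) by (intro bexI[of _ u]) (simp_all del: val_simps)
  qed (use prime_away_from_special[OF p] Chart_prime in auto)
next
  case j_eq: Center_place
  show ?thesis
  proof (cases i)
    case (Chart_prime q)
    then show ?thesis using x_in val_x i j_eq by (intro bexI[of _ x]) (simp_all del: val_simps)
  next
    case Minor_place
    then show ?thesis using y_in val_y j_eq by (intro bexI[of _ y]) (simp_all del: val_simps)
  qed (use ne j_eq in simp)
next
  case j_eq: Minor_place
  show ?thesis
  proof (cases i)
    case (Chart_prime q)
    then show ?thesis using x_in val_x i j_eq by (intro bexI[of _ x]) (simp_all del: val_simps)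
  next
    case Center_place
    obtain \<delta> where "\<delta> \<in> S - L" "val Center_place \<delta> = 0" "0 < val Minor_place \<delta>" by (rule minor)
    then show ?thesis unfolding j_eq Center_place by blast
  qed (use ne j_eq in simp)
qed

text \<open>
  Up to a power of \<open>x\<^sub>n\<close> the quotient of \<open>a\<close> and \<open>b\<close> is an element \<open>c\<close> that divides a power of \<open>x\<^sub>n\<close>.
  Since \<open>x\<^sub>n\<close> is prime in the main chart, \<open>c\<close> is a constant times a power of \<open>x\<^sub>n\<close>, and the two
  special values of \<open>x\<^sub>n\<close> agree.
\<close>

lemma special_values_determined:
  assumes a: "a \<in> S - L" and b: "b \<in> S - L"
    and eq: "\<And>p. Chart_prime p \<in> places \<Longrightarrow> val (Chart_prime p) a = val (Chart_prime p) b"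
  shows "val Center_place a + val Minor_place b = val Center_place b + val Minor_place a"
proof -
  interpret c: comm_ring_hom "chart n n :: 'k ypoly \<Rightarrow> _" by (rule chart_hom)
  obtain N c where c: "c \<in> S - L" "x ^ N * a - b * c \<in> L"
    using divides_locally[OF a b] eq by (metis order_refl)
  have xa: "x ^ N * a \<in> S - L" by (intro S_minus_L_mult S_minus_L_power x_in a)
  have bc: "b * c \<in> S - L" by (rule S_minus_L_mult[OF b c(1)])
  have val_c: "N * val i x + val i a = val i b + val i c" if i: "i \<in> places" for i
    using val_cong[OF _ _ c(2), of i] xa bc val_mult[OF i S_minus_L_power[OF x_in] a]
      val_power[OF i x_in] val_mult[OF i b c(1)] by simp
  have "val (Chart_prime p) c \<le> val (Chart_prime p) 1" if p: "Chart_prime p \<in> places" for p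
    using val_c[OF p] val_x(3)[OF p] eq[OF p] by (simp del: val_simps)
  from divides_locally[OF one_in c(1) this] obtain M d where d: "d \<in> S - L" "x ^ M * 1 - c * d \<in> L" by blast
  have "chart n n (x ^ M * 1 - c * d) = 0" by (rule chart_star_ideal[OF d(2) n_in])
  then have "chart n n c * chart n n d = x ^ M"
    unfolding c.hom_minus c.hom_mult c.hom_power chart_center by simp
  from divisors_of_prime_power[OF mvar_prime this]
  obtain u k where u: "u dvd 1" "chart n n c = u * x ^ k" by blast
  obtain e where e: "u = mconst e" "u \<noteq> 0" using unit_is_constant[OF u(1)] by blast
  have uxk: "u * x ^ k \<in> S" using e x_in_S by simp
  have "chart n n (c - u * x ^ k) = 0"
    unfolding c.hom_minus c.hom_mult c.hom_power chart_center u(2) e(1) by simp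
  then have L: "c - u * x ^ k \<in> L"
    using chart_0_iff[of "c - u * x ^ k", OF _ n_in] c(1) uxk by simp
  have uS: "u \<in> S - L"
  proof -
    have "u \<in> S" using e by simp
    then show ?thesis using chart_0_iff[OF _ n_in, of u] e by simp
  qed
  have unit_val: "val i u = 0" if i: "i \<in> places" for i
  proof -
    obtain w where w: "1 = u * w" using u(1) by (rule dvdE)
    then have "w dvd 1" by (metis dvd_triv_right)
    then obtain f where f: "w = mconst f" using unit_is_constant by blast
    then have "w \<in> S" by simp
    have "w \<notin> L" using star_ideal_mult[of w n "n - 1" n u] one_in w by auto
    then have "val i (u * w) = val i u + val i w" using val_mult[OF i uS] \<open>w \<in> S\<close> by simp
    then show ?thesis using w val_one[OF i] by simp
  qed
  have "val i c = k * val i x" if i: "i \<in> places" for i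
  proof -
    have "val i c = val i (u * x ^ k)" using val_cong[OF _ uxk L] c(1) by simp
    also have "\<dots> = k * val i x"
      using val_mult[OF i uS S_minus_L_power[OF x_in]] val_power[OF i x_in] unit_val[OF i] by simp
    finally show ?thesis .
  qed
  from this[of Center_place] this[of Minor_place] val_c[of Center_place] val_c[of Minor_place]
  show ?thesis using val_x(1,2) by (simp del: val_simps)
qed

end

section \<open>The class group of the star ring\<close>

lemma mpoly_ring_cring: "cring (mpoly_ring K V)"
proof (rule cringI)
  show "abelian_group (mpoly_ring K V)"
  proof (rule abelian_groupI)
    fix p assume p: "p \<in> carrier (mpoly_ring K V)"
    then have "- p \<in> carrier (mpoly_ring K V)"
      using mpolys_uminus[of p V] by (simp add: mpoly_ring_def mpolys_def)
    then show "\<exists>q\<in>carrier (mpoly_ring K V). q \<oplus>\<^bsub>mpoly_ring K V\<^esub> p = \<zero>\<^bsub>mpoly_ring K V\<^esub>"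
      by (intro bexI[of _ "- p"]) (simp_all add: mpoly_ring_def)
  next
    fix p q assume "p \<in> carrier (mpoly_ring K V)" "q \<in> carrier (mpoly_ring K V)"
    then show "p \<oplus>\<^bsub>mpoly_ring K V\<^esub> q \<in> carrier (mpoly_ring K V)"
      using mpolys_add[of p V q] by (simp add: mpoly_ring_def mpolys_def)
  qed (simp_all add: mpoly_ring_def ac_simps)
  show "comm_monoid (mpoly_ring K V)"
  proof (rule comm_monoidI)
    fix p q assume "p \<in> carrier (mpoly_ring K V)" "q \<in> carrier (mpoly_ring K V)"
    then show "p \<otimes>\<^bsub>mpoly_ring K V\<^esub> q \<in> carrier (mpoly_ring K V)"
      using mpolys_mult[of p V q] by (simp add: mpoly_ring_def mpolys_def)
  next
    show "\<one>\<^bsub>mpoly_ring K V\<^esub> \<in> carrier (mpoly_ring K V)"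
      using mpolys_1[of V] by (simp add: mpoly_ring_def mpolys_def)
  qed (simp_all add: mpoly_ring_def ac_simps)
qed (simp add: mpoly_ring_def distrib_right)

lemma carrier_mpoly_ring: "carrier (mpoly_ring K V) = mpolys V"
  by (simp add: mpoly_ring_def mpolys_def)

context star_ring
begin

abbreviation A :: "'k ypoly ring" where "A \<equiv> LSS_base K n n"
abbreviation I :: "'k ypoly set" where "I \<equiv> LSS_ideal K n (star_edges n) n"
abbreviation R :: "'k ypoly set ring" where "R \<equiv> LSS_ring K n (star_edges n) n"

sublocale A: cring A
  unfolding LSS_base_def by (rule mpoly_ring_cring)

lemma A_simps [simp]:
  "carrier A = S" "a \<otimes>\<^bsub>A\<^esub> b = a * b" "a \<oplus>\<^bsub>A\<^esub> b = a + b" "\<one>\<^bsub>A\<^esub> = 1" "\<zero>\<^bsub>A\<^esub> = 0"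
  by (simp_all add: LSS_base_def carrier_mpoly_ring) (simp_all add: mpoly_ring_def)

lemma A_uminus: "a \<in> S \<Longrightarrow> \<ominus>\<^bsub>A\<^esub> a = - a"
  by (rule A.minus_equality) simp_all

lemma A_minus: "a \<in> S \<Longrightarrow> b \<in> S \<Longrightarrow> a \<ominus>\<^bsub>A\<^esub> b = a - b"
  by (simp add: a_minus_def A_uminus)

lemma S_L_ideal: "ideal (S \<inter> L) A"
proof (rule idealI)
  show "ring A" by (rule A.ring_axioms)
  show "subgroup (S \<inter> L) (add_monoid A)"
  proof (rule A.add.subgroupI)
    have "0 \<in> S \<inter> L" by (intro IntI mpolys_0 star_ideal_0)
    then show "S \<inter> L \<subseteq> carrier A" "S \<inter> L \<noteq> {}" unfolding A_simps by blast+
    show "\<ominus>\<^bsub>A\<^esub> a \<in> S \<inter> L" if "a \<in> S \<inter> L" for a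
      using that star_ideal_diff[of 0 n "n - 1" n a] by (simp add: A_uminus)
    show "a \<oplus>\<^bsub>A\<^esub> b \<in> S \<inter> L" if "a \<in> S \<inter> L" "b \<in> S \<inter> L" for a b
      using that star_ideal_add[of a n "n - 1" n b] by simp
  qed
  show "b \<otimes>\<^bsub>A\<^esub> a \<in> S \<inter> L" "a \<otimes>\<^bsub>A\<^esub> b \<in> S \<inter> L" if "a \<in> S \<inter> L" "b \<in> carrier A" for a b
    using that star_ideal_mult[of a n "n - 1" n b] by (simp_all add: mult.commute)
qed

lemma LSS_poly_commute: "LSS_poly d i j = (LSS_poly d j i :: 'k ypoly)"
  by (simp add: LSS_poly_def mult.commute)

lemma generators: "{LSS_poly n i j | i j. {i, j} \<in> star_edges n} = (\<lambda>i. LSS_poly n i n :: 'k ypoly) ` {1..n - 1}"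
proof (intro equalityI subsetI)
  fix f :: "'k ypoly" assume "f \<in> {LSS_poly n i j | i j. {i, j} \<in> star_edges n}"
  then obtain i j k where f: "f = LSS_poly n i j" "{i, j} = {k, n}" "1 \<le> k" "k \<le> n - 1"
    by (auto simp: star_edges_def)
  then consider "i = k" "j = n" | "i = n" "j = k" by (auto simp: doubleton_eq_iff)
  then have "f = LSS_poly n k n" by cases (simp_all add: f(1) LSS_poly_commute[of n n k])
  then show "f \<in> (\<lambda>i. LSS_poly n i n) ` {1..n - 1}" using f(3,4) by auto
next
  fix f :: "'k ypoly" assume "f \<in> (\<lambda>i. LSS_poly n i n) ` {1..n - 1}"
  then obtain i where i: "i \<in> {1..n - 1}" "f = LSS_poly n i n" by (elim imageE)
  then have "{i, n} \<in> star_edges n" by (auto simp: star_edges_def)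
  then show "f \<in> {LSS_poly n i j | i j. {i, j} \<in> star_edges n}" using i(2) by blast
qed

lemma generators_in_S: "(\<lambda>i. LSS_poly n i n) ` {1..n - 1} \<subseteq> S"
  using n by (auto intro!: LSS_poly_in_mpolys)

text \<open>
  Setting all variables outside \<open>{1..n} \<times> {1..n}\<close> to zero turns a combination of the forms with arbitrary
  coefficients into one with coefficients in \<open>S\<close>.
\<close>

lemma LSS_ideal_eq: "I = S \<inter> L"
proof
  show "I \<subseteq> S \<inter> L"
    unfolding LSS_ideal_def generators
    by (rule A.genideal_minimal[OF S_L_ideal]) (use generators_in_S in \<open>auto intro: star_ideal_gen\<close>)
  have I: "ideal I A" unfolding LSS_ideal_def generators
    by (rule A.genideal_ideal) (use generators_in_S in simp)
  interpret I: ideal I A by (rule I)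
  have gen: "LSS_poly n i n \<in> I" if "i \<in> {1..n - 1}" for i
    unfolding LSS_ideal_def generators
    by (rule subsetD[OF A.genideal_self]) (use that generators_in_S in auto)
  interpret kill: comm_ring_hom "kill (- ({1..n} \<times> {1..n})) :: 'k ypoly \<Rightarrow> _" by (rule kill_hom)
  show "S \<inter> L \<subseteq> I"
  proof
    fix a assume a: "a \<in> S \<inter> L"
    then obtain c where c: "a = (\<Sum>i=1..n - 1. c i * LSS_poly n i n)" by (auto elim: star_idealE)
    let ?k = "kill (- ({1..n} \<times> {1..n})) :: 'k ypoly \<Rightarrow> _"
    have "a = ?k a" using a by (simp add: kill_free[of a "{1..n} \<times> {1..n}"])
    also have "\<dots> = (\<Sum>i=1..n - 1. ?k (c i) * ?k (LSS_poly n i n))"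
      unfolding c kill.hom_sum kill.hom_mult by (rule refl)
    also have "\<dots> = (\<Sum>i=1..n - 1. ?k (c i) * LSS_poly n i n)"
    proof (rule sum.cong[OF refl])
      fix i assume "i \<in> {1..n - 1}"
      then have "LSS_poly n i n \<in> S" using generators_in_S by blast
      then show "?k (c i) * ?k (LSS_poly n i n) = ?k (c i) * LSS_poly n i n"
        by (simp add: kill_free[of "LSS_poly n i n" "{1..n} \<times> {1..n}"])
    qed
    also have "(\<Sum>i\<in>F. ?k (c i) * LSS_poly n i n) \<in> I" if "finite F" "F \<subseteq> {1..n - 1}" for F
      using that
    proof (induction F)
      case empty
      then show ?case using I.zero_closed by simp
    next
      case (insert i F)
      have "?k (c i) \<otimes>\<^bsub>A\<^esub> LSS_poly n i n \<in> I"
        using insert.prems by (intro I.I_l_closed gen) (simp_all add: mpolys_kill)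
      moreover have "(\<Sum>i\<in>F. ?k (c i) * LSS_poly n i n) \<in> I" using insert by simp
      ultimately have "?k (c i) \<otimes>\<^bsub>A\<^esub> LSS_poly n i n \<oplus>\<^bsub>A\<^esub> (\<Sum>i\<in>F. ?k (c i) * LSS_poly n i n) \<in> I"
        by (rule I.a_closed)
      then show ?case using insert.hyps by simp
    qed
    from this[of "{1..n - 1}"] have "(\<Sum>i=1..n - 1. ?k (c i) * LSS_poly n i n) \<in> I" by simp
    finally show "a \<in> I" .
  qed
qed

lemma I_prime: "primeideal I A"
proof (rule primeidealI)
  show "ideal I A" unfolding LSS_ideal_eq by (rule S_L_ideal)
  show "cring A" by (rule A.is_cring)
  show "carrier A \<noteq> I"
  proof
    assume "carrier A = I"
    then have "1 \<in> I" using mpolys_1 by (metis A_simps(1))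
    then show False using one_in unfolding LSS_ideal_eq by blast
  qed
  show "a \<in> I \<or> b \<in> I" if "a \<in> carrier A" "b \<in> carrier A" "a \<otimes>\<^bsub>A\<^esub> b \<in> I" for a b
  proof -
    have "a \<in> S" "b \<in> S" using that(1,2) unfolding A_simps by simp_all
    moreover have "a * b \<in> L" using that(3) unfolding LSS_ideal_eq A_simps by blast
    ultimately show ?thesis using S_minus_L_mult[of a b] unfolding LSS_ideal_eq by blast
  qed
qed

interpretation I: primeideal I A
  by (rule I_prime)

lemma R_eq: "R = A Quot I"
  by (simp add: LSS_ring_def)

lemma R_domain: "domain R"
  unfolding R_eq by (rule I.quotient_is_domain)

definition cls :: "'k ypoly \<Rightarrow> 'k ypoly set" where
  "cls a = I +>\<^bsub>A\<^esub> a"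

lemma cls_hom: "cls \<in> Ring.ring_hom A R"
proof -
  have "cls = (+>\<^bsub>A\<^esub>) I" by (simp add: fun_eq_iff cls_def)
  then show ?thesis unfolding R_eq using I.rcos_ring_hom by simp
qed

lemma cls_closed: "a \<in> S \<Longrightarrow> cls a \<in> carrier R"
  and cls_mult: "a \<in> S \<Longrightarrow> b \<in> S \<Longrightarrow> cls a \<otimes>\<^bsub>R\<^esub> cls b = cls (a * b)"
  and cls_add: "a \<in> S \<Longrightarrow> b \<in> S \<Longrightarrow> cls a \<oplus>\<^bsub>R\<^esub> cls b = cls (a + b)"
  using ring_hom_closed[OF cls_hom] ring_hom_mult[OF cls_hom] ring_hom_add[OF cls_hom] by auto

lemma cls_eq_iff: "a \<in> S \<Longrightarrow> b \<in> S \<Longrightarrow> cls a = cls b \<longleftrightarrow> a - b \<in> L"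
  using A.quotient_eq_iff_same_a_r_cos[OF I.is_ideal, of a b]
  by (simp add: cls_def A_minus LSS_ideal_eq)

lemma cls_0: "cls 0 = \<zero>\<^bsub>R\<^esub>"
proof -
  have "cls 0 = I" unfolding cls_def using A.a_rcos_zero[OF I.is_ideal I.zero_closed] by simp
  then show ?thesis by (simp add: R_eq FactRing_def)
qed

lemma cls_eq_0_iff: "a \<in> S \<Longrightarrow> cls a = \<zero>\<^bsub>R\<^esub> \<longleftrightarrow> a \<in> L"
  using cls_eq_iff[of a 0] by (simp add: cls_0)

lemma R_cases:
  assumes "B \<in> carrier R"
  obtains a where "a \<in> S" "B = cls a"
  using assms by (auto simp: R_eq FactRing_def A_RCOSETS_def' cls_def)

lemma R_nonzero_cases:
  assumes "B \<in> carrier R - {\<zero>\<^bsub>R\<^esub>}"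
  obtains a where "a \<in> S - L" "B = cls a"
proof -
  have "B \<in> carrier R" using assms by blast
  then obtain a where a: "a \<in> S" "B = cls a" by (rule R_cases)
  then have "a \<notin> L" using assms cls_eq_0_iff[OF a(1)] by blast
  then show ?thesis using a by (intro that[of a]) simp_all
qed

definition cls_val :: "'k ypoly place \<Rightarrow> 'k ypoly set \<Rightarrow> nat" where
  "cls_val i B = val i (SOME a. a \<in> S \<and> B = cls a)"

text \<open>
  Any representative may be used, since all valuations factor through the star ring.
\<close>

lemma cls_val: "a \<in> S \<Longrightarrow> cls_val i (cls a) = val i a"
proof -
  assume a: "a \<in> S"
  have "\<exists>b. b \<in> S \<and> cls a = cls b" using a by blast
  define b where "b = (SOME b. b \<in> S \<and> cls a = cls b)"
  from someI_ex[OF \<open>\<exists>b. b \<in> S \<and> cls a = cls b\<close>]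
  have b: "b \<in> S" "cls a = cls b" unfolding b_def by blast+
  have "a - b \<in> L" using cls_eq_iff[OF a b(1)] b(2) by simp
  then have "val i a = val i b" by (rule val_cong[OF a b(1)])
  then show ?thesis by (simp only: cls_val_def b_def)
qed

lemma cls_nonzero: "a \<in> S - L \<Longrightarrow> cls a \<in> carrier R - {\<zero>\<^bsub>R\<^esub>}"
  using cls_closed cls_eq_0_iff by auto

lemma R_krull_family: "krull_family R places cls_val"
proof (intro krull_family.intro krull_family_axioms.intro)
  show "domain R" by (rule R_domain)
next
  fix i B Y assume "i \<in> places" "B \<in> carrier R - {\<zero>\<^bsub>R\<^esub>}" "Y \<in> carrier R - {\<zero>\<^bsub>R\<^esub>}"
  then show "cls_val i (B \<otimes>\<^bsub>R\<^esub> Y) = cls_val i B + cls_val i Y"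
    by (elim R_nonzero_cases) (simp add: cls_mult cls_val val_mult del: val_simps)
next
  fix i B Y assume i: "i \<in> places" and B: "B \<in> carrier R - {\<zero>\<^bsub>R\<^esub>}" and Y: "Y \<in> carrier R - {\<zero>\<^bsub>R\<^esub>}"
    and XY: "B \<oplus>\<^bsub>R\<^esub> Y \<noteq> \<zero>\<^bsub>R\<^esub>"
  obtain a where a: "a \<in> S - L" "B = cls a" using B by (rule R_nonzero_cases)
  obtain b where b: "b \<in> S - L" "Y = cls b" using Y by (rule R_nonzero_cases)
  have "a + b \<notin> L" using XY a b cls_eq_0_iff[of "a + b"] by (simp add: cls_add)
  then show "min (cls_val i B) (cls_val i Y) \<le> cls_val i (B \<oplus>\<^bsub>R\<^esub> Y)"
    using val_add[OF i a(1) b(1)] a b by (simp add: cls_add cls_val del: val_simps)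
next
  fix B assume "B \<in> carrier R - {\<zero>\<^bsub>R\<^esub>}"
  then obtain a where a: "a \<in> S - L" "B = cls a" by (rule R_nonzero_cases)
  then show "finite {i \<in> places. cls_val i B \<noteq> 0}" using val_finite[OF a(1)] by (simp add: cls_val)
next
  fix B Y assume B: "B \<in> carrier R - {\<zero>\<^bsub>R\<^esub>}" and Y: "Y \<in> carrier R - {\<zero>\<^bsub>R\<^esub>}"
    and le: "\<And>i. i \<in> places \<Longrightarrow> cls_val i Y \<le> cls_val i B"
  obtain a where a: "a \<in> S - L" "B = cls a" using B by (rule R_nonzero_cases)
  obtain b where b: "b \<in> S - L" "Y = cls b" using Y by (rule R_nonzero_cases)
  have "val i b \<le> val i a" if "i \<in> places" for i using le[OF that] a b by (simp add: cls_val)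
  from val_divides[OF a(1) b(1) this] obtain c where c: "c \<in> S" "a - c * b \<in> L" by blast
  have "B = cls (c * b)" unfolding a(2) using a(1) b(1) c by (subst cls_eq_iff) auto
  also have "\<dots> = cls c \<otimes>\<^bsub>R\<^esub> Y" using b c by (simp add: cls_mult)
  finally show "\<exists>Z\<in>carrier R. B = Z \<otimes>\<^bsub>R\<^esub> Y" using cls_closed[OF c(1)] by blast
next
  fix i assume "i \<in> places"
  from val_uniformizer[OF this] obtain u where "u \<in> S - L" "val i u = 1" by blast
  then show "\<exists>U\<in>carrier R - {\<zero>\<^bsub>R\<^esub>}. cls_val i U = 1"
    by (intro bexI[of _ "cls u"] cls_nonzero) (simp_all add: cls_val)
next
  fix i j assume "i \<in> places" "j \<in> places" "i \<noteq> j"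
  from val_separate[OF this] obtain s where "s \<in> S - L" "val j s > 0" "val i s = 0" by blast
  then show "\<exists>s\<in>carrier R - {\<zero>\<^bsub>R\<^esub>}. cls_val j s > 0 \<and> cls_val i s = 0"
    by (intro bexI[of _ "cls s"] cls_nonzero) (simp_all add: cls_val)
qed

lemma R_noetherian: "noetherian_domain R"
proof -
  interpret R: domain R by (rule R_domain)
  interpret V: subdomain S by (rule mpolys_subdomain)
  have noeth: "V.noetherian" by (rule mpolys_noetherian) simp
  have pull: "V.ideal_in {a \<in> S. cls a \<in> J}" if J: "ideal J R" for J
  proof -
    interpret J: ideal J R by (rule J)
    show ?thesis unfolding V.ideal_in_def
    proof (intro conjI ballI)
      show "0 \<in> {a \<in> S. cls a \<in> J}" using J.zero_closed by (simp add: cls_0)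
      show "a + b \<in> {a \<in> S. cls a \<in> J}" if "a \<in> {a \<in> S. cls a \<in> J}" "b \<in> {a \<in> S. cls a \<in> J}" for a b
        using that J.a_closed[of "cls a" "cls b"] by (simp add: cls_add)
      show "a * b \<in> {a \<in> S. cls a \<in> J}" if "a \<in> S" "b \<in> {a \<in> S. cls a \<in> J}" for a b
        using that J.I_l_closed[of "cls b" "cls a"] cls_closed by (simp add: cls_mult)
    qed
  qed
  have "noetherian_ring R"
  proof (rule R.noetherian_ringI)
    fix J assume J: "ideal J R"
    have "\<exists>G. finite G \<and> G \<subseteq> {a \<in> S. cls a \<in> J} \<and> {a \<in> S. cls a \<in> J} = V.ideal_in hull G"
      by (intro noeth[unfolded V.noetherian_def, rule_format] conjI pull[OF J]) auto
    then obtain G where G: "finite G" "G \<subseteq> {a \<in> S. cls a \<in> J}" "{a \<in> S. cls a \<in> J} = V.ideal_in hull G"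
      by (elim exE conjE)
    have GR: "cls ` G \<subseteq> carrier R" using G(2) cls_closed by blast
    have idl: "ideal (Idl\<^bsub>R\<^esub> (cls ` G)) R" by (rule R.genideal_ideal[OF GR])
    have "V.ideal_in hull G \<subseteq> {a \<in> S. cls a \<in> Idl\<^bsub>R\<^esub> (cls ` G)}"
    proof (rule hull_minimal)
      show "V.ideal_in {a \<in> S. cls a \<in> Idl\<^bsub>R\<^esub> (cls ` G)}" by (rule pull[OF idl])
      show "G \<subseteq> {a \<in> S. cls a \<in> Idl\<^bsub>R\<^esub> (cls ` G)}" using G(2) R.genideal_self[OF GR] by blast
    qed
    then have sub: "cls a \<in> Idl\<^bsub>R\<^esub> (cls ` G)" if "a \<in> S" "cls a \<in> J" for a
      using that unfolding G(3)[symmetric] by auto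
    have "J \<subseteq> Idl\<^bsub>R\<^esub> (cls ` G)"
    proof
      fix B assume B: "B \<in> J"
      then have "B \<in> carrier R" by (rule ideal.Icarr[OF J])
      then obtain a where "a \<in> S" "B = cls a" by (rule R_cases)
      then show "B \<in> Idl\<^bsub>R\<^esub> (cls ` G)" using sub B by blast
    qed
    moreover have "Idl\<^bsub>R\<^esub> (cls ` G) \<subseteq> J"
      by (rule R.genideal_minimal[OF J]) (use G(2) in blast)
    ultimately show "\<exists>F\<subseteq>carrier R. finite F \<and> J = Idl\<^bsub>R\<^esub> F"
      using G(1) GR by (intro exI[of _ "cls ` G"]) auto
  qed
  then show ?thesis by (intro noetherian_domain.intro R_domain)
qed

lemma R_class_group: "class_group R \<cong> integer_group"
proof -
  interpret krull_family R places cls_val by (rule R_krull_family)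
  define u where "u i = (case i of Chart_prime p \<Rightarrow> SOME u. u \<in> S - L \<and>
      (\<forall>q. Chart_prime q \<in> places \<longrightarrow> val (Chart_prime q) u = (if q = p then 1 else 0)) | _ \<Rightarrow> 1)" for i
  have u: "u (Chart_prime p) \<in> S - L \<and>
      (\<forall>q. Chart_prime q \<in> places \<longrightarrow> val (Chart_prime q) (u (Chart_prime p)) = (if q = p then 1 else 0))"
    if "Chart_prime p \<in> places" for p
  proof -
    have "\<exists>u. u \<in> S - L \<and> (\<forall>q. Chart_prime q \<in> places \<longrightarrow> val (Chart_prime q) u = (if q = p then 1 else 0))"
      using prime_representative[OF that] by blast
    from someI_ex[OF this] show ?thesis by (simp add: u_def)
  qed
  have ordinary: "\<exists>p. i = Chart_prime p \<and> Chart_prime p \<in> places" if "i \<in> places - {Center_place, Minor_place}" for i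
    using that by (cases i) auto
  show ?thesis
  proof (rule class_group_integers[of Center_place Minor_place "cls x" "\<lambda>i. cls (u i)"])
    show "Center_place \<in> places" "Minor_place \<in> places" "Center_place \<noteq> Minor_place" by simp_all
    show "cls x \<in> carrier R - {\<zero>\<^bsub>R\<^esub>}" by (rule cls_nonzero[OF x_in])
    show "cls_val Center_place (cls x) = 1" "cls_val Minor_place (cls x) = 1"
      unfolding cls_val[OF x_in_S] by (rule val_x)+
    show "cls_val i (cls x) = 0" if i: "i \<in> places - {Center_place, Minor_place}" for i
    proof -
      obtain p where p: "i = Chart_prime p" "Chart_prime p \<in> places"
        using ordinary[OF i] by (elim exE conjE)
      show ?thesis unfolding cls_val[OF x_in_S] p(1) by (rule val_x(3)[OF p(2)])
    qed
  next
    fix i assume i: "i \<in> places - {Center_place, Minor_place}"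
    then obtain p where p: "i = Chart_prime p" "Chart_prime p \<in> places"
      using ordinary[OF i] by (elim exE conjE)
    show "cls (u i) \<in> carrier R - {\<zero>\<^bsub>R\<^esub>}"
      unfolding p(1) by (rule cls_nonzero[OF u[OF p(2), THEN conjunct1]])
    fix j assume j: "j \<in> places - {Center_place, Minor_place}"
    obtain q where q: "j = Chart_prime q" "Chart_prime q \<in> places"
      using ordinary[OF j] by (elim exE conjE)
    have uS: "u (Chart_prime p) \<in> S" using u[OF p(2)] by blast
    have "val (Chart_prime q) (u (Chart_prime p)) = (if q = p then 1 else 0)"
      using u[OF p(2)] q(2) by blast
    then show "cls_val j (cls (u i)) = (if j = i then 1 else 0)"
      unfolding p(1) q(1) cls_val[OF uS] by simp
  next
    fix B Y assume B: "B \<in> carrier R - {\<zero>\<^bsub>R\<^esub>}" and Y: "Y \<in> carrier R - {\<zero>\<^bsub>R\<^esub>}"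
      and eq: "\<And>i. i \<in> places - {Center_place, Minor_place} \<Longrightarrow> cls_val i B = cls_val i Y"
    obtain a where a: "a \<in> S - L" "B = cls a" using B by (rule R_nonzero_cases)
    obtain b where b: "b \<in> S - L" "Y = cls b" using Y by (rule R_nonzero_cases)
    have "val (Chart_prime p) a = val (Chart_prime p) b" if "Chart_prime p \<in> places" for p
      using eq[of "Chart_prime p"] that a b by (simp add: cls_val)
    from special_values_determined[OF a(1) b(1) this]
    show "cls_val Center_place B + cls_val Minor_place Y = cls_val Center_place Y + cls_val Minor_place B"
      using a b by (simp add: cls_val)
  qed
qed

end

theorem proposition5p5:
  fixes K :: "'k::field itself" and n :: nat
  assumes "n \<ge> 2"
  shows "noetherian_domain (LSS_ring K n (star_edges n) n) \<and>
         normal_domain (LSS_ring K n (star_edges n) n) \<and>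
         class_group (LSS_ring K n (star_edges n) n) \<cong> integer_group"
proof -
  interpret star_ring n K by unfold_locales (rule assms)
  interpret krull_family R places cls_val by (rule R_krull_family)
  show ?thesis using R_noetherian is_normal R_class_group by blast
qed

end
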